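(* Let $X$ be a locally semiconvex, locally differentiable G-space. Then $X$ is a topological manifold admitting a canonical atlas that is both $C^1$ and DC, and a continuous Finsler metric $F:TX\to\mathbb R$ that is compatible with the original distance $d$ of $X$.
   Context: A shortest path is an isometric embedding of an interval into a metric space (so it has unit speed); a geodesic space is a metric space in which any two points are joined by a shortest path. Write $|xy|=d(x,y)$. G-space: a metric space $X$ such that (1) for any distinct $x,y\in X$ there is $z\in X\setminus\{x,y\}$ with $|xz|+|zy|=|xy|$; (2) every bounded infinite subset of $X$ has an accumulation point; (3) every point has an open neighborhood $U$ such that for any $x,y\in U$ there is $z\in U\setminus\{x,y\}$ with $|xy|+|yz|=|xz|$; (4) for any distinct $x,y\in X$, if $z_1,z_2\in X$ satisfy $|xy|+|yz_i|=|xz_i|$ and $|yz_1|=|yz_2|$, then $z_1=z_2$. Equivalently: a complete, locally compact geodesic space in which every point has an open neighborhood $U$ such that any shortest path in $U$ admits a unique maximal extension (as a shortest path) reaching $\partial U$. Locally semiconvex: a geodesic space $X$ is locally semiconvex if for every $x\in X$ there exist $\lambda\in\mathbb R$ and a neighborhood $U$ of $x$ such that for any $p\in U$ and any unit-speed shortest path $\gamma(t)$ in $U$, the function $t\mapsto |p\gamma(t)|^2+\lambda t^2$ is convex. Locally differentiable: every point of $X$ has a neighborhood $U$ such that for any $p\in U$ and any shortest path $\gamma(t)$ in $U$, the function $t\mapsto|p\gamma(t)|^2$ is differentiable (continuity of the derivative is not assumed). A function on an open subset of $\mathbb R^n$ is semiconcave if it is locally Lipschitz and every point has a neighborhood on which,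 for some $\lambda>0$, $f\circ\gamma(t)-\lambda t^2$ is concave for every unit-speed line segment $\gamma$; it is DC if it is locally a difference of two semiconcave functions. An atlas of a topological manifold is $C^1$ (resp. DC) if the coordinate transformations (and their inverses) preserve the class of $C^1$ (resp. DC) functions, i.e. they are $C^1$ diffeomorphisms (resp. locally bi-Lipschitz homeomorphisms that are DC in both directions). The atlas on the geodesic space $X$ is canonical if every point of $X$ has a neighborhood $U$ such that for every $p\in U$ the squared distance function $d(p,\cdot)^2$ on $U$ is $C^1$ and DC in the local coordinates of the atlas. For a $C^1$ manifold $X$, a Finsler metric is a function $F:TX\to\mathbb R$ on the tangent bundle whose restriction to each fiber $T_xX$ is a norm. It is continuous if it is continuous on $TX$. It is compatible with $d$ if $d(p,q)=\inf_c\int_0^1F(c(t),c'(t))\,dt$ for all $p,q$, where $c:[0,1]\to X$ runs over all $C^1$ curves from $p$ to $q$. *)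

theory Defs
  imports "HOL-Analysis.Analysis"
begin

definition G_space :: "'a::metric_space itself \<Rightarrow> bool" where
  "G_space _ \<longleftrightarrow>
     (\<forall>x y::'a. x \<noteq> y \<longrightarrow> (\<exists>z. z \<notin> {x, y} \<and> dist x z + dist z y = dist x y)) \<and>
     (\<forall>S::'a set. bounded S \<and> infinite S \<longrightarrow> (\<exists>x. x islimpt S)) \<and>
     (\<forall>p::'a. \<exists>U. open U \<and> p \<in> U \<and>
        (\<forall>x\<in>U. \<forall>y\<in>U. \<exists>z\<in>U - {x, y}. dist x y + dist y z = dist x z)) \<and>
     (\<forall>x y z1 z2::'a. x \<noteq> y \<and>
        dist x y + dist y z1 = dist x z1 \<and> dist x y + dist y z2 = dist x z2 \<and>
        dist y z1 = dist y z2 \<longrightarrow> z1 = z2)"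

definition shortest_path :: "real set \<Rightarrow> (real \<Rightarrow> 'a::metric_space) \<Rightarrow> bool" where
  "shortest_path I \<gamma> \<longleftrightarrow>
     is_interval I \<and> (\<forall>s\<in>I. \<forall>t\<in>I. dist (\<gamma> s) (\<gamma> t) = \<bar>s - t\<bar>)"

definition locally_semiconvex :: "'a::metric_space itself \<Rightarrow> bool" where
  "locally_semiconvex _ \<longleftrightarrow>
     (\<forall>x::'a. \<exists>lam::real. \<exists>U. open U \<and> x \<in> U \<and>
        (\<forall>p\<in>U. \<forall>I \<gamma>. shortest_path I \<gamma> \<and> \<gamma> ` I \<subseteq> U \<longrightarrow>
           convex_on I (\<lambda>t. (dist p (\<gamma> t))\<^sup>2 + lam * t\<^sup>2)))"

text \<open>At an endpoint belonging to the interval the derivative is the one-sided one.\<close>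

definition locally_differentiable :: "'a::metric_space itself \<Rightarrow> bool" where
  "locally_differentiable _ \<longleftrightarrow>
     (\<forall>x::'a. \<exists>U. open U \<and> x \<in> U \<and>
        (\<forall>p\<in>U. \<forall>I \<gamma>. shortest_path I \<gamma> \<and> \<gamma> ` I \<subseteq> U \<longrightarrow>
           (\<lambda>t. (dist p (\<gamma> t))\<^sup>2) differentiable_on I))"

text \<open>
  The dimension of the manifold is existentially quantified, so it cannot be a type: n-dimensional
  space is the library's \<^const>\<open>Euclidean_space\<close>, whose points are the sequences of reals
  that vanish from index \<open>n\<close> on. Its vector operations are written out componentwise.
  In the definitions below \<open>\<Omega>\<close> is meant to be open in it; values of functions outside
  \<open>\<Omega>\<close> are irrelevant.
\<close>

definition enorm :: "nat \<Rightarrow> (nat \<Rightarrow> real) \<Rightarrow> real" where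
  "enorm n v = L2_set v {..<n}"

definition edist :: "nat \<Rightarrow> (nat \<Rightarrow> real) \<Rightarrow> (nat \<Rightarrow> real) \<Rightarrow> real" where
  "edist n x y = enorm n (\<lambda>i. x i - y i)"

definition partial_deriv :: "nat \<Rightarrow> ((nat \<Rightarrow> real) \<Rightarrow> real) \<Rightarrow> (nat \<Rightarrow> real) \<Rightarrow> real" where
  "partial_deriv i f x = deriv (\<lambda>t. f (x(i := t))) (x i)"

definition C1_function :: "nat \<Rightarrow> (nat \<Rightarrow> real) set \<Rightarrow> ((nat \<Rightarrow> real) \<Rightarrow> real) \<Rightarrow> bool" where
  "C1_function n \<Omega> f \<longleftrightarrow>
     (\<forall>i<n. (\<forall>x\<in>\<Omega>. (\<lambda>t. f (x(i := t))) differentiable (at (x i))) \<and>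
            continuous_map (subtopology (Euclidean_space n) \<Omega>) euclideanreal (partial_deriv i f))"

definition locally_lipschitz :: "nat \<Rightarrow> (nat \<Rightarrow> real) set \<Rightarrow> ((nat \<Rightarrow> real) \<Rightarrow> real) \<Rightarrow> bool" where
  "locally_lipschitz n \<Omega> f \<longleftrightarrow>
     (\<forall>x\<in>\<Omega>. \<exists>W L. openin (Euclidean_space n) W \<and> x \<in> W \<and> W \<subseteq> \<Omega> \<and>
        (\<forall>y\<in>W. \<forall>z\<in>W. \<bar>f y - f z\<bar> \<le> L * edist n y z))"

definition semiconcave :: "nat \<Rightarrow> (nat \<Rightarrow> real) set \<Rightarrow> ((nat \<Rightarrow> real) \<Rightarrow> real) \<Rightarrow> bool" where
  "semiconcave n \<Omega> f \<longleftrightarrow>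
     locally_lipschitz n \<Omega> f \<and>
     (\<forall>x\<in>\<Omega>. \<exists>W. openin (Euclidean_space n) W \<and> x \<in> W \<and> W \<subseteq> \<Omega> \<and>
        (\<exists>lam>0. \<forall>a\<in>topspace (Euclidean_space n). \<forall>v\<in>topspace (Euclidean_space n). \<forall>I.
           enorm n v = 1 \<and> is_interval I \<and> (\<forall>t\<in>I. (\<lambda>i. a i + t * v i) \<in> W) \<longrightarrow>
           concave_on I (\<lambda>t. f (\<lambda>i. a i + t * v i) - lam * t\<^sup>2)))"

definition DC_function :: "nat \<Rightarrow> (nat \<Rightarrow> real) set \<Rightarrow> ((nat \<Rightarrow> real) \<Rightarrow> real) \<Rightarrow> bool" where
  "DC_function n \<Omega> f \<longleftrightarrow>
     (\<forall>x\<in>\<Omega>. \<exists>W g h. openin (Euclidean_space n) W \<and> x \<in> W \<and> W \<subseteq> \<Omega> \<and>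
        semiconcave n W g \<and> semiconcave n W h \<and> (\<forall>y\<in>W. f y = g y - h y))"

definition C1_map ::
    "nat \<Rightarrow> (nat \<Rightarrow> real) set \<Rightarrow> ((nat \<Rightarrow> real) \<Rightarrow> nat \<Rightarrow> real) \<Rightarrow> bool" where
  "C1_map n \<Omega> \<tau> \<longleftrightarrow> (\<forall>i<n. C1_function n \<Omega> (\<lambda>y. \<tau> y i))"

definition DC_map ::
    "nat \<Rightarrow> (nat \<Rightarrow> real) set \<Rightarrow> ((nat \<Rightarrow> real) \<Rightarrow> nat \<Rightarrow> real) \<Rightarrow> bool" where
  "DC_map n \<Omega> \<tau> \<longleftrightarrow> (\<forall>i<n. DC_function n \<Omega> (\<lambda>y. \<tau> y i))"

definition locally_bilipschitz ::
    "nat \<Rightarrow> (nat \<Rightarrow> real) set \<Rightarrow> ((nat \<Rightarrow> real) \<Rightarrow> nat \<Rightarrow> real) \<Rightarrow> bool" where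
  "locally_bilipschitz n \<Omega> \<tau> \<longleftrightarrow>
     (\<forall>x\<in>\<Omega>. \<exists>W. openin (Euclidean_space n) W \<and> x \<in> W \<and> W \<subseteq> \<Omega> \<and>
        (\<exists>L>0. \<forall>y\<in>W. \<forall>z\<in>W.
           edist n y z / L \<le> edist n (\<tau> y) (\<tau> z) \<and> edist n (\<tau> y) (\<tau> z) \<le> L * edist n y z))"

definition topological_manifold :: "nat \<Rightarrow> 'a topology \<Rightarrow> bool" where
  "topological_manifold n X \<longleftrightarrow>
     Hausdorff_space X \<and> second_countable X \<and>
     (\<forall>x\<in>topspace X. \<exists>U V. openin X U \<and> x \<in> U \<and> openin (Euclidean_space n) V \<and>
        subtopology X U homeomorphic_space subtopology (Euclidean_space n) V)"

text \<open>A chart is a pair of its domain and its coordinate map; the latter is total in HOL, but only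
  its values on the domain matter.\<close>

type_synonym 'a chart = "'a set \<times> ('a \<Rightarrow> nat \<Rightarrow> real)"

definition is_chart :: "nat \<Rightarrow> 'a::metric_space chart \<Rightarrow> bool" where
  "is_chart n = (\<lambda>(U, \<phi>). open U \<and> openin (Euclidean_space n) (\<phi> ` U) \<and>
     homeomorphic_map (top_of_set U) (subtopology (Euclidean_space n) (\<phi> ` U)) \<phi>)"

definition atlas :: "nat \<Rightarrow> 'a::metric_space chart set \<Rightarrow> bool" where
  "atlas n A \<longleftrightarrow> (\<forall>c\<in>A. is_chart n c) \<and> (\<Union>c\<in>A. fst c) = UNIV"

definition chart_inv :: "'a chart \<Rightarrow> (nat \<Rightarrow> real) \<Rightarrow> 'a" where
  "chart_inv c = inv_into (fst c) (snd c)"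

definition transition :: "'a chart \<Rightarrow> 'a chart \<Rightarrow> (nat \<Rightarrow> real) \<Rightarrow> nat \<Rightarrow> real" where
  "transition c c' = snd c' \<circ> chart_inv c"

definition overlap :: "'a chart \<Rightarrow> 'a chart \<Rightarrow> (nat \<Rightarrow> real) set" where
  "overlap c c' = snd c ` (fst c \<inter> fst c')"

text \<open>Coordinate transformations of an atlas are homeomorphisms, and the inverse of the one from
  \<open>c\<close> to \<open>c'\<close> is the one from \<open>c'\<close> to \<open>c\<close>. Since all ordered pairs
  of charts are considered, regularity of the inverses is included in both definitions.\<close>

definition C1_atlas :: "nat \<Rightarrow> 'a::metric_space chart set \<Rightarrow> bool" where
  "C1_atlas n A \<longleftrightarrow> atlas n A \<and>
     (\<forall>c\<in>A. \<forall>c'\<in>A. C1_map n (overlap c c') (transition c c'))"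

definition DC_atlas :: "nat \<Rightarrow> 'a::metric_space chart set \<Rightarrow> bool" where
  "DC_atlas n A \<longleftrightarrow> atlas n A \<and>
     (\<forall>c\<in>A. \<forall>c'\<in>A. locally_bilipschitz n (overlap c c') (transition c c') \<and>
                      DC_map n (overlap c c') (transition c c'))"

definition canonical_atlas :: "nat \<Rightarrow> 'a::metric_space chart set \<Rightarrow> bool" where
  "canonical_atlas n A \<longleftrightarrow> atlas n A \<and>
     (\<forall>x::'a. \<exists>U. open U \<and> x \<in> U \<and>
        (\<forall>p\<in>U. \<forall>c\<in>A.
           C1_function n (snd c ` (fst c \<inter> U)) (\<lambda>y. (dist p (chart_inv c y))\<^sup>2) \<and>
           DC_function n (snd c ` (fst c \<inter> U)) (\<lambda>y. (dist p (chart_inv c y))\<^sup>2)))"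

text \<open>
  A tangent vector at \<open>x\<close> assigns to every chart around \<open>x\<close> a coordinate vector,
  transforming by the Jacobian matrices of the coordinate transformations. It is set to \<open>0\<close>
  on everything that is not a chart of the atlas around \<open>x\<close>, so that it is determined by its
  coordinates and the vector space operations of the fibre are the pointwise ones.
\<close>

definition tangent_space ::
    "nat \<Rightarrow> 'a::metric_space chart set \<Rightarrow> 'a \<Rightarrow> ('a chart \<Rightarrow> nat \<Rightarrow> real) set" where
  "tangent_space n A x = {\<xi>.
     (\<forall>c. if c \<in> A \<and> x \<in> fst c then \<xi> c \<in> topspace (Euclidean_space n) else \<xi> c = (\<lambda>_. 0)) \<and>
     (\<forall>c\<in>A. \<forall>c'\<in>A. x \<in> fst c \<and> x \<in> fst c' \<longrightarrow>
        (\<forall>i<n. \<xi> c' i =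
           (\<Sum>j<n. partial_deriv j (\<lambda>y. transition c c' y i) (snd c x) * \<xi> c j)))}"

definition tangent_bundle ::
    "nat \<Rightarrow> 'a::metric_space chart set \<Rightarrow> ('a \<times> ('a chart \<Rightarrow> nat \<Rightarrow> real)) set" where
  "tangent_bundle n A = Sigma UNIV (tangent_space n A)"

text \<open>The topology for which the maps \<open>(x, \<xi>) \<mapsto> (\<phi> x, coordinates of \<xi>)\<close> are bundle
  charts: it is generated by the preimages of open sets under these maps.\<close>

definition tangent_topology ::
    "nat \<Rightarrow> 'a::metric_space chart set \<Rightarrow> ('a \<times> ('a chart \<Rightarrow> nat \<Rightarrow> real)) topology" where
  "tangent_topology n A = topology_generated_by
     {{(x, \<xi>) \<in> tangent_bundle n A. x \<in> fst c \<and> (snd c x, \<xi> c) \<in> W} | c W.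
        c \<in> A \<and> openin (prod_topology (Euclidean_space n) (Euclidean_space n)) W}"

definition finsler_metric ::
    "nat \<Rightarrow> 'a::metric_space chart set \<Rightarrow> ('a \<times> ('a chart \<Rightarrow> nat \<Rightarrow> real) \<Rightarrow> real) \<Rightarrow> bool" where
  "finsler_metric n A F \<longleftrightarrow>
     (\<forall>x. \<forall>\<xi>\<in>tangent_space n A x.
        0 \<le> F (x, \<xi>) \<and> (F (x, \<xi>) = 0 \<longleftrightarrow> \<xi> = (\<lambda>c i. 0)) \<and>
        (\<forall>a. F (x, \<lambda>c i. a * \<xi> c i) = \<bar>a\<bar> * F (x, \<xi>)) \<and>
        (\<forall>\<eta>\<in>tangent_space n A x. F (x, \<lambda>c i. \<xi> c i + \<eta> c i) \<le> F (x, \<xi>) + F (x, \<eta>)))"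

definition continuous_finsler_metric ::
    "nat \<Rightarrow> 'a::metric_space chart set \<Rightarrow> ('a \<times> ('a chart \<Rightarrow> nat \<Rightarrow> real) \<Rightarrow> real) \<Rightarrow> bool" where
  "continuous_finsler_metric n A F \<longleftrightarrow>
     finsler_metric n A F \<and> continuous_map (tangent_topology n A) euclideanreal F"

text \<open>Derivatives of curves at the endpoints \<open>0\<close> and \<open>1\<close> are one-sided.\<close>

definition C1_curve :: "nat \<Rightarrow> 'a::metric_space chart set \<Rightarrow> (real \<Rightarrow> 'a) \<Rightarrow> bool" where
  "C1_curve n A c \<longleftrightarrow> continuous_on {0..1} c \<and>
     (\<forall>(U, \<phi>)\<in>A. \<forall>i<n. \<exists>g. continuous_on {t\<in>{0..1}. c t \<in> U} g \<and>
        (\<forall>t\<in>{0..1}. c t \<in> U \<longrightarrow>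
           ((\<lambda>s. \<phi> (c s) i) has_real_derivative g t) (at t within {0..1})))"

definition velocity ::
    "nat \<Rightarrow> 'a::metric_space chart set \<Rightarrow> (real \<Rightarrow> 'a) \<Rightarrow> real \<Rightarrow> ('a chart \<Rightarrow> nat \<Rightarrow> real)" where
  "velocity n A c t = (\<lambda>(U, \<phi>) i.
     if (U, \<phi>) \<in> A \<and> c t \<in> U \<and> i < n
     then vector_derivative (\<lambda>s. \<phi> (c s) i) (at t within {0..1}) else 0)"

text \<open>The infimum is taken in the extended reals, where the infimum of the empty set is
  \<open>\<infinity>\<close>; so compatibility includes the existence of connecting curves.\<close>

definition compatible_with_dist ::
    "nat \<Rightarrow> 'a::metric_space chart set \<Rightarrow> ('a \<times> ('a chart \<Rightarrow> nat \<Rightarrow> real) \<Rightarrow> real) \<Rightarrow> bool" where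
  "compatible_with_dist n A F \<longleftrightarrow>
     (\<forall>p q. ereal (dist p q) =
        (INF c\<in>{c. C1_curve n A c \<and> c 0 = p \<and> c 1 = q}.
           ereal (integral {0..1} (\<lambda>t. F (c t, velocity n A c t)))))"

end

(*
  Near a point, geodesics extend to a definite length and are unique, so limits of short
  rescaled pairs of points exist and are realized by geodesics. Call a function regular if it
  is Lipschitz and if it is semiconvex and differentiable along geodesics; squared distances
  are regular. Semiconvexity and differentiability along the limit geodesic force difference
  quotients of regular functions along converging geodesics to converge. Hence the derivations
  of regular functions along geodesics at x form a vector space: follow one geodesic for time
  a/k, then a nearby one for time b/k, and pass to the limit. Finitely many squared distances
  separate pairs of points near x, so the space is finite-dimensional, and functions whose
  differentials form a basis give a bi-Lipschitz chart (onto by minimizing the distance to the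
  target) in which all regular functions and the distance itself are strictly differentiable.

  Let s be a sum of (1 + M(d_p^2 - r^2))^2 over many pairs of opposite points p at distance r
  from x. For large M it is strongly convex near x, and its differential vanishes at x since the
  distances to opposite points have opposite differentials. Adding s makes coordinates convex
  without changing their differentials at x. If k is geodesically convex and psi0 is convex with
  differential minus the sum of the coordinate differentials, then k + C psi0 is decreasing in each
  coordinate for large C. Since convex coordinates only decrease when passing from a segment
  to the geodesic, k + C psi0 is convex in the chart. So every regular function is DC.

  The Finsler norm of a tangent vector is the limit of distances over times. Geodesics are C1
  of constant norm, and the norm of the velocity of a C1 curve is its metric speed.
*)

theory Submission
  imports Defs "HOL-Homology.Homology"
begin

section \<open>Shortest paths in G-spaces\<close>

text \<open>There is no linear structure to start from: semiconvexity is one-sided, so regular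
  functions form only a cone, and derivatives of squared distances are not assumed continuous.
  Two-sided geodesics of uniform length close both gaps. A semiconvex function along such a geodesic
  is trapped between secants on the two sides of the base point, and differentiability makes the two
  bounds meet; thus derivatives pass to limits of geodesics. Axiom (4) makes those limits easy to
  control, since a geodesic is determined by its values at two times.

  The form (1 + M(d_p^2 - r^2))^2 has two reasons. Squaring contributes the square of the increment
  of d_p^2, with a factor M^2, while the loss of convexity is linear in M; so large M wins. And at x
  the inner factor equals 1, so the differential is 2M times that of d_p^2 and opposite points
  cancel.

  Uniform estimates near x are mostly obtained by contradiction: failing pairs are rescaled and a
  tangent vector at x is extracted.\<close>

lemma LIMSEQ_by_subseq:
  fixes f :: "nat \<Rightarrow> 'b::metric_space"
  assumes "\<And>r::nat \<Rightarrow> nat. strict_mono r \<Longrightarrow> \<exists>s::nat \<Rightarrow> nat. strict_mono s \<and> (\<lambda>k. f (r (s k))) \<longlonglongrightarrow> l"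
  shows "f \<longlonglongrightarrow> l"
proof (rule ccontr)
  assume "\<not> f \<longlonglongrightarrow> l"
  then obtain e where e: "e > 0" and "\<not> (\<exists>N. \<forall>n\<ge>N. dist (f n) l < e)"
    by (meson metric_LIMSEQ_I)
  then have inf: "infinite {n. \<not> dist (f n) l < e}"
    unfolding infinite_nat_iff_unbounded_le by auto
  define r where "r = enumerate {n. \<not> dist (f n) l < e}"
  have r: "strict_mono r"
    using inf by (simp add: r_def strict_mono_enumerate)
  have rn: "\<not> dist (f (r k)) l < e" for k
    using enumerate_in_set[OF inf, of k] by (simp add: r_def)
  obtain s where s: "strict_mono s" "(\<lambda>k. f (r (s k))) \<longlonglongrightarrow> l"
    using assms[OF r] by blast
  then obtain N where "\<forall>n\<ge>N. dist (f (r (s n))) l < e"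
    using e metric_LIMSEQ_D by blast
  then show False using rn by auto
qed

lemma shortest_path_dist:
  "shortest_path I \<gamma> \<Longrightarrow> s \<in> I \<Longrightarrow> t \<in> I \<Longrightarrow> dist (\<gamma> s) (\<gamma> t) = \<bar>s - t\<bar>"
  by (simp add: shortest_path_def)

lemma shortest_path_subset:
  "shortest_path I \<gamma> \<Longrightarrow> J \<subseteq> I \<Longrightarrow> is_interval J \<Longrightarrow> shortest_path J \<gamma>"
  by (auto simp: shortest_path_def)

lemma shortest_path_affine:
  assumes "shortest_path I \<gamma>" "is_interval J" "\<bar>a\<bar> = 1" "\<And>t. t \<in> J \<Longrightarrow> a * t + b \<in> I"
  shows "shortest_path J (\<lambda>t. \<gamma> (a * t + b))"
  unfolding shortest_path_def
proof (intro conjI ballI)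
  fix s t assume "s \<in> J" "t \<in> J"
  then have "dist (\<gamma> (a * s + b)) (\<gamma> (a * t + b)) = \<bar>(a * s + b) - (a * t + b)\<bar>"
    using assms by (intro shortest_path_dist) auto
  also have "(a * s + b) - (a * t + b) = a * (s - t)" by (simp add: algebra_simps)
  also have "\<bar>a * (s - t)\<bar> = \<bar>s - t\<bar>" using assms(3) by (simp add: abs_mult)
  finally show "dist (\<gamma> (a * s + b)) (\<gamma> (a * t + b)) = \<bar>s - t\<bar>" .
qed fact

lemma shortest_path_continuous_on: "shortest_path I \<gamma> \<Longrightarrow> continuous_on I \<gamma>"
  unfolding continuous_on_iff
  by (metis dist_real_def shortest_path_dist)

section \<open>Compactness and existence of shortest paths\<close>

locale gspace =
  fixes T :: "'a::metric_space itself"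
  assumes G_space: "G_space T"
begin

lemma between_exists:
  fixes x y :: 'a
  shows "x \<noteq> y \<Longrightarrow> \<exists>z. z \<notin> {x, y} \<and> dist x z + dist z y = dist x y"
  using G_space unfolding G_space_def by blast

lemma local_prolong:
  fixes p :: 'a
  obtains U where "open U" "p \<in> U"
    "\<And>x y. x \<in> U \<Longrightarrow> y \<in> U \<Longrightarrow> \<exists>z\<in>U - {x, y}. dist x y + dist y z = dist x z"
  using G_space unfolding G_space_def by meson

lemma prolong_unique:
  fixes x y z1 z2 :: 'a
  assumes "x \<noteq> y" "dist x y + dist y z1 = dist x z1" "dist x y + dist y z2 = dist x z2"
    "dist y z1 = dist y z2"
  shows "z1 = z2"
  using G_space assms unfolding G_space_def by blast

lemma closed_bounded_compact:
  fixes S :: "'a set"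
  assumes "closed S" "bounded S" shows "compact S"
  unfolding compact_eq_Bolzano_Weierstrass
proof (intro allI impI)
  fix A assume A: "infinite A \<and> A \<subseteq> S"
  then have "bounded A" using assms(2) bounded_subset by blast
  then obtain x where x: "x islimpt A"
    using A G_space unfolding G_space_def by blast
  then have "x \<in> S" using A assms(1) closed_limpt islimpt_subset by blast
  then show "\<exists>x\<in>S. x islimpt A" using x by blast
qed

lemma cball_compact: "compact (cball (x::'a) r)"
  by (simp add: closed_bounded_compact)

lemma bounded_subseq:
  fixes f :: "nat \<Rightarrow> 'a"
  assumes "\<And>k. f k \<in> cball x r"
  shows "\<exists>l s. strict_mono (s :: nat \<Rightarrow> nat) \<and> (\<lambda>k. f (s k)) \<longlonglongrightarrow> l"
proof -
  have "seq_compact (cball x r)" using cball_compact compact_eq_seq_compact_metric by blast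
  then show ?thesis using assms unfolding seq_compact_def o_def by metis
qed

lemma Cauchy_has_limit:
  fixes f :: "nat \<Rightarrow> 'a"
  assumes "Cauchy f" shows "\<exists>l. f \<longlonglongrightarrow> l"
proof -
  have "bounded (range f)" using assms cauchy_imp_bounded by blast
  then obtain x r where "\<And>k. f k \<in> cball x r"
    unfolding bounded_def by (metis mem_cball rangeI)
  then show ?thesis
    using assms cball_compact compact_imp_complete unfolding complete_def by (metis)
qed

text \<open>Menger's argument, stated for graphs of partial isometries so that a path can be made to
  pass through several given points, not only two. A maximal graph has closed domain by
  completeness, and a point between the two ends of a gap would enlarge it.\<close>

lemma isometric_extension:
  fixes R0 :: "(real \<times> 'a) set"
  assumes sub: "fst ` R0 \<subseteq> {s..t}" and st: "s \<in> fst ` R0" "t \<in> fst ` R0"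
    and iso: "\<And>a b. a \<in> R0 \<Longrightarrow> b \<in> R0 \<Longrightarrow> dist (snd a) (snd b) = \<bar>fst a - fst b\<bar>"
  shows "\<exists>\<gamma>. shortest_path {s..t} \<gamma> \<and> (\<forall>a\<in>R0. \<gamma> (fst a) = snd a)"
proof -
  define A where "A = {R. R0 \<subseteq> R \<and> fst ` R \<subseteq> {s..t} \<and>
     (\<forall>a\<in>R. \<forall>b\<in>R. dist (snd a) (snd b) = \<bar>fst a - fst b\<bar>)}"
  have "R0 \<in> A" using assms by (auto simp: A_def)
  have "\<exists>M\<in>A. \<forall>X\<in>A. M \<subseteq> X \<longrightarrow> X = M"
  proof (rule subset_Zorn_nonempty)
    fix C assume C: "C \<noteq> {}" "subset.chain A C"
    then have CA: "C \<subseteq> A" and ch: "\<And>X Y. X \<in> C \<Longrightarrow> Y \<in> C \<Longrightarrow> X \<subseteq> Y \<or> Y \<subseteq> X"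
      by (auto simp: subset_chain_def)
    show "\<Union>C \<in> A"
      unfolding A_def
    proof (intro CollectI conjI ballI)
      show "R0 \<subseteq> \<Union>C" using C(1) CA unfolding A_def by blast
      show "fst ` \<Union>C \<subseteq> {s..t}" using CA unfolding A_def by blast
      fix a b assume "a \<in> \<Union>C" "b \<in> \<Union>C"
      then obtain X where "X \<in> C" "a \<in> X" "b \<in> X" using ch by blast
      then show "dist (snd a) (snd b) = \<bar>fst a - fst b\<bar>" using CA unfolding A_def by blast
    qed
  qed (use \<open>R0 \<in> A\<close> in blast)
  then obtain M where M: "M \<in> A" and max: "\<And>X. X \<in> A \<Longrightarrow> M \<subseteq> X \<Longrightarrow> X = M" by blast
  have R0M: "R0 \<subseteq> M" and Msub: "fst ` M \<subseteq> {s..t}"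
    and Miso: "\<And>a b. a \<in> M \<Longrightarrow> b \<in> M \<Longrightarrow> dist (snd a) (snd b) = \<bar>fst a - fst b\<bar>"
    using M unfolding A_def by auto
  have add: "(u, w) \<in> M"
    if "u \<in> {s..t}" "\<And>a. a \<in> M \<Longrightarrow> dist w (snd a) = \<bar>u - fst a\<bar>" for u w
  proof -
    have "insert (u, w) M \<in> A"
      using that R0M Msub Miso unfolding A_def by (auto simp: dist_commute abs_minus_commute)
    then show ?thesis using max by blast
  qed
  define D where "D = fst ` M"
  have clD: "l \<in> D" if f: "\<And>k::nat. f k \<in> D" "f \<longlonglongrightarrow> l" for f l
  proof -
    have "\<forall>k. \<exists>q. (f k, q) \<in> M" using f(1) unfolding D_def by force
    then obtain q where q: "\<And>k. (f k, q k) \<in> M" by metis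
    have dq: "dist (q j) (q k) = \<bar>f j - f k\<bar>" for j k using Miso[OF q q] by simp
    have "Cauchy f" using f(2) by (simp add: LIMSEQ_imp_Cauchy)
    then have "Cauchy q" unfolding Cauchy_def dq dist_real_def .
    then obtain w where w: "q \<longlonglongrightarrow> w" using Cauchy_has_limit by blast
    have "(l, w) \<in> M"
    proof (rule add)
      show "l \<in> {s..t}"
      proof -
        have "\<forall>k. f k \<in> {s..t}" using f(1) Msub unfolding D_def by blast
        then show ?thesis using closed_sequentially[OF closed_atLeastAtMost _ f(2)] by blast
      qed
      fix a assume a: "a \<in> M"
      have 1: "(\<lambda>k. dist (q k) (snd a)) \<longlonglongrightarrow> dist w (snd a)"
        by (intro tendsto_intros w)
      have 2: "(\<lambda>k. \<bar>f k - fst a\<bar>) \<longlonglongrightarrow> \<bar>l - fst a\<bar>"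
        by (intro tendsto_intros f)
      have "(\<lambda>k. dist (q k) (snd a)) = (\<lambda>k. \<bar>f k - fst a\<bar>)" using Miso[OF q a] by simp
      with 1 2 show "dist w (snd a) = \<bar>l - fst a\<bar>" using LIMSEQ_unique by metis
    qed
    then show ?thesis unfolding D_def by force
  qed
  then have clo: "closed D" unfolding closed_sequential_limits by blast
  have Dst: "D \<subseteq> {s..t}" "s \<in> D" "t \<in> D" using Msub st R0M unfolding D_def by auto
  have "D = {s..t}"
  proof (rule ccontr)
    assume "D \<noteq> {s..t}"
    then have "\<exists>u\<in>{s..t}. u \<notin> D" using Dst by blast
    then obtain u where u: "s \<le> u" "u \<le> t" "u \<notin> D" by auto
    \<comment> \<open>\<open>l\<close> and \<open>r\<close> are the ends of the gap of
      \<open>D\<close> around the missing time \<open>u\<close>; they lie in \<open>D\<close>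
      because it is closed.\<close>
    define l where "l = Sup (D \<inter> {..u})"
    define r where "r = Inf (D \<inter> {u..})"
    have bd: "bdd_above (D \<inter> {..u})" "bdd_below (D \<inter> {u..})" by auto
    have l: "l \<in> D \<inter> {..u}" unfolding l_def
      using clo u Dst bd by (intro closed_contains_Sup) auto
    have r: "r \<in> D \<inter> {u..}" unfolding r_def
      using clo u Dst bd by (intro closed_contains_Inf) auto
    have lr: "l < u" "u < r" using l r u by (auto simp: less_le)
    have gap: "v \<le> l \<or> r \<le> v" if "v \<in> D" for v
      using that cSup_upper[OF _ bd(1), of v] cInf_lower[OF _ bd(2), of v]
      unfolding l_def r_def by force
    obtain p q where pq: "(l, p) \<in> M" "(r, q) \<in> M" using l r unfolding D_def by force
    have dpq: "dist p q = r - l" using Miso[OF pq] lr by simp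
    then have "p \<noteq> q" using lr by auto
    then obtain z where z: "z \<noteq> p" "z \<noteq> q" "dist p z + dist z q = dist p q"
      using between_exists by blast
    define v where "v = l + dist p z"
    have "0 < dist p z" "0 < dist z q" using z by auto
    then have v: "l < v" "v < r" using z(3) dpq unfolding v_def by linarith+
    have "(v, z) \<in> M"
    proof (rule add)
      show "v \<in> {s..t}" using v lr l r Dst by auto
      fix a assume a: "a \<in> M"
      have ap: "dist (snd a) p = \<bar>fst a - l\<bar>" and aq: "dist (snd a) q = \<bar>fst a - r\<bar>"
        using Miso[OF a] pq by auto
      have "fst a \<in> D" using a unfolding D_def by auto
      then consider "fst a \<le> l" | "r \<le> fst a" using gap by blast
      \<comment> \<open>The triangle through the nearer end of the gap bounds this distance from
        above, the one through the farther end from below.\<close>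
      then show "dist z (snd a) = \<bar>v - fst a\<bar>"
      proof cases
        case 1
        then have "dist (snd a) p = l - fst a" "dist (snd a) q = r - fst a" "\<bar>v - fst a\<bar> = v - fst a"
          using ap aq lr v by auto
        then show ?thesis
          using dist_triangle[of z "snd a" p] dist_triangle[of "snd a" q z] z(3) dpq
          unfolding v_def by (simp add: dist_commute)
      next
        case 2
        then have "dist (snd a) p = fst a - l" "dist (snd a) q = fst a - r" "\<bar>v - fst a\<bar> = fst a - v"
          using ap aq lr v by auto
        then show ?thesis
          using dist_triangle[of z "snd a" q] dist_triangle[of "snd a" p z] z(3) dpq
          unfolding v_def by (simp add: dist_commute)
      qed
    qed
    then have "v \<in> D" unfolding D_def by force
    with gap v show False by fastforce
  qed
  then have "\<forall>u\<in>{s..t}. \<exists>p. (u, p) \<in> M" unfolding D_def by force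
  then obtain \<gamma> where \<gamma>: "\<And>u. u \<in> {s..t} \<Longrightarrow> (u, \<gamma> u) \<in> M" by metis
  show ?thesis
  proof (intro exI conjI ballI)
    show "shortest_path {s..t} \<gamma>"
      unfolding shortest_path_def using Miso[OF \<gamma> \<gamma>] by (auto simp: is_interval_cc)
    fix a assume a: "a \<in> R0"
    then have "a \<in> M" "fst a \<in> {s..t}" using R0M sub by auto
    then have "dist (\<gamma> (fst a)) (snd a) = 0" using Miso[OF \<gamma>[of "fst a"] \<open>a \<in> M\<close>] by simp
    then show "\<gamma> (fst a) = snd a" by simp
  qed
qed

lemma shortest_path_exists:
  fixes p q :: 'a
  obtains \<gamma> where "shortest_path {0..dist p q} \<gamma>" "\<gamma> 0 = p" "\<gamma> (dist p q) = q"
proof -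
  have "\<exists>\<gamma>. shortest_path {0..dist p q} \<gamma> \<and>
    (\<forall>a\<in>{(0, p), (dist p q, q)}. \<gamma> (fst a) = snd a)"
    by (rule isometric_extension) (auto simp: dist_commute)
  then show ?thesis using that by auto
qed

section \<open>Prolongation, uniqueness and limits of shortest paths\<close>

lemma between_trans:
  fixes x y w z :: 'a
  assumes "dist x y + dist y w = dist x w" "dist x w + dist w z = dist x z"
  shows "dist x y + dist y z = dist x z" "dist y w + dist w z = dist y z"
  using assms dist_triangle[of y z w] dist_triangle[of x z y] by auto

lemma connected_space: "connected (UNIV :: 'a set)"
proof -
  fix x0 :: 'a
  have "path_component UNIV x0 y" for y
  proof -
    obtain \<gamma> where \<gamma>: "shortest_path {0..dist x0 y} \<gamma>" "\<gamma> 0 = x0" "\<gamma> (dist x0 y) = y"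
      by (rule shortest_path_exists)
    have "continuous_on {0..1} (\<lambda>t. \<gamma> (dist x0 y * t))"
      by (rule continuous_on_compose2[OF shortest_path_continuous_on[OF \<gamma>(1)]])
        (auto intro!: continuous_intros mult_left_le)
    then show ?thesis
      unfolding path_component_def path_def pathstart_def pathfinish_def using \<gamma>
      by (intro exI[of _ "\<lambda>t. \<gamma> (dist x0 y * t)"]) auto
  qed
  then have "path_connected (UNIV::'a set)"
    unfolding path_connected_component by (meson UNIV_I path_component_sym path_component_trans)
  then show ?thesis by (rule path_connected_imp_connected)
qed

text \<open>Axiom (3) prolongs by an uncontrolled amount. Among the prolongations of the segment
  from \<open>x\<close> to \<open>y\<close> within a closed ball, compactness gives an end farthest
  from \<open>x\<close>; were it interior to the ball, it could be prolonged a little more. So the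
  prolongation reaches a sphere of fixed radius.\<close>

lemma prolong_to_sphere:
  fixes p :: 'a
  obtains R where "R > 0"
    "\<And>x y. x \<in> ball p R \<Longrightarrow> y \<in> ball p R \<Longrightarrow> x \<noteq> y \<Longrightarrow>
      \<exists>w. dist p w = R \<and> dist x y + dist y w = dist x w"
proof -
  obtain U where U: "open U" "p \<in> U"
    "\<And>x y. x \<in> U \<Longrightarrow> y \<in> U \<Longrightarrow> \<exists>z\<in>U - {x, y}. dist x y + dist y z = dist x z"
    using local_prolong by blast
  obtain R where R: "R > 0" "cball p R \<subseteq> U" using U open_contains_cball by blast
  show ?thesis
  proof (rule that[OF R(1)])
    fix x y assume xy: "x \<in> ball p R" "y \<in> ball p R" "x \<noteq> y"
    define K where "K = cball p R \<inter> {w. dist x y + dist y w = dist x w}"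
    have "closed {w. dist x y + dist y w = dist x w}"
      by (intro closed_Collect_eq continuous_intros)
    then have "compact K" unfolding K_def using cball_compact by (intro compact_Int_closed)
    moreover have "y \<in> K" using xy unfolding K_def by auto
    moreover have "continuous_on K (dist x)" by (intro continuous_intros)
    ultimately obtain w where w: "w \<in> K" and max: "\<And>v. v \<in> K \<Longrightarrow> dist x v \<le> dist x w"
      using continuous_attains_sup[of K "dist x"] by blast
    have wp: "dist p w \<le> R" and xyw: "dist x y + dist y w = dist x w"
      using w unfolding K_def by auto
    have "dist p w = R"
    proof (rule ccontr)
      assume "dist p w \<noteq> R"
      then have less: "dist p w < R" using wp by simp
      have "x \<in> U" "w \<in> U" using xy wp R by auto
      then obtain z where z: "z \<noteq> w" "dist x w + dist w z = dist x z" using U(3) by blast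
      obtain \<delta> where \<delta>: "shortest_path {0..dist w z} \<delta>" "\<delta> 0 = w" "\<delta> (dist w z) = z"
        by (rule shortest_path_exists)
      \<comment> \<open>Only this much of the new piece is used, so that its end stays in the closed
        ball.\<close>
      define h where "h = min (dist w z) (R - dist p w)"
      have h: "0 < h" "h \<le> dist w z" "h \<le> R - dist p w" using z less unfolding h_def by auto
      have d: "dist w (\<delta> h) = h" "dist (\<delta> h) z = dist w z - h"
        using shortest_path_dist[OF \<delta>(1), of 0 h] shortest_path_dist[OF \<delta>(1), of h "dist w z"] h \<delta>
        by auto
      have xw: "dist x w + dist w (\<delta> h) = dist x (\<delta> h)"
        using dist_triangle[of x z "\<delta> h"] dist_triangle[of x "\<delta> h" w] d z by auto
      have "\<delta> h \<in> K"
        using between_trans(1)[OF xyw xw] dist_triangle[of p "\<delta> h" w] d h unfolding K_def by auto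
      then show False using max[of "\<delta> h"] xw d h by simp
    qed
    then show "\<exists>w. dist p w = R \<and> dist x y + dist y w = dist x w" using xyw by blast
  qed
qed

text \<open>Axiom (3) with both points equal to \<open>y\<close> yields a second point, and a
  shortest path brings it close. It supplies a direction in the degenerate case of
  \<open>two_sided_path\<close>.\<close>

lemma two_points_near:
  fixes y :: 'a
  assumes "e > 0"
  obtains z where "z \<noteq> y" "dist y z < e"
proof -
  obtain U where U: "open U" "y \<in> U"
    "\<And>x y. x \<in> U \<Longrightarrow> y \<in> U \<Longrightarrow> \<exists>z\<in>U - {x, y}. dist x y + dist y z = dist x z"
    by (rule local_prolong[of y]) (rule that; assumption)
  obtain z where z: "z \<noteq> y" using U(3)[OF U(2) U(2)] by auto
  obtain \<delta> where \<delta>: "shortest_path {0..dist y z} \<delta>" "\<delta> 0 = y" "\<delta> (dist y z) = z"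
    by (rule shortest_path_exists)
  define h where "h = min (dist y z) (e / 2)"
  have h: "0 < h" "h \<le> dist y z" "h < e" using z assms unfolding h_def by (auto simp: min_def)
  have "dist y (\<delta> h) = h" using shortest_path_dist[OF \<delta>(1), of 0 h] h \<delta> by auto
  then show ?thesis using that[of "\<delta> h"] h by force
qed

text \<open>One length \<open>a\<close> serves all pairs near \<open>x\<close>, so that limits of
  geodesics do not shrink to a point. The path extends a four-point isometry: go from
  \<open>y\<close> past \<open>z\<close> to \<open>wp\<close>, then prolong the reversed segment
  from \<open>wp\<close> past \<open>y\<close> to \<open>wm\<close>.\<close>

lemma two_sided_path:
  fixes x :: 'a
  obtains a where "a > 0"
    "\<And>y z. y \<in> ball x a \<Longrightarrow> z \<in> ball x a \<Longrightarrow>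
      \<exists>\<gamma>. shortest_path {-3*a..3*a} \<gamma> \<and> \<gamma> 0 = y \<and> \<gamma> (dist y z) = z"
proof -
  obtain R where R: "R > 0" "\<And>y z. y \<in> ball x R \<Longrightarrow> z \<in> ball x R \<Longrightarrow> y \<noteq> z \<Longrightarrow>
      \<exists>w. dist x w = R \<and> dist y z + dist z w = dist y w"
    using prolong_to_sphere by blast
  \<comment> \<open>A tenth of \<open>R\<close>: from points of \<open>ball x a\<close> the sphere
    of radius \<open>R\<close> is at least \<open>9 * a\<close> away, and cutting at
    \<open>3 * a\<close> leaves \<open>wp\<close> inside \<open>ball x R\<close>, where prolongation
    is possible again.\<close>
  define a where "a = R / 10"
  have a: "a > 0" "R = 10 * a" using R unfolding a_def by auto
  have main: "\<exists>\<gamma>. shortest_path {-3*a..3*a} \<gamma> \<and> \<gamma> 0 = y \<and> \<gamma> (dist y z) = z"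
    if yz: "y \<in> ball x a" "z \<in> ball x a" "y \<noteq> z" for y z
  proof -
    have dy: "dist x y < a" "dist x z < a" using yz by auto
    have dyz: "dist y z < 2 * a" using dist_triangle[of y z x] dy by (simp add: dist_commute)
    obtain w where w: "dist x w = 10 * a" "dist y z + dist z w = dist y w"
      using R(2)[of y z] yz a by auto
    have yw: "dist y w \<ge> 9 * a" using dist_triangle[of x w y] dy w by simp
    have "\<exists>\<alpha>. shortest_path {0..dist y w} \<alpha> \<and>
        (\<forall>b\<in>{(0, y), (dist y z, z), (dist y w, w)}. \<alpha> (fst b) = snd b)"
      by (rule isometric_extension) (use w dyz yw a in \<open>auto simp: dist_commute\<close>)
    then obtain \<alpha> where \<alpha>: "shortest_path {0..dist y w} \<alpha>"
      and \<alpha>v: "\<alpha> 0 = y" "\<alpha> (dist y z) = z" by auto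
    define wp where "wp = \<alpha> (3*a)"
    have wp: "dist y wp = 3*a" "dist z wp = 3*a - dist y z"
      using shortest_path_dist[OF \<alpha>, of 0 "3*a"] shortest_path_dist[OF \<alpha>, of "dist y z" "3*a"]
        \<alpha>v yw a dyz unfolding wp_def by auto
    have "wp \<in> ball x R" using dist_triangle[of x wp y] wp dy a by auto
    moreover have "wp \<noteq> y" using wp a by auto
    ultimately obtain w' where w': "dist x w' = 10 * a" "dist wp y + dist y w' = dist wp w'"
      using R(2)[of wp y] yz a by auto
    have yw': "dist y w' \<ge> 9 * a" using dist_triangle[of x w' y] dy w' by simp
    obtain \<beta> where \<beta>: "shortest_path {0..dist y w'} \<beta>" "\<beta> 0 = y" "\<beta> (dist y w') = w'"
      by (rule shortest_path_exists)
    define wm where "wm = \<beta> (3*a)"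
    have wm: "dist y wm = 3*a" "dist wm w' = dist y w' - 3*a"
      using shortest_path_dist[OF \<beta>(1), of 0 "3*a"] shortest_path_dist[OF \<beta>(1), of "3*a" "dist y w'"]
        \<beta> yw' a unfolding wm_def by auto
    \<comment> \<open>\<open>y\<close> lies between \<open>wp\<close> and \<open>w'\<close>, and
      \<open>wm\<close> lies between \<open>y\<close> and \<open>w'\<close>; hence \<open>y\<close>
      is the midpoint of \<open>wm\<close> and \<open>wp\<close>.\<close>
    have mp: "dist wm wp = 6*a"
      using dist_triangle[of wp w' wm] dist_triangle[of wm wp y] w' wm wp
      by (auto simp: dist_commute)
    have mz: "dist wm z = 3*a + dist y z"
      using dist_triangle[of wm wp z] dist_triangle[of wm z y] mp wm wp by (auto simp: dist_commute)
    let ?R = "{(-3*a, wm), (0, y), (dist y z, z), (3*a, wp)}"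
    have "dist wm y = 3*a" using wm by (simp add: dist_commute)
    then have *: "\<forall>b\<in>?R. \<forall>b'\<in>?R. fst b < fst b' \<longrightarrow> dist (snd b) (snd b') = fst b' - fst b"
      using wm wp mp mz a zero_le_dist[of y z] dyz
      by (simp only: ball_simps simp_thms fst_conv snd_conv) (intro conjI impI; linarith)
    have **: "\<forall>b\<in>?R. \<forall>b'\<in>?R. fst b = fst b' \<longrightarrow> snd b = snd b'"
    proof -
      have "dist y z > 0" using yz by simp
      then show ?thesis using a dyz
        by (simp only: ball_simps simp_thms fst_conv snd_conv)
          (intro conjI impI; (rule refl | (rule FalseE, linarith)))
    qed
    have R: "dist (snd b) (snd b') = \<bar>fst b - fst b'\<bar>" if "b \<in> ?R" "b' \<in> ?R" for b b'
    proof (cases "fst b" "fst b'" rule: linorder_cases)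
      case less
      then have "dist (snd b) (snd b') = fst b' - fst b" using * that by blast
      then show ?thesis using less by linarith
    next
      case equal
      then have "snd b = snd b'" using ** that by blast
      then show ?thesis using equal by (simp only: dist_self)
    next
      case greater
      then have "dist (snd b') (snd b) = fst b - fst b'" using * that by blast
      then show ?thesis using greater by (simp only: dist_commute)
    qed
    have "\<exists>\<gamma>. shortest_path {-3*a..3*a} \<gamma> \<and> (\<forall>b\<in>?R. \<gamma> (fst b) = snd b)"
    proof (rule isometric_extension)
      show "fst ` ?R \<subseteq> {-3*a..3*a}" using a dyz zero_le_dist[of y z] by (simp del: zero_le_dist)
    qed (use R in auto)
    then show ?thesis by auto
  qed
  show ?thesis
  proof (rule that[OF a(1)])
    fix y z assume yz: "y \<in> ball x a" "z \<in> ball x a"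
    show "\<exists>\<gamma>. shortest_path {-3*a..3*a} \<gamma> \<and> \<gamma> 0 = y \<and> \<gamma> (dist y z) = z"
    proof (cases "y = z")
      case True
      \<comment> \<open>A constant segment carries no direction; any second point near
        \<open>y\<close> provides one.\<close>
      obtain z' where z': "z' \<noteq> y" "dist y z' < a - dist x y"
        using two_points_near[of "a - dist x y" y] yz by auto
      then have "z' \<in> ball x a" using dist_triangle[of x z' y] by auto
      then show ?thesis using main[of y z'] yz z' True by auto
    qed (use main yz in blast)
  qed
qed

text \<open>Axiom (4) with the extra point \<open>\<gamma> (-b)\<close>: both
  \<open>\<gamma> t\<close> and \<open>\<gamma>' t\<close> prolong the segment from it to the common
  start by the length \<open>t\<close>. The piece before time 0 is what excludes branching
  there.\<close>

lemma path_unique: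
  fixes \<gamma> \<gamma>' :: "real \<Rightarrow> 'a"
  assumes "b > 0" "shortest_path {-b..s} \<gamma>" "shortest_path {0..s} \<gamma>'" "\<gamma> 0 = \<gamma>' 0" "\<gamma> s = \<gamma>' s"
    "t \<in> {0..s}"
  shows "\<gamma> t = \<gamma>' t"
proof (rule prolong_unique[of "\<gamma> (-b)" "\<gamma> 0"])
  have t: "0 \<le> t" "t \<le> s" using assms by auto
  have d: "dist (\<gamma> (-b)) (\<gamma> 0) = b" "dist (\<gamma> 0) (\<gamma> t) = t" "dist (\<gamma> (-b)) (\<gamma> t) = b + t"
    "dist (\<gamma> (-b)) (\<gamma> s) = b + s"
    using t assms(1) by (auto simp: shortest_path_dist[OF assms(2)])
  have d': "dist (\<gamma>' 0) (\<gamma>' t) = t" "dist (\<gamma>' t) (\<gamma>' s) = s - t"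
    using t by (auto simp: shortest_path_dist[OF assms(3)])
  show "\<gamma> (-b) \<noteq> \<gamma> 0" using d assms(1) by auto
  show "dist (\<gamma> (-b)) (\<gamma> 0) + dist (\<gamma> 0) (\<gamma> t) = dist (\<gamma> (-b)) (\<gamma> t)" using d by simp
  show "dist (\<gamma> 0) (\<gamma> t) = dist (\<gamma> 0) (\<gamma>' t)" using d d' assms by simp
  show "dist (\<gamma> (-b)) (\<gamma> 0) + dist (\<gamma> 0) (\<gamma>' t) = dist (\<gamma> (-b)) (\<gamma>' t)"
    using d d' assms(4,5) dist_triangle[of "\<gamma> (-b)" "\<gamma> s" "\<gamma>' t"]
      dist_triangle[of "\<gamma> (-b)" "\<gamma>' t" "\<gamma> 0"] by simp
qed

text \<open>Once the values at the two times \<open>-b\<close> and \<open>-c\<close> converge, axiom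
  (4) determines the limit at every later time, so two extractions of subsequences replace a
  diagonal argument. The price is the shorter interval.\<close>

lemma paths_compact:
  fixes \<gamma> :: "nat \<Rightarrow> real \<Rightarrow> 'a"
  assumes cb: "0 < c" "c < b" and \<gamma>: "\<And>k. shortest_path {-b..b} (\<gamma> k)"
    and lim: "(\<lambda>k. \<gamma> k 0) \<longlonglongrightarrow> x"
  obtains r \<gamma>' where "strict_mono (r :: nat \<Rightarrow> nat)" "shortest_path {-c..c} \<gamma>'"
    "\<And>t. t \<in> {-c..c} \<Longrightarrow> (\<lambda>k. \<gamma> (r k) t) \<longlonglongrightarrow> \<gamma>' t"
proof -
  have "bounded (range (\<lambda>k. \<gamma> k 0))" using lim convergent_imp_bounded by blast
  then obtain B where B: "\<And>k. dist x (\<gamma> k 0) \<le> B"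
    using bounded_any_center[of _ x] by (metis rangeI)
  have in_ball: "\<gamma> k t \<in> cball x (B + b)" if "t \<in> {-b..b}" for k t
    using dist_triangle[of x "\<gamma> k t" "\<gamma> k 0"] B[of k] shortest_path_dist[OF \<gamma>, of 0 t k] that cb
    by auto
  obtain r1 e where r1: "strict_mono (r1 :: nat \<Rightarrow> nat)" "(\<lambda>k. \<gamma> (r1 k) (-b)) \<longlonglongrightarrow> e"
    using bounded_subseq[of "\<lambda>k. \<gamma> k (-b)" x "B + b"] in_ball[of "-b"] cb by auto
  obtain r2 y where r2: "strict_mono (r2 :: nat \<Rightarrow> nat)" "(\<lambda>k. \<gamma> (r1 (r2 k)) (-c)) \<longlonglongrightarrow> y"
    using bounded_subseq[of "\<lambda>k. \<gamma> (r1 k) (-c)" x "B + b"] in_ball[of "-c"] cb by auto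
  define r where "r = r1 \<circ> r2"
  have r: "strict_mono r" using r1 r2 strict_mono_o unfolding r_def by blast
  have e: "(\<lambda>k. \<gamma> (r k) (-b)) \<longlonglongrightarrow> e"
    using LIMSEQ_subseq_LIMSEQ[OF r1(2) r2(1)] unfolding r_def o_def .
  have y: "(\<lambda>k. \<gamma> (r k) (-c)) \<longlonglongrightarrow> y" using r2(2) unfolding r_def o_def .
  have lim_dist: "dist p q = \<bar>s - t\<bar>"
    if "strict_mono (f :: nat \<Rightarrow> nat)" "s \<in> {-b..b}" "t \<in> {-b..b}" "(\<lambda>k. \<gamma> (r (f k)) s) \<longlonglongrightarrow> p" "(\<lambda>k. \<gamma> (r (f k)) t) \<longlonglongrightarrow> q"
    for p q s t f
    using LIMSEQ_unique[OF tendsto_dist[OF that(4,5)], of "\<bar>s - t\<bar>"]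
      shortest_path_dist[OF \<gamma> that(2,3)] by simp
  have conv: "\<exists>l. (\<lambda>k. \<gamma> (r k) t) \<longlonglongrightarrow> l" if t: "t \<in> {-c..c}" for t
  proof -
    have tb: "t \<in> {-b..b}" using t cb by auto
    \<comment> \<open>Every subsequential limit at time \<open>t\<close> prolongs the segment from
      \<open>e\<close> to \<open>y\<close> by the same length.\<close>
    have char: "dist e l = b + t \<and> dist y l = c + t"
      if "strict_mono (f :: nat \<Rightarrow> nat)" "(\<lambda>k. \<gamma> (r (f k)) t) \<longlonglongrightarrow> l" for f l
    proof -
      have "(\<lambda>k. \<gamma> (r (f k)) (-b)) \<longlonglongrightarrow> e" "(\<lambda>k. \<gamma> (r (f k)) (-c)) \<longlonglongrightarrow> y"
        using LIMSEQ_subseq_LIMSEQ[OF e that(1)] LIMSEQ_subseq_LIMSEQ[OF y that(1)]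
        unfolding o_def .
      then show ?thesis
        using lim_dist[OF that(1) _ tb _ that(2), of "-b" e] lim_dist[OF that(1) _ tb _ that(2), of "-c" y]
          cb t by auto
    qed
    have ey: "dist e y = b - c" using lim_dist[OF strict_mono_id, of "-b" "-c"] e y cb by simp
    obtain f l where f: "strict_mono (f :: nat \<Rightarrow> nat)" "(\<lambda>k. \<gamma> (r (f k)) t) \<longlonglongrightarrow> l"
      using bounded_subseq[of "\<lambda>k. \<gamma> (r k) t" x "B + b"] in_ball tb by blast
    have "(\<lambda>k. \<gamma> (r k) t) \<longlonglongrightarrow> l"
    proof (rule LIMSEQ_by_subseq)
      fix g :: "nat \<Rightarrow> nat" assume g: "strict_mono g"
      obtain h l' where h: "strict_mono (h :: nat \<Rightarrow> nat)" "(\<lambda>k. \<gamma> (r (g (h k))) t) \<longlonglongrightarrow> l'"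
        using bounded_subseq[of "\<lambda>k. \<gamma> (r (g k)) t" x "B + b"] in_ball tb by blast
      have "strict_mono (g \<circ> h)" using g h strict_mono_o by blast
      then have "dist e l' = b + t \<and> dist y l' = c + t" using char[of "g \<circ> h" l'] h by (simp add: o_def)
      moreover have "dist e l = b + t \<and> dist y l = c + t" using char[OF f] .
      ultimately have "l' = l" using cb ey by (intro prolong_unique[of e y]) auto
      then show "\<exists>s. strict_mono (s :: nat \<Rightarrow> nat) \<and> (\<lambda>k. \<gamma> (r (g (s k))) t) \<longlonglongrightarrow> l" using h by blast
    qed
    then show ?thesis by blast
  qed
  then obtain \<gamma>' where \<gamma>': "\<And>t. t \<in> {-c..c} \<Longrightarrow> (\<lambda>k. \<gamma> (r k) t) \<longlonglongrightarrow> \<gamma>' t" by metis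
  have "shortest_path {-c..c} \<gamma>'"
    unfolding shortest_path_def
    using lim_dist[OF strict_mono_id] \<gamma>' cb by (auto simp: is_interval_cc)
  then show ?thesis using that r \<gamma>' by blast
qed

end

section \<open>Regular functions and tangent vectors\<close>

text \<open>A negative \<open>lam\<close> expresses strong convexity: \<open>semi W (-1) s\<close>
  corresponds to second derivatives at least 2 along geodesics.\<close>

definition semi :: "'a::metric_space set \<Rightarrow> real \<Rightarrow> ('a \<Rightarrow> real) \<Rightarrow> bool" where
  "semi W lam u \<longleftrightarrow> (\<forall>I \<gamma>. shortest_path I \<gamma> \<and> \<gamma> ` I \<subseteq> W \<longrightarrow>
     convex_on I (\<lambda>t. u (\<gamma> t) + lam * t\<^sup>2))"

text \<open>The class is stable under sums and nonnegative multiples, a cone rather than a vector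
  space. Linearity is recovered on the side of tangent vectors.\<close>

definition regular_on :: "'a::metric_space set \<Rightarrow> ('a \<Rightarrow> real) \<Rightarrow> bool" where
  "regular_on W u \<longleftrightarrow> (\<exists>L. \<forall>y\<in>W. \<forall>z\<in>W. \<bar>u y - u z\<bar> \<le> L * dist y z) \<and>
     (\<forall>I \<gamma>. shortest_path I \<gamma> \<and> \<gamma> ` I \<subseteq> W \<longrightarrow> (\<lambda>t. u (\<gamma> t)) differentiable_on I) \<and>
     (\<exists>lam. semi W lam u)"

definition regular_at :: "'a::metric_space \<Rightarrow> ('a \<Rightarrow> real) \<Rightarrow> bool" where
  "regular_at x u \<longleftrightarrow> (\<exists>W. open W \<and> x \<in> W \<and> regular_on W u)"

text \<open>A tangent vector is encoded as the derivation \<open>c\<close> times the derivative along a shortest path through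
  \<open>x\<close>; \<open>c\<close> is its length. It is set to \<open>0\<close> on functions that are not regular at \<open>x\<close>,
  so that it is determined by its values on regular functions.\<close>

definition tvec :: "'a::metric_space \<Rightarrow> real \<Rightarrow> (('a \<Rightarrow> real) \<Rightarrow> real) \<Rightarrow> bool" where
  "tvec x c v \<longleftrightarrow> c \<ge> 0 \<and> (\<exists>b>0. \<exists>\<gamma>. shortest_path {-b..b} \<gamma> \<and> \<gamma> 0 = x \<and>
     v = (\<lambda>u. if regular_at x u then c * deriv (\<lambda>t. u (\<gamma> t)) 0 else 0))"

lemma semi_subset: "semi W lam u \<Longrightarrow> V \<subseteq> W \<Longrightarrow> semi V lam u"
  unfolding semi_def by blast

lemma convex_on_square: "0 \<le> c \<Longrightarrow> convex I \<Longrightarrow> convex_on I (\<lambda>t::real. c * t\<^sup>2)"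
  by (rule convex_on_cmul) (use convex_on_subset[OF convex_power2, of I] in auto)

lemma semi_mono: "semi W lam u \<Longrightarrow> lam \<le> lam' \<Longrightarrow> semi W lam' u"
  unfolding semi_def
proof (intro allI impI)
  fix I \<gamma> assume *: "\<forall>I \<gamma>. shortest_path I \<gamma> \<and> \<gamma> ` I \<subseteq> W \<longrightarrow> convex_on I (\<lambda>t. u (\<gamma> t) + lam * t\<^sup>2)"
    "lam \<le> lam'" "shortest_path I \<gamma> \<and> \<gamma> ` I \<subseteq> W"
  then have c: "convex_on I (\<lambda>t. u (\<gamma> t) + lam * t\<^sup>2)" by blast
  have "convex_on I (\<lambda>t. (u (\<gamma> t) + lam * t\<^sup>2) + (lam' - lam) * t\<^sup>2)"
    by (rule convex_on_add[OF c convex_on_square]) (use * convex_on_imp_convex[OF c] in auto)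
  then show "convex_on I (\<lambda>t. u (\<gamma> t) + lam' * t\<^sup>2)" by (simp add: algebra_simps)
qed

lemma semi_add:
  assumes "semi W l u" "semi W m w" shows "semi W (l + m) (\<lambda>y. u y + w y)"
  unfolding semi_def
proof (intro allI impI)
  fix I \<gamma> assume *: "shortest_path I \<gamma> \<and> \<gamma> ` I \<subseteq> W"
  have "convex_on I (\<lambda>t. (u (\<gamma> t) + l * t\<^sup>2) + (w (\<gamma> t) + m * t\<^sup>2))"
  proof (rule convex_on_add)
    show "convex_on I (\<lambda>t. u (\<gamma> t) + l * t\<^sup>2)" using assms(1) * unfolding semi_def by blast
    show "convex_on I (\<lambda>t. w (\<gamma> t) + m * t\<^sup>2)" using assms(2) * unfolding semi_def by blast
  qed
  then show "convex_on I (\<lambda>t. u (\<gamma> t) + w (\<gamma> t) + (l + m) * t\<^sup>2)" by (simp add: algebra_simps)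
qed

lemma semi_cmul:
  assumes "semi W l u" "c \<ge> 0" shows "semi W (c * l) (\<lambda>y. c * u y)"
  unfolding semi_def
proof (intro allI impI)
  fix I \<gamma> assume *: "shortest_path I \<gamma> \<and> \<gamma> ` I \<subseteq> W"
  have "convex_on I (\<lambda>t. c * (u (\<gamma> t) + l * t\<^sup>2))"
  proof (rule convex_on_cmul[OF assms(2)])
    show "convex_on I (\<lambda>t. u (\<gamma> t) + l * t\<^sup>2)" using assms(1) * unfolding semi_def by blast
  qed
  then show "convex_on I (\<lambda>t. c * u (\<gamma> t) + c * l * t\<^sup>2)" by (simp add: algebra_simps)
qed

lemma regular_on_subset: "regular_on W u \<Longrightarrow> V \<subseteq> W \<Longrightarrow> regular_on V u"
  unfolding regular_on_def by (meson semi_subset subset_eq order_trans)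

lemma regular_on_lip:
  assumes "regular_on W u"
  shows "\<exists>L\<ge>0. \<forall>y\<in>W. \<forall>z\<in>W. \<bar>u y - u z\<bar> \<le> L * dist y z"
proof -
  obtain L where L: "\<And>y z. y \<in> W \<Longrightarrow> z \<in> W \<Longrightarrow> \<bar>u y - u z\<bar> \<le> L * dist y z"
    using assms unfolding regular_on_def by blast
  have "\<bar>u y - u z\<bar> \<le> max L 0 * dist y z" if "y \<in> W" "z \<in> W" for y z
    using L[OF that] mult_right_mono[of L "max L 0" "dist y z"] by simp
  then show ?thesis by (intro exI[of _ "max L 0"]) auto
qed

lemma regular_on_semi:
  assumes "regular_on W u" shows "\<exists>lam\<ge>0. semi W lam u"
proof -
  obtain lam where "semi W lam u" using assms unfolding regular_on_def by blast
  then have "semi W (max lam 0) u" by (rule semi_mono) simp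
  then show ?thesis by (intro exI[of _ "max lam 0"]) auto
qed

lemma regular_on_differentiable:
  "regular_on W u \<Longrightarrow> shortest_path I \<gamma> \<Longrightarrow> \<gamma> ` I \<subseteq> W \<Longrightarrow> (\<lambda>t. u (\<gamma> t)) differentiable_on I"
  unfolding regular_on_def by blast

lemma regular_on_add:
  assumes "regular_on W u" "regular_on W w" shows "regular_on W (\<lambda>y. u y + w y)"
proof -
  obtain L1 l1 where 1: "\<And>y z. y \<in> W \<Longrightarrow> z \<in> W \<Longrightarrow> \<bar>u y - u z\<bar> \<le> L1 * dist y z" "semi W l1 u"
    using assms(1) unfolding regular_on_def by blast
  obtain L2 l2 where 2: "\<And>y z. y \<in> W \<Longrightarrow> z \<in> W \<Longrightarrow> \<bar>w y - w z\<bar> \<le> L2 * dist y z" "semi W l2 w"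
    using assms(2) unfolding regular_on_def by blast
  have "\<bar>u y + w y - (u z + w z)\<bar> \<le> (L1 + L2) * dist y z" if "y \<in> W" "z \<in> W" for y z
    using 1(1)[OF that] 2(1)[OF that] by (simp add: distrib_right)
  then have "\<exists>L. \<forall>y\<in>W. \<forall>z\<in>W. \<bar>u y + w y - (u z + w z)\<bar> \<le> L * dist y z" by blast
  moreover have "(\<lambda>t. u (\<gamma> t) + w (\<gamma> t)) differentiable_on I" if "shortest_path I \<gamma>" "\<gamma> ` I \<subseteq> W" for I \<gamma>
    using regular_on_differentiable[OF assms(1) that] regular_on_differentiable[OF assms(2) that]
    by (rule differentiable_on_add)
  ultimately show ?thesis using semi_add[OF 1(2) 2(2)] unfolding regular_on_def by blast
qed

lemma regular_on_const [simp]: "regular_on W (\<lambda>y. c)"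
  unfolding regular_on_def semi_def
proof (intro conjI)
  show "\<exists>L. \<forall>y\<in>W. \<forall>z\<in>W. \<bar>c - c\<bar> \<le> L * dist y z" by (intro exI[of _ 0]) auto
  show "\<exists>lam. \<forall>I (\<gamma>::real \<Rightarrow> 'a). shortest_path I \<gamma> \<and> \<gamma> ` I \<subseteq> W \<longrightarrow> convex_on I (\<lambda>t. c + lam * t\<^sup>2)"
    by (intro exI[of _ 0]) (auto simp: shortest_path_def is_interval_convex_1 convex_on_const)
qed auto

lemma regular_on_cmul:
  assumes "regular_on W u" "c \<ge> 0" shows "regular_on W (\<lambda>y. c * u y)"
proof -
  obtain L1 l1 where 1: "\<And>y z. y \<in> W \<Longrightarrow> z \<in> W \<Longrightarrow> \<bar>u y - u z\<bar> \<le> L1 * dist y z" "semi W l1 u"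
    using assms(1) unfolding regular_on_def by blast
  have "\<bar>c * u y - c * u z\<bar> \<le> (c * L1) * dist y z" if "y \<in> W" "z \<in> W" for y z
    using mult_left_mono[OF 1(1)[OF that] assms(2)] assms(2)
    by (simp add: abs_mult mult.assoc flip: right_diff_distrib)
  then have "\<exists>L. \<forall>y\<in>W. \<forall>z\<in>W. \<bar>c * u y - c * u z\<bar> \<le> L * dist y z" by blast
  moreover have "(\<lambda>t. c * u (\<gamma> t)) differentiable_on I" if "shortest_path I \<gamma>" "\<gamma> ` I \<subseteq> W" for I \<gamma>
    by (rule differentiable_on_mult[OF differentiable_on_const regular_on_differentiable[OF assms(1) that]])
  ultimately show ?thesis using semi_cmul[OF 1(2) assms(2)] unfolding regular_on_def by blast
qed

lemma regular_on_sum: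
  assumes "\<And>i. i \<in> J \<Longrightarrow> regular_on W (f i)"
  shows "regular_on W (\<lambda>y. \<Sum>i\<in>J. f i y)"
  using assms by (induction J rule: infinite_finite_induct) (auto intro: regular_on_add)

lemma regular_on_isCont:
  assumes "regular_on W u" "open W" "x \<in> W" shows "isCont u x"
proof -
  obtain L where L: "\<And>y z. y \<in> W \<Longrightarrow> z \<in> W \<Longrightarrow> \<bar>u y - u z\<bar> \<le> L * dist y z" and "L \<ge> 0"
    using regular_on_lip[OF assms(1)] by blast
  then have "L-lipschitz_on W u" by (auto simp: lipschitz_on_def dist_real_def)
  then have "continuous_on W u" by (rule lipschitz_on_continuous_on)
  then show ?thesis using assms continuous_on_eq_continuous_at by blast
qed

lemma regular_on_at: "regular_on W u \<Longrightarrow> open W \<Longrightarrow> x \<in> W \<Longrightarrow> regular_at x u"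
  unfolding regular_at_def by blast

lemma regular_at_add:
  assumes "regular_at x u" "regular_at x w" shows "regular_at x (\<lambda>y. u y + w y)"
proof -
  obtain U W where "open U" "x \<in> U" "regular_on U u" "open W" "x \<in> W" "regular_on W w"
    using assms unfolding regular_at_def by blast
  then show ?thesis unfolding regular_at_def
    by (intro exI[of _ "U \<inter> W"]) (auto intro!: regular_on_add intro: regular_on_subset)
qed

lemma regular_at_sum:
  assumes "\<And>i. i \<in> J \<Longrightarrow> regular_at x (f i)"
  shows "regular_at x (\<lambda>y. \<Sum>i\<in>J. f i y)"
  using assms
proof (induction J rule: infinite_finite_induct)
  case empty
  show ?case by (auto intro!: regular_on_at[of UNIV])
next
  case infinite
  then show ?case by (auto intro!: regular_on_at[of UNIV])
qed (auto intro: regular_at_add)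

section \<open>First-order limits along converging geodesics\<close>

lemma regular_at_path:
  fixes x :: "'a::metric_space"
  assumes "regular_at x u" "shortest_path {-b..b} \<gamma>" "\<gamma> 0 = x" "b > 0"
  shows "((\<lambda>t. u (\<gamma> t)) has_real_derivative deriv (\<lambda>t. u (\<gamma> t)) 0) (at 0)"
proof -
  obtain W where W: "open W" "x \<in> W" "regular_on W u" using assms(1) unfolding regular_at_def by blast
  obtain e where e: "e > 0" "ball x e \<subseteq> W" using W open_contains_ball by blast
  define d where "d = min b (e/2)"
  have d: "d > 0" "d \<le> b" "d < e" using e assms(4) unfolding d_def by auto
  have sp: "shortest_path {-d..d} \<gamma>" using shortest_path_subset[OF assms(2)] d by (auto simp: is_interval_cc)
  have "\<gamma> t \<in> ball x e" if "t \<in> {-d..d}" for t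
    using shortest_path_dist[OF sp, of 0 t] that d assms(3) by auto
  then have "(\<lambda>t. u (\<gamma> t)) differentiable_on {-d..d}"
    using e by (intro regular_on_differentiable[OF W(3) sp]) auto
  then have "(\<lambda>t. u (\<gamma> t)) differentiable (at 0 within {-d..d})"
    using d unfolding differentiable_on_def by auto
  moreover have "at 0 within {-d..d} = at (0::real)"
    using d by (intro at_within_interior) (auto simp: interior_atLeastAtMost_real)
  ultimately have "(\<lambda>t. u (\<gamma> t)) differentiable (at 0)" by simp
  then show ?thesis
    using real_differentiable_def DERIV_imp_deriv by metis
qed

text \<open>Monotonicity of secant slopes around 0, multiplied by \<open>t\<close> so that
  \<open>t = 0\<close> is included.\<close>

lemma convex_on_slopes_at_0:
  fixes h :: "real \<Rightarrow> real"
  assumes "convex_on {-d..d} h" "0 \<le> t" "t \<le> s" "0 < s" "s \<le> d"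
  shows "t * ((h 0 - h (-s)) / s) \<le> h t - h 0" "h t - h 0 \<le> t * ((h s - h 0) / s)"
proof -
  have "h ((1 - t/s) *\<^sub>R 0 + (t/s) *\<^sub>R s) \<le> (1 - t/s) * h 0 + (t/s) * h s"
    using assms by (intro convex_onD[OF assms(1)]) auto
  then have "h t \<le> (1 - t/s) * h 0 + (t/s) * h s" using assms by simp
  then show "h t - h 0 \<le> t * ((h s - h 0) / s)" by (simp add: algebra_simps diff_divide_distrib)
  \<comment> \<open>With this weight 0 is the convex combination of \<open>-s\<close> and
    \<open>t\<close>.\<close>
  define m where "m = s / (s + t)"
  have "h ((1 - m) *\<^sub>R (-s) + m *\<^sub>R t) \<le> (1 - m) * h (-s) + m * h t"
    using assms unfolding m_def by (intro convex_onD[OF assms(1)]) auto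
  moreover have "(1 - m) *\<^sub>R (-s) + m *\<^sub>R t = 0"
    using assms unfolding m_def by (simp add: field_simps)
  ultimately have "(s + t) * h 0 \<le> (s + t) * ((1 - m) * h (-s) + m * h t)"
    using assms by (intro mult_left_mono) auto
  also have "\<dots> = t * h (-s) + s * h t"
  proof -
    have "(s + t) * m = s" "(s + t) * (1 - m) = t" using assms unfolding m_def by (auto simp: field_simps)
    then show ?thesis by (simp add: distrib_left flip: mult.assoc)
  qed
  finally show "t * ((h 0 - h (-s)) / s) \<le> h t - h 0" using assms by (simp add: field_simps)
qed

text \<open>Difference quotients of convex functions along converging paths converge, because they are
  trapped between quotients at a fixed scale.\<close>

lemma derivative_limit:
  fixes x :: "'a::metric_space"
  assumes u: "regular_at x u" and b: "b > 0" and \<gamma>: "\<And>k. shortest_path {-b..b} (\<gamma> k)"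
    and lim: "\<And>t. t \<in> {-b..b} \<Longrightarrow> (\<lambda>k. \<gamma> k t) \<longlonglongrightarrow> \<delta> t" and \<delta>: "shortest_path {-b..b} \<delta>" "\<delta> 0 = x"
    and \<sigma>: "\<And>k. \<sigma> k > 0" "\<sigma> \<longlonglongrightarrow> 0" and t: "\<And>k. t k \<ge> 0" "(\<lambda>k. t k / \<sigma> k) \<longlonglongrightarrow> c"
  shows "(\<lambda>k. (u (\<gamma> k (t k)) - u (\<gamma> k 0)) / \<sigma> k) \<longlonglongrightarrow> c * deriv (\<lambda>t. u (\<delta> t)) 0"
proof -
  obtain W where W: "open W" "x \<in> W" "regular_on W u" using u unfolding regular_at_def by blast
  obtain lam where lam: "semi W lam u" using regular_on_semi[OF W(3)] by blast
  obtain e where e: "e > 0" "ball x e \<subseteq> W" using W open_contains_ball by blast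
  \<comment> \<open>A path that starts within \<open>e / 2\<close> of \<open>x\<close> stays in
    \<open>ball x e\<close>, hence in \<open>W\<close>, up to time \<open>d\<close>.\<close>
  define d where "d = min b (e/2)"
  have d: "d > 0" "d \<le> b" "d \<le> e/2" using e b unfolding d_def by auto
  define h where "h k t = u (\<gamma> k t) + lam * t\<^sup>2" for k t
  define H where "H t = u (\<delta> t) + lam * t\<^sup>2" for t
  define D where "D = deriv (\<lambda>t. u (\<delta> t)) 0"
  have DH: "(H has_real_derivative D) (at 0)"
    unfolding H_def using regular_at_path[OF u \<delta> b] unfolding D_def[symmetric]
    by (auto intro!: derivative_eq_intros)
  have "(\<lambda>k. \<gamma> k 0) \<longlonglongrightarrow> x" using lim[of 0] \<delta> b by simp
  then have ev: "\<forall>\<^sub>F k in sequentially. dist (\<gamma> k 0) x < e / 2"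
    using e tendstoD by (metis half_gt_zero_iff)
  have cvx: "\<forall>\<^sub>F k in sequentially. convex_on {-d..d} (h k)"
    using ev
  proof eventually_elim
    case (elim k)
    have sp: "shortest_path {-d..d} (\<gamma> k)"
      using shortest_path_subset[OF \<gamma>] d by (auto simp: is_interval_cc)
    have "\<gamma> k t \<in> ball x e" if "t \<in> {-d..d}" for t
      using shortest_path_dist[OF sp, of 0 t] that d elim dist_triangle[of x "\<gamma> k t" "\<gamma> k 0"]
      by (auto simp: dist_commute)
    then have "\<gamma> k ` {-d..d} \<subseteq> W" using e by blast
    then show ?case using lam sp unfolding semi_def h_def by blast
  qed
  have limh: "(\<lambda>k. h k t) \<longlonglongrightarrow> H t" if "t \<in> {-d..d}" for t
  proof -
    have "\<delta> t \<in> ball x e" using shortest_path_dist[OF \<delta>(1), of 0 t] that d \<delta>(2) e by auto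
    then have "isCont u (\<delta> t)" using W e regular_on_isCont by blast
    moreover have "(\<lambda>k. \<gamma> k t) \<longlonglongrightarrow> \<delta> t" using lim that d by auto
    ultimately show ?thesis unfolding h_def H_def
      by (intro tendsto_add[OF isCont_tendsto_compose tendsto_const])
  qed
  have "(\<lambda>k. t k / \<sigma> k * \<sigma> k) \<longlonglongrightarrow> c * 0" by (intro tendsto_intros t \<sigma>)
  moreover have "t k / \<sigma> k * \<sigma> k = t k" for k using \<sigma>(1)[of k] by simp
  ultimately have t0: "t \<longlonglongrightarrow> 0" by simp
  \<comment> \<open>Left and right secants of the limit function have the same limit
    \<open>D\<close>; this is where differentiability along the limit geodesic enters.\<close>
  have lo: "((\<lambda>s. c * ((H 0 - H (-s)) / s)) \<longlongrightarrow> c * D) (at_right 0)"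
  proof -
    have "((\<lambda>s. (H (0 + (-s)) - H 0) / (-s)) \<longlongrightarrow> D) (at_right 0)"
      by (rule filterlim_compose[OF DH[unfolded DERIV_def]])
        (auto simp: filterlim_at eventually_at_filter intro!: tendsto_eq_intros)
    moreover have "(\<lambda>s. (H (0 + (-s)) - H 0) / (-s)) = (\<lambda>s. (H 0 - H (-s)) / s)"
      by (rule ext) (simp add: minus_divide_right[symmetric] minus_divide_left)
    ultimately show ?thesis by (intro tendsto_intros) simp
  qed
  have hi: "((\<lambda>s. c * ((H s - H 0) / s)) \<longlongrightarrow> c * D) (at_right 0)"
  proof -
    have "((\<lambda>s. (H (0 + s) - H 0) / s) \<longlongrightarrow> D) (at_right 0)"
      using DH[unfolded DERIV_def] by (rule filterlim_mono) (auto simp: at_le)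
    then show ?thesis by (intro tendsto_intros) simp
  qed
  have small: "\<forall>\<^sub>F s in at_right 0. 0 < s \<and> s \<le> d"
    using d by (auto simp: eventually_at_right_field intro!: exI[of _ d])
  have main: "(\<lambda>k. (h k (t k) - h k 0) / \<sigma> k) \<longlonglongrightarrow> c * D"
  proof (rule order_tendstoI)
    fix a assume "a < c * D"
    then have "\<forall>\<^sub>F s in at_right 0. a < c * ((H 0 - H (-s)) / s)" using lo by (simp add: order_tendsto_iff)
    then have "\<forall>\<^sub>F s in at_right 0. a < c * ((H 0 - H (-s)) / s) \<and> 0 < s \<and> s \<le> d"
      using small by eventually_elim auto
    \<comment> \<open>The scale \<open>s\<close> is fixed first, on the limit path; only afterwards
      does \<open>k\<close> tend to infinity, at this fixed scale.\<close>
    then obtain s where s: "a < c * ((H 0 - H (-s)) / s)" "0 < s" "s \<le> d"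
      using eventually_happens' trivial_limit_at_right_real by blast
    have "(\<lambda>k. t k / \<sigma> k * ((h k 0 - h k (-s)) / s)) \<longlonglongrightarrow> c * ((H 0 - H (-s)) / s)"
      using s d by (intro tendsto_intros t limh) auto
    then have "\<forall>\<^sub>F k in sequentially. a < t k / \<sigma> k * ((h k 0 - h k (-s)) / s)"
      using s by (simp add: order_tendsto_iff)
    moreover have "\<forall>\<^sub>F k in sequentially. t k < s" using t0 s by (simp add: order_tendsto_iff)
    ultimately show "\<forall>\<^sub>F k in sequentially. a < (h k (t k) - h k 0) / \<sigma> k" using cvx
    proof eventually_elim
      case (elim k)
      have "t k * ((h k 0 - h k (-s)) / s) / \<sigma> k \<le> (h k (t k) - h k 0) / \<sigma> k"
        using convex_on_slopes_at_0(1)[OF elim(3) t(1)[of k], of s] elim s \<sigma>(1)[of k]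
        by (intro divide_right_mono) auto
      moreover have "t k / \<sigma> k * ((h k 0 - h k (-s)) / s) = t k * ((h k 0 - h k (-s)) / s) / \<sigma> k" by simp
      ultimately show ?case using elim(1) by linarith
    qed
  next
    fix a assume "a > c * D"
    then have "\<forall>\<^sub>F s in at_right 0. a > c * ((H s - H 0) / s)" using hi by (simp add: order_tendsto_iff)
    then have "\<forall>\<^sub>F s in at_right 0. a > c * ((H s - H 0) / s) \<and> 0 < s \<and> s \<le> d"
      using small by eventually_elim auto
    then obtain s where s: "a > c * ((H s - H 0) / s)" "0 < s" "s \<le> d"
      using eventually_happens' trivial_limit_at_right_real by blast
    have "(\<lambda>k. t k / \<sigma> k * ((h k s - h k 0) / s)) \<longlonglongrightarrow> c * ((H s - H 0) / s)"
      using s d by (intro tendsto_intros t limh) auto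
    then have "\<forall>\<^sub>F k in sequentially. a > t k / \<sigma> k * ((h k s - h k 0) / s)"
      using s by (simp add: order_tendsto_iff)
    moreover have "\<forall>\<^sub>F k in sequentially. t k < s" using t0 s by (simp add: order_tendsto_iff)
    ultimately show "\<forall>\<^sub>F k in sequentially. a > (h k (t k) - h k 0) / \<sigma> k" using cvx
    proof eventually_elim
      case (elim k)
      have "t k * ((h k s - h k 0) / s) / \<sigma> k \<ge> (h k (t k) - h k 0) / \<sigma> k"
        using convex_on_slopes_at_0(2)[OF elim(3) t(1)[of k], of s] elim s \<sigma>(1)[of k]
        by (intro divide_right_mono) auto
      moreover have "t k / \<sigma> k * ((h k s - h k 0) / s) = t k * ((h k s - h k 0) / s) / \<sigma> k" by simp
      ultimately show ?case using elim(1) by linarith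
    qed
  qed
  \<comment> \<open>The quadratic correction in \<open>h\<close> is of smaller order than
    \<open>\<sigma>\<close>.\<close>
  have "(\<lambda>k. lam * ((t k / \<sigma> k) * (t k))) \<longlonglongrightarrow> lam * (c * 0)" by (intro tendsto_intros t t0)
  then have "(\<lambda>k. (h k (t k) - h k 0) / \<sigma> k - lam * ((t k / \<sigma> k) * (t k))) \<longlonglongrightarrow> c * D - 0"
    by (intro tendsto_diff main) simp
  moreover have "(h k (t k) - h k 0) / \<sigma> k - lam * ((t k / \<sigma> k) * (t k)) =
     (u (\<gamma> k (t k)) - u (\<gamma> k 0)) / \<sigma> k" for k
    unfolding h_def by (simp add: power2_eq_square add_divide_distrib diff_divide_distrib)
  ultimately show ?thesis unfolding D_def by simp
qed

lemma tvec_ge0: "tvec x c v \<Longrightarrow> c \<ge> 0" by (simp add: tvec_def)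

lemma tvec_irregular: "tvec x c v \<Longrightarrow> \<not> regular_at x u \<Longrightarrow> v u = 0" by (auto simp: tvec_def)

lemma tvec_0: "tvec x 0 v \<Longrightarrow> v u = 0" by (auto simp: tvec_def)

lemma tvec_scale_nonneg: "tvec x c v \<Longrightarrow> a \<ge> 0 \<Longrightarrow> tvec x (a * c) (\<lambda>u. a * v u)"
  unfolding tvec_def by (auto simp: fun_eq_iff) (metis mult.assoc)

lemma tvec_uminus:
  assumes "tvec x c v" shows "tvec x c (\<lambda>u. - v u)"
proof -
  obtain b \<gamma> where b: "b > 0" "c \<ge> 0" and \<gamma>: "shortest_path {-b..b} \<gamma>" "\<gamma> 0 = x"
    and v: "v = (\<lambda>u. if regular_at x u then c * deriv (\<lambda>t. u (\<gamma> t)) 0 else 0)"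
    using assms unfolding tvec_def by blast
  define \<delta> where "\<delta> t = \<gamma> (- 1 * t + 0)" for t
  have \<delta>: "shortest_path {-b..b} \<delta>"
    unfolding \<delta>_def by (rule shortest_path_affine[OF \<gamma>(1)]) (auto simp: is_interval_cc)
  have "deriv (\<lambda>t. u (\<delta> t)) 0 = - deriv (\<lambda>t. u (\<gamma> t)) 0" if "regular_at x u" for u
  proof (rule DERIV_imp_deriv)
    have "((\<lambda>t. u (\<gamma> t)) has_real_derivative deriv (\<lambda>t. u (\<gamma> t)) 0) (at (- 0))"
      using regular_at_path[OF that \<gamma> b(1)] by simp
    then show "((\<lambda>t. u (\<delta> t)) has_real_derivative - deriv (\<lambda>t. u (\<gamma> t)) 0) (at 0)"
      unfolding \<delta>_def DERIV_mirror by simp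
  qed
  then have "(\<lambda>u. - v u) = (\<lambda>u. if regular_at x u then c * deriv (\<lambda>t. u (\<delta> t)) 0 else 0)"
    unfolding v by auto
  then show ?thesis unfolding tvec_def using b \<delta> \<gamma> by (auto intro!: exI[of _ b] exI[of _ \<delta>] simp: \<delta>_def)
qed

lemma tvec_scale: "tvec x c v \<Longrightarrow> tvec x (\<bar>a\<bar> * c) (\<lambda>u. a * v u)"
  using tvec_scale_nonneg[of x c v a] tvec_uminus[OF tvec_scale_nonneg[of x c v "-a"]]
  by (cases "a \<ge> 0") auto

lemma tvec_additive:
  assumes v: "tvec x c v" and "regular_at x u" "regular_at x w"
  shows "v (\<lambda>y. u y + w y) = v u + v w"
proof -
  obtain b \<gamma> where b: "b > 0" and \<gamma>: "shortest_path {-b..b} \<gamma>" "\<gamma> 0 = x"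
    and v: "v = (\<lambda>u. if regular_at x u then c * deriv (\<lambda>t. u (\<gamma> t)) 0 else 0)"
    using v unfolding tvec_def by blast
  have "deriv (\<lambda>t. u (\<gamma> t) + w (\<gamma> t)) 0 = deriv (\<lambda>t. u (\<gamma> t)) 0 + deriv (\<lambda>t. w (\<gamma> t)) 0"
    using regular_at_path[OF _ \<gamma> b] assms by (intro DERIV_imp_deriv derivative_intros) auto
  then show ?thesis using assms regular_at_add[OF assms(2,3)] unfolding v by (simp add: distrib_left)
qed

lemma tvec_const [simp]: "tvec x c v \<Longrightarrow> v (\<lambda>y. a) = 0"
  unfolding tvec_def by auto

lemma tvec_sum:
  assumes v: "tvec x c v" and "\<And>i. i \<in> J \<Longrightarrow> regular_at x (f i)"
  shows "v (\<lambda>y. \<Sum>i\<in>J. f i y) = (\<Sum>i\<in>J. v (f i))"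
  using assms(2)
proof (induction J rule: infinite_finite_induct)
  case (insert i J)
  then show ?case using tvec_additive[OF v, of "f i" "\<lambda>y. \<Sum>i\<in>J. f i y"] regular_at_sum[of J x f] by auto
qed (use v in auto)

section \<open>Tangent vectors as limits of rescaled pairs of points\<close>

lemma real_bounded_subseq:
  fixes f :: "nat \<Rightarrow> real"
  assumes "\<And>k. \<bar>f k\<bar> \<le> B"
  shows "\<exists>l s. strict_mono (s :: nat \<Rightarrow> nat) \<and> (\<lambda>k. f (s k)) \<longlonglongrightarrow> l"
proof -
  have "seq_compact (cball 0 B :: real set)" using compact_cball compact_eq_seq_compact_metric by blast
  moreover have "\<forall>k. f k \<in> cball 0 B" using assms by simp
  ultimately show ?thesis unfolding seq_compact_def o_def by blast
qed

context gspace
begin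

text \<open>The subsequence is chosen for the joining geodesics and for the ratio of distance to
  scale only, so a single one serves all regular functions. The scale \<open>\<sigma>\<close> need
  not be the distance itself, so vectors of every length arise, zero included.\<close>

lemma tangent_limit:
  fixes x :: 'a
  assumes y: "y \<longlonglongrightarrow> x" and z: "z \<longlonglongrightarrow> x" and \<sigma>: "\<And>k. \<sigma> k > 0" "\<sigma> \<longlonglongrightarrow> 0"
    and B: "\<And>k. dist (y k) (z k) \<le> B * \<sigma> k"
  shows "\<exists>r c v. strict_mono (r :: nat \<Rightarrow> nat) \<and> tvec x c v \<and>
    (\<lambda>k. dist (y (r k)) (z (r k)) / \<sigma> (r k)) \<longlonglongrightarrow> c \<and>
    (\<forall>u. regular_at x u \<longrightarrow> (\<lambda>k. (u (z (r k)) - u (y (r k))) / \<sigma> (r k)) \<longlonglongrightarrow> v u)"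
proof -
  obtain a where a: "a > 0" and pth: "\<And>y z. y \<in> ball x a \<Longrightarrow> z \<in> ball x a \<Longrightarrow>
      \<exists>\<gamma>. shortest_path {-3*a..3*a} \<gamma> \<and> \<gamma> 0 = y \<and> \<gamma> (dist y z) = z"
    using two_sided_path by blast
  have "\<forall>\<^sub>F k in sequentially. dist (y k) x < a \<and> dist (z k) x < a"
    using tendstoD[OF y a] tendstoD[OF z a] by eventually_elim auto
  then obtain N where N: "\<And>k. k \<ge> N \<Longrightarrow> y k \<in> ball x a \<and> z k \<in> ball x a"
    unfolding eventually_sequentially mem_ball by (metis dist_commute)
  have "\<forall>k. \<exists>\<gamma>. shortest_path {-3*a..3*a} \<gamma> \<and> \<gamma> 0 = y (k + N) \<and>
      \<gamma> (dist (y (k + N)) (z (k + N))) = z (k + N)"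
    using pth N by simp
  then obtain \<gamma> where \<gamma>: "\<And>k. shortest_path {-(3*a)..3*a} (\<gamma> k)" "\<And>k. \<gamma> k 0 = y (k + N)"
      "\<And>k. \<gamma> k (dist (y (k + N)) (z (k + N))) = z (k + N)"
    by (auto dest!: choice)
  have "(\<lambda>k. \<gamma> k 0) \<longlonglongrightarrow> x" unfolding \<gamma>(2) using y by (rule LIMSEQ_ignore_initial_segment)
  then obtain r1 \<delta> where r1: "strict_mono (r1 :: nat \<Rightarrow> nat)" and \<delta>: "shortest_path {-(2*a)..2*a} \<delta>"
    and lim: "\<And>t. t \<in> {-(2*a)..2*a} \<Longrightarrow> (\<lambda>k. \<gamma> (r1 k) t) \<longlonglongrightarrow> \<delta> t"
    using paths_compact[of "2*a" "3*a" \<gamma> x] a \<gamma>(1) by auto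
  define q where "q k = dist (y k) (z k) / \<sigma> k" for k
  have "\<bar>q k\<bar> \<le> B" for k
    using B[of k] \<sigma>(1)[of k] unfolding q_def by (simp add: divide_le_eq)
  then obtain c r2 where r2: "strict_mono (r2 :: nat \<Rightarrow> nat)" "(\<lambda>k. q (r1 (r2 k) + N)) \<longlonglongrightarrow> c"
    using real_bounded_subseq[of "\<lambda>k. q (r1 k + N)" B] by blast
  define r where "r k = r1 (r2 k) + N" for k
  have r: "strict_mono r" using r1 r2(1) unfolding r_def strict_mono_def by auto
  have r12: "strict_mono (\<lambda>k. r1 (r2 k))" using r1 r2(1) unfolding strict_mono_def by auto
  have "q k \<ge> 0" for k using \<sigma>(1)[of k] unfolding q_def by simp
  then have c: "c \<ge> 0" using r2(2) LIMSEQ_le_const by blast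
  have lim2: "(\<lambda>k. \<gamma> (r1 (r2 k)) t) \<longlonglongrightarrow> \<delta> t" if "t \<in> {-(2*a)..2*a}" for t
    using LIMSEQ_subseq_LIMSEQ[OF lim[OF that] r2(1)] unfolding o_def .
  have \<delta>0: "\<delta> 0 = x"
  proof (rule LIMSEQ_unique)
    show "(\<lambda>k. \<gamma> (r1 (r2 k)) 0) \<longlonglongrightarrow> \<delta> 0" using lim2 a by simp
    show "(\<lambda>k. \<gamma> (r1 (r2 k)) 0) \<longlonglongrightarrow> x"
      using LIMSEQ_subseq_LIMSEQ[OF y r] unfolding \<gamma>(2) r_def o_def .
  qed
  define v where "v = (\<lambda>u. if regular_at x u then c * deriv (\<lambda>t. u (\<delta> t)) 0 else 0)"
  show ?thesis
  proof (intro exI[of _ r] exI[of _ c] exI[of _ v] conjI allI impI)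
    show "strict_mono r" by (rule r)
    show "tvec x c v" unfolding tvec_def v_def using c a \<delta> \<delta>0
      by (intro conjI exI[of _ "2*a"] exI[of _ \<delta>]) auto
    show qc: "(\<lambda>k. dist (y (r k)) (z (r k)) / \<sigma> (r k)) \<longlonglongrightarrow> c"
      using r2(2) unfolding r_def q_def .
    fix u assume u: "regular_at x u"
    have "(\<lambda>k. (u (\<gamma> (r1 (r2 k)) (dist (y (r k)) (z (r k)))) - u (\<gamma> (r1 (r2 k)) 0)) / \<sigma> (r k))
       \<longlonglongrightarrow> c * deriv (\<lambda>t. u (\<delta> t)) 0"
    proof (rule derivative_limit[OF u, of "2*a"])
      show "shortest_path {-(2*a)..2*a} (\<gamma> (r1 (r2 k)))" for k
        by (rule shortest_path_subset[OF \<gamma>(1)]) (use a in \<open>auto simp: is_interval_cc\<close>)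
      show "(\<lambda>k. \<sigma> (r k)) \<longlonglongrightarrow> 0" using LIMSEQ_subseq_LIMSEQ[OF \<sigma>(2) r] unfolding o_def .
    qed (use a \<delta> \<delta>0 lim2 \<sigma> qc in auto)
    then show "(\<lambda>k. (u (z (r k)) - u (y (r k))) / \<sigma> (r k)) \<longlonglongrightarrow> v u"
      using u unfolding v_def by (simp add: \<gamma> r_def)
  qed
qed

text \<open>Converse of \<open>tangent_limit\<close>, with freely moving base points. From
  \<open>y k\<close> aim at the fixed point \<open>\<gamma> e\<close> of the geodesic of
  \<open>v\<close> and walk for time \<open>c * \<sigma>\<close>. Along a subsequence the aiming
  geodesics converge, and by uniqueness their limit agrees with \<open>\<gamma>\<close> on
  \<open>{0..e}\<close>.\<close>

lemma tangent_realize: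
  fixes x :: 'a
  assumes v: "tvec x c v" and y: "y \<longlonglongrightarrow> x" and \<sigma>: "\<And>k. \<sigma> k > 0" "\<sigma> \<longlonglongrightarrow> 0"
  obtains r z where "strict_mono (r :: nat \<Rightarrow> nat)" "z \<longlonglongrightarrow> x"
    "\<And>k. dist (y (r k)) (z k) = c * \<sigma> (r k)"
    "\<And>u. regular_at x u \<Longrightarrow> (\<lambda>k. (u (z k) - u (y (r k))) / \<sigma> (r k)) \<longlonglongrightarrow> v u"
proof -
  obtain b \<gamma> where b: "b > 0" "c \<ge> 0" and \<gamma>: "shortest_path {-b..b} \<gamma>" "\<gamma> 0 = x"
    and v: "v = (\<lambda>u. if regular_at x u then c * deriv (\<lambda>t. u (\<gamma> t)) 0 else 0)"
    using v unfolding tvec_def by blast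
  obtain a where a: "a > 0" and pth: "\<And>y z. y \<in> ball x a \<Longrightarrow> z \<in> ball x a \<Longrightarrow>
      \<exists>\<gamma>. shortest_path {-3*a..3*a} \<gamma> \<and> \<gamma> 0 = y \<and> \<gamma> (dist y z) = z"
    using two_sided_path by blast
  \<comment> \<open>The target \<open>\<gamma> e\<close> has to lie in \<open>ball x a\<close>,
    where joining geodesics of uniform length exist.\<close>
  define e where "e = min b (a / 2)"
  have e: "0 < e" "e \<le> b" "e < a" using a b unfolding e_def by auto
  have de: "dist x (\<gamma> e) = e" using shortest_path_dist[OF \<gamma>(1), of 0 e] e \<gamma>(2) by auto
  have "(\<lambda>k. c * \<sigma> k) \<longlonglongrightarrow> c * 0" by (intro tendsto_intros \<sigma>)
  then have "\<forall>\<^sub>F k in sequentially. c * \<sigma> k < 2 * a"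
    using a by (simp add: order_tendsto_iff)
  then have "\<forall>\<^sub>F k in sequentially. dist (y k) x < a \<and> c * \<sigma> k < 2 * a"
    using tendstoD[OF y a] by eventually_elim auto
  then obtain N where N: "\<And>k. k \<ge> N \<Longrightarrow> y k \<in> ball x a \<and> c * \<sigma> k < 2 * a"
    unfolding eventually_sequentially mem_ball by (metis dist_commute)
  have "\<forall>k. \<exists>\<beta>. shortest_path {-3*a..3*a} \<beta> \<and> \<beta> 0 = y (k + N) \<and> \<beta> (dist (y (k + N)) (\<gamma> e)) = \<gamma> e"
    using pth N de e by simp
  then obtain \<beta> where \<beta>: "\<And>k. shortest_path {-(3*a)..3*a} (\<beta> k)" "\<And>k. \<beta> k 0 = y (k + N)"
      "\<And>k. \<beta> k (dist (y (k + N)) (\<gamma> e)) = \<gamma> e"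
    by (auto dest!: choice)
  have yN: "(\<lambda>k. y (k + N)) \<longlonglongrightarrow> x" using y by (rule LIMSEQ_ignore_initial_segment)
  then have "(\<lambda>k. \<beta> k 0) \<longlonglongrightarrow> x" unfolding \<beta>(2) .
  then obtain r1 \<delta> where r1: "strict_mono (r1 :: nat \<Rightarrow> nat)" and \<delta>: "shortest_path {-(2*a)..2*a} \<delta>"
    and lim: "\<And>t. t \<in> {-(2*a)..2*a} \<Longrightarrow> (\<lambda>k. \<beta> (r1 k) t) \<longlonglongrightarrow> \<delta> t"
    using paths_compact[of "2*a" "3*a" \<beta> x] a \<beta>(1) by auto
  define r where "r k = r1 k + N" for k
  have r: "strict_mono r" using r1 unfolding r_def strict_mono_def by auto
  have yr: "(\<lambda>k. y (r k)) \<longlonglongrightarrow> x" using LIMSEQ_subseq_LIMSEQ[OF y r] unfolding o_def .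
  have \<sigma>r: "(\<lambda>k. \<sigma> (r k)) \<longlonglongrightarrow> 0" using LIMSEQ_subseq_LIMSEQ[OF \<sigma>(2) r] unfolding o_def .
  have \<delta>0: "\<delta> 0 = x"
  proof (rule LIMSEQ_unique)
    show "(\<lambda>k. \<beta> (r1 k) 0) \<longlonglongrightarrow> \<delta> 0" using lim a by simp
    show "(\<lambda>k. \<beta> (r1 k) 0) \<longlonglongrightarrow> x" using yr unfolding \<beta>(2) r_def .
  qed
  \<comment> \<open>The geodesic \<open>\<beta> k\<close> meets \<open>\<gamma> e\<close> at the
    time equal to its distance from the start, and this time tends to \<open>e\<close>.\<close>
  have \<delta>e: "\<delta> e = \<gamma> e"
  proof (rule LIMSEQ_unique)
    show "(\<lambda>k. \<beta> (r1 k) e) \<longlonglongrightarrow> \<delta> e" using lim a e by simp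
    have d: "(\<lambda>k. \<bar>e - dist (y (r k)) (\<gamma> e)\<bar>) \<longlonglongrightarrow> \<bar>e - dist x (\<gamma> e)\<bar>" by (intro tendsto_intros yr)
    show "(\<lambda>k. \<beta> (r1 k) e) \<longlonglongrightarrow> \<gamma> e"
    proof (rule metric_tendsto_imp_tendsto)
      show "(\<lambda>k. \<bar>e - dist (y (r k)) (\<gamma> e)\<bar>) \<longlonglongrightarrow> 0" using d de by simp
      have "dist (\<beta> (r1 k) e) (\<gamma> e) \<le> \<bar>e - dist (y (r k)) (\<gamma> e)\<bar>" for k
      proof -
        have "dist (y (r k)) (\<gamma> e) \<le> 2 * a"
          using dist_triangle2[of "y (r k)" "\<gamma> e" x] N[of "r k"] de e unfolding r_def
          by (auto simp: dist_commute)
        then have "dist (\<beta> (r1 k) e) (\<beta> (r1 k) (dist (y (r k)) (\<gamma> e))) = \<bar>e - dist (y (r k)) (\<gamma> e)\<bar>"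
          using a e zero_le_dist[of "y (r k)" "\<gamma> e"]
          by (intro shortest_path_dist[OF \<beta>(1)]; unfold atLeastAtMost_iff; linarith)
        then show ?thesis using \<beta>(3)[of "r1 k"] unfolding r_def by simp
      qed
      then show "\<forall>\<^sub>F k in sequentially. dist (\<beta> (r1 k) e) (\<gamma> e) \<le> dist \<bar>e - dist (y (r k)) (\<gamma> e)\<bar> 0"
        by simp
    qed
  qed
  have agree: "\<delta> t = \<gamma> t" if "t \<in> {0..e}" for t
    using that
    by (intro path_unique[of "2*a" e \<delta> \<gamma> t] shortest_path_subset[OF \<delta>] shortest_path_subset[OF \<gamma>(1)])
      (use a e b \<delta>0 \<delta>e \<gamma>(2) in \<open>auto simp: is_interval_cc\<close>)
  \<comment> \<open>\<open>\<delta>\<close> and \<open>\<gamma>\<close> are known to agree only to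
    the right of 0; this suffices because both compositions with \<open>u\<close> have two-sided
    derivatives at 0.\<close>
  have deq: "deriv (\<lambda>t. u (\<delta> t)) 0 = deriv (\<lambda>t. u (\<gamma> t)) 0" if u: "regular_at x u" for u
  proof (rule tendsto_unique[OF trivial_limit_at_right_real])
    have D: "((\<lambda>h. (f (0 + h) - f 0) / h) \<longlongrightarrow> D) (at_right 0)"
      if "(f has_real_derivative D) (at 0)" for f :: "real \<Rightarrow> real" and D
      using that[unfolded DERIV_def] by (rule filterlim_mono) (auto simp: at_le)
    show "((\<lambda>h. (u (\<gamma> (0 + h)) - u (\<gamma> 0)) / h) \<longlongrightarrow> deriv (\<lambda>t. u (\<gamma> t)) 0) (at_right 0)"
      by (rule D[OF regular_at_path[OF u \<gamma> b(1)]])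
    have "((\<lambda>h. (u (\<delta> (0 + h)) - u (\<delta> 0)) / h) \<longlongrightarrow> deriv (\<lambda>t. u (\<delta> t)) 0) (at_right 0)"
      using a by (intro D[OF regular_at_path[OF u \<delta> \<delta>0]]) auto
    then show "((\<lambda>h. (u (\<gamma> (0 + h)) - u (\<gamma> 0)) / h) \<longlongrightarrow> deriv (\<lambda>t. u (\<delta> t)) 0) (at_right 0)"
    proof (rule Lim_transform_eventually)
      show "\<forall>\<^sub>F h in at_right 0. (u (\<delta> (0 + h)) - u (\<delta> 0)) / h = (u (\<gamma> (0 + h)) - u (\<gamma> 0)) / h"
        using e agree by (auto simp: eventually_at_right_field intro!: exI[of _ e])
    qed
  qed
  define z where "z k = \<beta> (r1 k) (c * \<sigma> (r k))" for k
  have cs: "0 \<le> c * \<sigma> (r k)" "c * \<sigma> (r k) < 2 * a" for k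
    using N[of "r k"] \<sigma>(1)[of "r k"] b(2) unfolding r_def by auto
  have dz: "dist (y (r k)) (z k) = c * \<sigma> (r k)" for k
    using shortest_path_dist[OF \<beta>(1)[of "r1 k"], of 0 "c * \<sigma> (r k)"] cs[of k] a
    unfolding z_def \<beta>(2) r_def by auto
  show ?thesis
  proof (rule that[OF r])
    show "z \<longlonglongrightarrow> x"
    proof (rule metric_tendsto_imp_tendsto)
      have "(\<lambda>k. c * \<sigma> (r k) + dist (y (r k)) x) \<longlonglongrightarrow> c * 0 + dist x x"
        by (intro tendsto_intros \<sigma>r yr)
      then show "(\<lambda>k. c * \<sigma> (r k) + dist (y (r k)) x) \<longlonglongrightarrow> 0" by simp
      have "dist (z k) x \<le> c * \<sigma> (r k) + dist (y (r k)) x" for k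
        using dist_triangle[of "z k" x "y (r k)"] dz[of k] by (simp add: dist_commute)
      moreover have "c * \<sigma> (r k) + dist (y (r k)) x = dist (c * \<sigma> (r k) + dist (y (r k)) x) 0" for k
        using cs(1)[of k] by simp
      ultimately show "\<forall>\<^sub>F k in sequentially. dist (z k) x \<le> dist (c * \<sigma> (r k) + dist (y (r k)) x) 0"
        by simp
    qed
    show "dist (y (r k)) (z k) = c * \<sigma> (r k)" for k by (rule dz)
    fix u assume u: "regular_at x u"
    have "(\<lambda>k. (u (\<beta> (r1 k) (c * \<sigma> (r k))) - u (\<beta> (r1 k) 0)) / \<sigma> (r k))
       \<longlonglongrightarrow> c * deriv (\<lambda>t. u (\<delta> t)) 0"
    proof (rule derivative_limit[OF u, of "2*a"])
      show "shortest_path {-(2*a)..2*a} (\<beta> (r1 k))" for k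
        by (rule shortest_path_subset[OF \<beta>(1)]) (use a in \<open>auto simp: is_interval_cc\<close>)
      have "c * \<sigma> (r k) / \<sigma> (r k) = c" for k using \<sigma>(1)[of "r k"] by simp
      then show "(\<lambda>k. c * \<sigma> (r k) / \<sigma> (r k)) \<longlonglongrightarrow> c" by simp
    qed (use a \<delta> \<delta>0 lim \<sigma> cs \<sigma>r in auto)
    then show "(\<lambda>k. (u (z k) - u (y (r k))) / \<sigma> (r k)) \<longlonglongrightarrow> v u"
      using u deq unfolding v z_def \<beta>(2) r_def by simp
  qed
qed

text \<open>The second step starts at \<open>z k\<close> and not at \<open>x\<close>, which is why
  \<open>tangent_realize\<close> allows moving base points. The triangle inequality for the two
  steps becomes \<open>e \<le> c + d\<close>, the later triangle inequality of the Finsler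
  norm.\<close>

lemma tvec_add:
  fixes x :: 'a
  assumes v: "tvec x c v" and w: "tvec x d w"
  obtains e where "tvec x e (\<lambda>u. v u + w u)" "e \<le> c + d"
proof -
  define \<sigma> where "\<sigma> k = 1 / real (Suc k)" for k
  have \<sigma>: "\<And>k. \<sigma> k > 0" "\<sigma> \<longlonglongrightarrow> 0" unfolding \<sigma>_def using LIMSEQ_Suc[OF lim_1_over_n] by auto
  obtain r z where r: "strict_mono (r :: nat \<Rightarrow> nat)" and z: "z \<longlonglongrightarrow> x"
    and dz: "\<And>k. dist x (z k) = c * \<sigma> (r k)"
    and vz: "\<And>u. regular_at x u \<Longrightarrow> (\<lambda>k. (u (z k) - u x) / \<sigma> (r k)) \<longlonglongrightarrow> v u"
    by (rule tangent_realize[OF v tendsto_const[of x] \<sigma>]) (rule that; assumption)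
  have \<sigma>r: "\<And>k. \<sigma> (r k) > 0" "(\<lambda>k. \<sigma> (r k)) \<longlonglongrightarrow> 0"
    using \<sigma> LIMSEQ_subseq_LIMSEQ[OF \<sigma>(2) r] unfolding o_def by auto
  obtain s q where s: "strict_mono (s :: nat \<Rightarrow> nat)" and q: "q \<longlonglongrightarrow> x"
    and dq: "\<And>k. dist (z (s k)) (q k) = d * \<sigma> (r (s k))"
    and wq: "\<And>u. regular_at x u \<Longrightarrow> (\<lambda>k. (u (q k) - u (z (s k))) / \<sigma> (r (s k))) \<longlonglongrightarrow> w u"
    by (rule tangent_realize[OF w z \<sigma>r]) (rule that; assumption)
  have \<sigma>rs: "\<And>k. \<sigma> (r (s k)) > 0" "(\<lambda>k. \<sigma> (r (s k))) \<longlonglongrightarrow> 0"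
    using \<sigma> LIMSEQ_subseq_LIMSEQ[OF \<sigma>r(2) s] unfolding o_def by auto
  have B: "dist x (q k) \<le> (c + d) * \<sigma> (r (s k))" for k
    using dist_triangle[of x "q k" "z (s k)"] dz dq by (simp add: algebra_simps)
  obtain f e v' where f: "strict_mono (f :: nat \<Rightarrow> nat)" and v': "tvec x e v'"
    and e: "(\<lambda>k. dist x (q (f k)) / \<sigma> (r (s (f k)))) \<longlonglongrightarrow> e"
    and lim: "\<forall>u. regular_at x u \<longrightarrow> (\<lambda>k. (u (q (f k)) - u x) / \<sigma> (r (s (f k)))) \<longlonglongrightarrow> v' u"
    using tangent_limit[OF tendsto_const[of x] q \<sigma>rs B] by (elim exE conjE)
  have "v' u = v u + w u" for u
  proof (cases "regular_at x u")
    case True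
    have "strict_mono (\<lambda>k. s (f k))" using s f unfolding strict_mono_def by auto
    then have 1: "(\<lambda>k. (u (z (s (f k))) - u x) / \<sigma> (r (s (f k)))) \<longlonglongrightarrow> v u"
      using LIMSEQ_subseq_LIMSEQ[OF vz[OF True]] unfolding o_def by blast
    have 2: "(\<lambda>k. (u (q (f k)) - u (z (s (f k)))) / \<sigma> (r (s (f k)))) \<longlonglongrightarrow> w u"
      using LIMSEQ_subseq_LIMSEQ[OF wq[OF True] f] unfolding o_def .
    have "(\<lambda>k. (u (q (f k)) - u x) / \<sigma> (r (s (f k)))) \<longlonglongrightarrow> v u + w u"
      using tendsto_add[OF 1 2] by (simp flip: add_divide_distrib)
    then show ?thesis using lim True LIMSEQ_unique by blast
  next
    case False
    then show ?thesis using tvec_irregular[OF v] tvec_irregular[OF w] tvec_irregular[OF v'] by simp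
  qed
  then have "v' = (\<lambda>u. v u + w u)" by (rule ext)
  moreover have "e \<le> c + d"
    using e by (rule LIMSEQ_le_const2) (use B \<sigma>rs(1) in \<open>auto simp: pos_divide_le_eq\<close>)
  ultimately show ?thesis using v' that by blast
qed

lemma tvec_0_exists: "tvec (x::'a) 0 (\<lambda>u. 0)"
proof -
  obtain a where a: "a > 0" and pth: "\<And>y z. y \<in> ball x a \<Longrightarrow> z \<in> ball x a \<Longrightarrow>
      \<exists>\<gamma>. shortest_path {-3*a..3*a} \<gamma> \<and> \<gamma> 0 = y \<and> \<gamma> (dist y z) = z"
    using two_sided_path by blast
  then obtain \<gamma> where "shortest_path {-(3*a)..3*a} \<gamma>" "\<gamma> 0 = x"
    using pth[of x x] by auto
  then show ?thesis unfolding tvec_def using a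
    by (intro conjI exI[of _ "3*a"] exI[of _ \<gamma>]) auto
qed

lemma tvec_lincomb:
  fixes x :: 'a
  assumes "finite J" "\<And>j. j \<in> J \<Longrightarrow> tvec x (c j) (v j)"
  shows "\<exists>e. tvec x e (\<lambda>u. \<Sum>j\<in>J. w j * v j u)"
  using assms
proof (induction J rule: finite_induct)
  case empty
  then show ?case using tvec_0_exists by auto
next
  case (insert i J)
  then obtain e where "tvec x e (\<lambda>u. \<Sum>j\<in>J. w j * v j u)" by auto
  moreover have "tvec x (\<bar>w i\<bar> * c i) (\<lambda>u. w i * v i u)" using tvec_scale[OF insert.prems[of i], of "w i"] by simp
  ultimately obtain e' where "tvec x e' (\<lambda>u. w i * v i u + (\<Sum>j\<in>J. w j * v j u))"
    using tvec_add by blast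
  then show ?case using insert(1,2) by auto
qed

end

section \<open>Strongly convex functions and charts\<close>

text \<open>Supporting lines at interior points suffice, because a proper convex combination of two
  distinct points of an interval is interior to it.\<close>

lemma convex_on_by_support:
  fixes k :: "real \<Rightarrow> real"
  assumes "is_interval I" "\<And>t. t \<in> interior I \<Longrightarrow> \<exists>m. \<forall>s\<in>I. k s \<ge> k t + m * (s - t)"
  shows "convex_on I k"
proof (rule convex_on_linorderI)
  show "convex I" using assms(1) by (simp add: is_interval_convex_1)
  fix \<mu> x y :: real assume \<mu>: "0 < \<mu>" "\<mu> < 1" and xy: "x \<in> I" "y \<in> I" "x < y"
  define z where "z = (1 - \<mu>) * x + \<mu> * y"
  have "z - x = \<mu> * (y - x)" "y - z = (1 - \<mu>) * (y - x)" unfolding z_def by (auto simp: algebra_simps)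
  then have "x < z" "z < y" using \<mu> xy by (metis diff_gt_0_iff_gt mult_pos_pos)+
  moreover have "{x<..<y} \<subseteq> I" using assms(1) xy unfolding is_interval_1 by (meson greaterThanLessThan_iff less_imp_le subsetI)
  ultimately have "z \<in> interior I" using interior_maximal[of "{x<..<y}" I] by auto
  then obtain m where m: "\<forall>s\<in>I. k s \<ge> k z + m * (s - z)" using assms(2) by blast
  have "(1 - \<mu>) * (k z + m * (x - z)) \<le> (1 - \<mu>) * k x" "\<mu> * (k z + m * (y - z)) \<le> \<mu> * k y"
    using m \<mu> xy by (auto intro: mult_left_mono)
  moreover have "(1 - \<mu>) * (k z + m * (x - z)) + \<mu> * (k z + m * (y - z)) = k z"
    unfolding z_def by (simp add: algebra_simps)
  ultimately show "k ((1 - \<mu>) *\<^sub>R x + \<mu> *\<^sub>R y) \<le> (1 - \<mu>) * k x + \<mu> * k y"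
    unfolding z_def by simp
qed

lemma regular_on_support:
  assumes w: "regular_on W w" "semi W lam w" and \<gamma>: "shortest_path I \<gamma>" "\<gamma> ` I \<subseteq> W"
    and t: "t \<in> interior I"
  shows "\<exists>m. \<forall>s\<in>I. w (\<gamma> s) \<ge> w (\<gamma> t) + m * (s - t) - lam * (s - t)\<^sup>2"
proof -
  have cv: "convex_on I (\<lambda>t. w (\<gamma> t) + lam * t\<^sup>2)" using w \<gamma> unfolding semi_def by blast
  have "(\<lambda>t. w (\<gamma> t)) differentiable (at t within I)"
    using regular_on_differentiable[OF w(1) \<gamma>] t interior_subset unfolding differentiable_on_def by blast
  then obtain D where D: "((\<lambda>t. w (\<gamma> t)) has_real_derivative D) (at t within I)"
    using real_differentiable_def by blast
  have "((\<lambda>t. w (\<gamma> t) + lam * t\<^sup>2) has_real_derivative D + lam * (2 * t)) (at t within I)"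
    using D by (auto intro!: derivative_eq_intros)
  then have "(w (\<gamma> s) + lam * s\<^sup>2) - (w (\<gamma> t) + lam * t\<^sup>2) \<ge> (D + lam * (2 * t)) * (s - t)" if "s \<in> I" for s
    using convex_on_imp_above_tangent[OF cv _ t that] \<gamma>(1)
    by (auto simp: shortest_path_def is_interval_connected_1)
  then show ?thesis
    by (intro exI[of _ D]) (fastforce simp: power2_eq_square algebra_simps)
qed

text \<open>For values close to 1, squaring preserves a support inequality, and the loss grows by
  the factor 3 because \<open>2 * b \<le> 3\<close>. The gain \<open>(a - b)\<^sup>2\<close> is
  kept: it is the source of strong convexity later.\<close>

lemma square_support:
  fixes a b c :: real
  assumes "a \<ge> b + c - d" "\<bar>b - 1\<bar> \<le> 1/2" "d \<ge> 0"
  shows "a\<^sup>2 \<ge> b\<^sup>2 + 2 * b * c - 3 * d + (a - b)\<^sup>2"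
proof -
  have b: "0 \<le> b" "b \<le> 3/2" using assms(2) by linarith+
  have "2 * b * (a - b - c) \<ge> 2 * b * (- d)" using assms b by (intro mult_left_mono) auto
  moreover have "2 * b * d \<le> 3 * d" using assms b by (intro mult_right_mono) auto
  ultimately show ?thesis by (simp add: power2_eq_square algebra_simps)
qed

lemma regular_on_square_support:
  assumes w: "regular_on W w" "semi W lam w" "lam \<ge> 0" and near1: "\<And>y. y \<in> W \<Longrightarrow> \<bar>w y - 1\<bar> \<le> 1/2"
    and \<gamma>: "shortest_path I \<gamma>" "\<gamma> ` I \<subseteq> W" and t: "t \<in> interior I"
  shows "\<exists>m. \<forall>s\<in>I. (w (\<gamma> s))\<^sup>2 \<ge> (w (\<gamma> t))\<^sup>2 + m * (s - t) - 3 * lam * (s - t)\<^sup>2 + (w (\<gamma> s) - w (\<gamma> t))\<^sup>2"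
proof -
  obtain m where m: "\<forall>s\<in>I. w (\<gamma> s) \<ge> w (\<gamma> t) + m * (s - t) - lam * (s - t)\<^sup>2"
    using regular_on_support[OF w(1,2) \<gamma> t] by blast
  have "\<gamma> t \<in> W" using t interior_subset \<gamma> by blast
  then have "(w (\<gamma> s))\<^sup>2 \<ge> (w (\<gamma> t))\<^sup>2 + 2 * w (\<gamma> t) * (m * (s - t)) - 3 * (lam * (s - t)\<^sup>2) + (w (\<gamma> s) - w (\<gamma> t))\<^sup>2"
    if "s \<in> I" for s
    using m that near1 w(3) by (intro square_support) auto
  then show ?thesis by (intro exI[of _ "2 * w (\<gamma> t) * m"]) (simp add: mult.assoc)
qed

lemma regular_on_square:
  assumes w: "regular_on W w" and near1: "\<And>y. y \<in> W \<Longrightarrow> \<bar>w y - 1\<bar> \<le> 1/2"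
  shows "regular_on W (\<lambda>y. (w y)\<^sup>2)"
  unfolding regular_on_def
proof (intro conjI allI impI)
  obtain L where L: "\<And>y z. y \<in> W \<Longrightarrow> z \<in> W \<Longrightarrow> \<bar>w y - w z\<bar> \<le> L * dist y z"
    using regular_on_lip[OF w] by blast
  have "\<bar>(w y)\<^sup>2 - (w z)\<^sup>2\<bar> \<le> (3 * L) * dist y z" if yz: "y \<in> W" "z \<in> W" for y z
  proof -
    have "\<bar>(w y)\<^sup>2 - (w z)\<^sup>2\<bar> = \<bar>w y + w z\<bar> * \<bar>w y - w z\<bar>"
      by (simp add: power2_eq_square algebra_simps flip: abs_mult)
    also have "\<dots> \<le> 3 * (L * dist y z)"
      using near1[OF yz(1)] near1[OF yz(2)] L[OF yz] by (intro mult_mono) (auto simp: abs_real_def split: if_splits)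
    finally show ?thesis by simp
  qed
  then show "\<exists>L. \<forall>y\<in>W. \<forall>z\<in>W. \<bar>(w y)\<^sup>2 - (w z)\<^sup>2\<bar> \<le> L * dist y z" by blast
  show "(\<lambda>t. (w (\<gamma> t))\<^sup>2) differentiable_on I" if "shortest_path I \<gamma> \<and> \<gamma> ` I \<subseteq> W" for I \<gamma>
    using regular_on_differentiable[OF w, of I \<gamma>] that unfolding power2_eq_square
    by (intro differentiable_on_mult) auto
  obtain lam where lam: "lam \<ge> 0" "semi W lam w" using regular_on_semi[OF w] by blast
  have "semi W (3 * lam) (\<lambda>y. (w y)\<^sup>2)"
    unfolding semi_def
  proof (intro allI impI)
    fix I \<gamma> assume *: "shortest_path I \<gamma> \<and> \<gamma> ` I \<subseteq> W"
    show "convex_on I (\<lambda>t. (w (\<gamma> t))\<^sup>2 + 3 * lam * t\<^sup>2)"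
    proof (rule convex_on_by_support)
      show "is_interval I" using * by (simp add: shortest_path_def)
      fix t assume t: "t \<in> interior I"
      obtain m where m: "\<And>s. s \<in> I \<Longrightarrow> (w (\<gamma> s))\<^sup>2 \<ge> (w (\<gamma> t))\<^sup>2 + m * (s - t) - 3 * lam * (s - t)\<^sup>2 + (w (\<gamma> s) - w (\<gamma> t))\<^sup>2"
        using regular_on_square_support[OF w lam(2,1) near1 conjunct1[OF *] conjunct2[OF *] t] by blast
      have "(w (\<gamma> s))\<^sup>2 + 3 * lam * s\<^sup>2 \<ge> (w (\<gamma> t))\<^sup>2 + 3 * lam * t\<^sup>2 + (m + 6 * lam * t) * (s - t)" if "s \<in> I" for s
      proof -
        have "(w (\<gamma> s))\<^sup>2 \<ge> (w (\<gamma> t))\<^sup>2 + m * (s - t) - 3 * lam * (s - t)\<^sup>2"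
          using m[OF that] zero_le_power2[of "w (\<gamma> s) - w (\<gamma> t)"] by linarith
        then show ?thesis by (simp add: power2_eq_square algebra_simps)
      qed
      then show "\<exists>m. \<forall>s\<in>I. (w (\<gamma> s))\<^sup>2 + 3 * lam * s\<^sup>2 \<ge> (w (\<gamma> t))\<^sup>2 + 3 * lam * t\<^sup>2 + m * (s - t)" by blast
    qed
  qed
  then show "\<exists>lam. semi W lam (\<lambda>y. (w y)\<^sup>2)" by blast
qed

lemma tvec_affine_square:
  assumes v: "tvec x c v" and u: "regular_at x u" "u x = B" and sq: "regular_at x (\<lambda>y. (1 + M * (u y - B))\<^sup>2)"
  shows "v (\<lambda>y. (1 + M * (u y - B))\<^sup>2) = 2 * M * v u"
proof -
  obtain b \<gamma> where b: "b > 0" and \<gamma>: "shortest_path {-b..b} \<gamma>" "\<gamma> 0 = x"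
    and v: "v = (\<lambda>u. if regular_at x u then c * deriv (\<lambda>t. u (\<gamma> t)) 0 else 0)"
    using v unfolding tvec_def by blast
  have "((\<lambda>t. (1 + M * (u (\<gamma> t) - B))\<^sup>2) has_real_derivative 2 * M * deriv (\<lambda>t. u (\<gamma> t)) 0) (at 0)"
    using regular_at_path[OF u(1) \<gamma> b] by (auto intro!: derivative_eq_intros simp: \<gamma>(2) u(2))
  then have "deriv (\<lambda>t. (1 + M * (u (\<gamma> t) - B))\<^sup>2) 0 = 2 * M * deriv (\<lambda>t. u (\<gamma> t)) 0"
    by (rule DERIV_imp_deriv)
  then show ?thesis unfolding v using u sq by simp
qed

lemma Euclidean_space_eq: "Euclidean_space n = top_of_set {x::nat \<Rightarrow> real. \<forall>i\<ge>n. x i = 0}"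
  unfolding Euclidean_space_def euclidean_product_topology ..

text \<open>The coordinates are geodesically convex and so is \<open>\<psi>0\<close>, whose differential is close to minus the sum of
  the coordinate differentials: moving to smaller coordinates increases \<open>\<psi>0\<close>. The function \<open>s\<close> is strongly
  convex. Both are only used to show that coordinate expressions are DC.\<close>

definition good_chart :: "nat \<Rightarrow> 'a::metric_space set \<Rightarrow> ('a \<Rightarrow> nat \<Rightarrow> real) \<Rightarrow> bool" where
  "good_chart n V \<psi> \<longleftrightarrow> open V \<and> (\<forall>y. \<forall>i\<ge>n. \<psi> y i = 0) \<and> openin (Euclidean_space n) (\<psi> ` V) \<and>
    (\<exists>\<kappa>>0. \<forall>y\<in>V. \<forall>z\<in>V. \<kappa> * dist y z \<le> (\<Sum>i<n. \<bar>\<psi> y i - \<psi> z i\<bar>)) \<and>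
    (\<forall>i<n. regular_on V (\<lambda>y. \<psi> y i) \<and> semi V 0 (\<lambda>y. \<psi> y i)) \<and>
    (\<exists>\<psi>0. regular_on V \<psi>0 \<and> semi V 0 \<psi>0 \<and>
      (\<forall>y\<in>V. \<forall>z\<in>V. \<bar>\<psi>0 y - \<psi>0 z + (\<Sum>i<n. \<psi> y i - \<psi> z i)\<bar> \<le> (\<Sum>i<n. \<bar>\<psi> y i - \<psi> z i\<bar>) / 2)) \<and>
    (\<exists>s. regular_on V s \<and> semi V (-1) s)"

section \<open>Squared distances: first variation and separation of points\<close>

locale semiconvex_gspace = gspace T for T :: "'a::metric_space itself" +
  assumes semiconvex: "locally_semiconvex T" and differentiable: "locally_differentiable T"
begin

abbreviation sqd :: "'a \<Rightarrow> 'a \<Rightarrow> real" where "sqd p y \<equiv> (dist p y)\<^sup>2"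

lemma sqd_regular:
  fixes x :: 'a
  obtains e lam where "0 < e" "lam \<ge> 0" "\<And>p. p \<in> ball x e \<Longrightarrow> semi (ball x e) lam (sqd p)"
    "\<And>p. p \<in> ball x e \<Longrightarrow> regular_on (ball x e) (sqd p)"
    "\<And>p y z. p \<in> ball x e \<Longrightarrow> y \<in> ball x e \<Longrightarrow> z \<in> ball x e \<Longrightarrow> \<bar>sqd p y - sqd p z\<bar> \<le> 4 * dist y z"
proof -
  obtain lam U where U: "open U" "x \<in> U" and
    lam: "\<forall>p\<in>U. \<forall>I \<gamma>. shortest_path I \<gamma> \<and> \<gamma> ` I \<subseteq> U \<longrightarrow> convex_on I (\<lambda>t. (dist p (\<gamma> t))\<^sup>2 + lam * t\<^sup>2)"
    using semiconvex[unfolded locally_semiconvex_def, THEN spec, of x] by (elim exE conjE) (rule that; assumption)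
  obtain V where V: "open V" "x \<in> V" and
    df: "\<forall>p\<in>V. \<forall>I \<gamma>. shortest_path I \<gamma> \<and> \<gamma> ` I \<subseteq> V \<longrightarrow> (\<lambda>t. (dist p (\<gamma> t))\<^sup>2) differentiable_on I"
    using differentiable[unfolded locally_differentiable_def, THEN spec, of x] by (elim exE conjE) (rule that; assumption)
  have "open (U \<inter> V \<inter> ball x 1)" "x \<in> U \<inter> V \<inter> ball x 1" using U V by auto
  then obtain e where e: "e > 0" "ball x e \<subseteq> U \<inter> V \<inter> ball x 1" using open_contains_ball by blast
  have sc: "semi (ball x e) (max lam 0) (sqd p)" if "p \<in> ball x e" for p
  proof (rule semi_mono)
    show "semi (ball x e) lam (sqd p)" unfolding semi_def using lam that e by blast
  qed simp
  have lip: "\<bar>sqd p y - sqd p z\<bar> \<le> 4 * dist y z" if "p \<in> ball x e" "y \<in> ball x e" "z \<in> ball x e" for p y z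
  proof -
    have "p \<in> ball x 1" "y \<in> ball x 1" "z \<in> ball x 1" using that e by blast+
    then have "dist p x \<le> 1" "dist x y \<le> 1" "dist x z \<le> 1" by (auto simp: dist_commute)
    \<comment> \<open>All points are within 1 of \<open>x\<close>; this is the origin of the
      Lipschitz constant 4.\<close>
    then have "dist p y + dist p z \<le> 4" using dist_triangle[of p y x] dist_triangle[of p z x] by simp
    moreover have "\<bar>dist p y - dist p z\<bar> \<le> dist y z"
      using dist_triangle[of p y z] dist_triangle[of p z y] by (simp add: dist_commute abs_le_iff)
    ultimately have "\<bar>dist p y - dist p z\<bar> * (dist p y + dist p z) \<le> dist y z * 4"
      by (intro mult_mono) auto
    moreover have "\<bar>sqd p y - sqd p z\<bar> = \<bar>dist p y - dist p z\<bar> * \<bar>dist p y + dist p z\<bar>"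
      unfolding abs_mult[symmetric] by (simp add: power2_eq_square algebra_simps)
    ultimately show ?thesis by simp
  qed
  have "regular_on (ball x e) (sqd p)" if p: "p \<in> ball x e" for p
    unfolding regular_on_def
  proof (intro conjI allI impI)
    show "\<exists>L. \<forall>y\<in>ball x e. \<forall>z\<in>ball x e. \<bar>sqd p y - sqd p z\<bar> \<le> L * dist y z" using lip[OF p] by blast
    show "\<exists>lam. semi (ball x e) lam (sqd p)" using sc[OF p] by blast
    show "(\<lambda>t. sqd p (\<gamma> t)) differentiable_on I" if "shortest_path I \<gamma> \<and> \<gamma> ` I \<subseteq> ball x e" for I \<gamma>
      using df p that e by blast
  qed
  then show ?thesis using that[of e "max lam 0"] e sc lip by simp
qed

lemma sqd_regular_at: "\<exists>U. open U \<and> x \<in> U \<and> (\<forall>p\<in>U. \<forall>y\<in>U. regular_at y (sqd p))" for x :: 'a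
proof -
  obtain e lam where "0 < e" "\<And>p. p \<in> ball x e \<Longrightarrow> regular_on (ball x e) (sqd p)"
    by (rule sqd_regular[of x]) (rule that; assumption)
  then show ?thesis by (intro exI[of _ "ball x e"]) (auto intro: regular_on_at[of "ball x e"])
qed

text \<open>The derivation determines the length. Test it on the squared distance to a point
  \<open>p\<close> ahead on the first geodesic: its derivative is \<open>- 2 * t\<close> along that
  geodesic and, by the triangle inequality, at least \<open>- 2 * t\<close> along any other
  one.\<close>

lemma tvec_norm_le:
  fixes x :: 'a
  assumes v: "tvec x c v" and w: "tvec x c' v"
  shows "c \<le> c'"
proof (cases "c = 0")
  case True
  then show ?thesis using tvec_ge0[OF w] by simp
next
  case False
  obtain b \<gamma> where b: "b > 0" and \<gamma>: "shortest_path {-b..b} \<gamma>" "\<gamma> 0 = x"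
    and v1: "v = (\<lambda>u. if regular_at x u then c * deriv (\<lambda>t. u (\<gamma> t)) 0 else 0)"
    using v unfolding tvec_def by blast
  obtain b' \<gamma>' where b': "b' > 0" and \<gamma>': "shortest_path {-b'..b'} \<gamma>'" "\<gamma>' 0 = x"
    and v2: "v = (\<lambda>u. if regular_at x u then c' * deriv (\<lambda>t. u (\<gamma>' t)) 0 else 0)"
    using w unfolding tvec_def by blast
  obtain U where U: "open U" "x \<in> U" "\<And>p y. p \<in> U \<Longrightarrow> y \<in> U \<Longrightarrow> regular_at y (sqd p)"
    using sqd_regular_at[of x] by blast
  obtain e where e: "e > 0" "ball x e \<subseteq> U" using U open_contains_ball by blast
  define t where "t = min b (e / 2)"
  have t: "0 < t" "t \<le> b" "t < e" using e b unfolding t_def by auto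
  define p where "p = \<gamma> t"
  have dp: "dist x p = t" using shortest_path_dist[OF \<gamma>(1), of 0 t] t \<gamma>(2) unfolding p_def by auto
  then have reg: "regular_at x (sqd p)" using U e t by auto
  have D1: "deriv (\<lambda>s. sqd p (\<gamma> s)) 0 = - 2 * t"
  proof (rule DERIV_imp_deriv)
    have "((\<lambda>s. (t - s)\<^sup>2) has_real_derivative - 2 * t) (at 0)"
      by (auto intro!: derivative_eq_intros)
    moreover have "\<forall>\<^sub>F s in nhds 0. (t - s)\<^sup>2 = sqd p (\<gamma> s)"
    proof -
      have "\<forall>\<^sub>F s in nhds 0. s \<in> {-b<..<b}" using b by (intro eventually_nhds_in_open) auto
      then show ?thesis
      proof eventually_elim
        case (elim s)
        then have "dist p (\<gamma> s) = \<bar>t - s\<bar>" unfolding p_def using t by (intro shortest_path_dist[OF \<gamma>(1)]) auto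
        then show ?case by simp
      qed
    qed
    ultimately show "((\<lambda>s. sqd p (\<gamma> s)) has_real_derivative - 2 * t) (at 0)"
      using DERIV_cong_ev[of 0 0] by fastforce
  qed
  define D where "D = deriv (\<lambda>s. sqd p (\<gamma>' s)) 0"
  \<comment> \<open>For small positive \<open>s\<close> the function \<open>(t - s)\<^sup>2\<close>
    lies below \<open>sqd p (\<gamma>' s)\<close>, with equality at 0; a smaller \<open>D\<close>
    would reverse this.\<close>
  have D2: "D \<ge> - 2 * t"
  proof (rule ccontr)
    assume "\<not> D \<ge> - 2 * t"
    then have neg: "D + 2 * t < 0" by simp
    have "((\<lambda>s. sqd p (\<gamma>' s) - (t - s)\<^sup>2) has_real_derivative D + 2 * t) (at 0)"
    proof -
      have "((\<lambda>s. (t - s)\<^sup>2) has_real_derivative - 2 * t) (at 0)"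
        by (auto intro!: derivative_eq_intros)
      from DERIV_diff[OF regular_at_path[OF reg \<gamma>' b'] this] show ?thesis unfolding D_def by simp
    qed
    from DERIV_neg_dec_right[OF this neg] obtain d where d: "d > 0"
      "\<And>h. 0 < h \<Longrightarrow> h < d \<Longrightarrow> sqd p (\<gamma>' (0 + h)) - (t - (0 + h))\<^sup>2 < sqd p (\<gamma>' 0) - (t - 0)\<^sup>2" by blast
    define h where "h = min (min (d / 2) t) b'"
    have h: "0 < h" "h < d" "h \<le> t" "h \<le> b'" using d t b' unfolding h_def by auto
    have "dist x (\<gamma>' h) = h" using shortest_path_dist[OF \<gamma>'(1), of 0 h] h \<gamma>'(2) by auto
    then have "t - h \<le> dist p (\<gamma>' h)" using dist_triangle[of x p "\<gamma>' h"] dp by (simp add: dist_commute)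
    then have "(t - h)\<^sup>2 \<le> sqd p (\<gamma>' h)" using h by (intro power_mono) auto
    moreover have "sqd p (\<gamma>' 0) = t\<^sup>2" using dp \<gamma>'(2) by (simp add: dist_commute)
    ultimately show False using d(2)[OF h(1,2)] by simp
  qed
  have "c * (- 2 * t) = c' * D" using fun_cong[OF v1, of "sqd p"] fun_cong[OF v2, of "sqd p"] reg D1
    unfolding D_def by simp
  moreover have "c' * D \<ge> c' * (- 2 * t)" using D2 tvec_ge0[OF w] by (rule mult_left_mono)
  ultimately have "t * c \<le> t * c'" by (simp add: mult.commute)
  then show ?thesis using t by simp
qed

lemma tvec_norm_unique: "tvec (x::'a) c v \<Longrightarrow> tvec x c' v \<Longrightarrow> c = c'"
  using tvec_norm_le by (meson order_antisym)

text \<open>The sum of the two squared distances attains its minimum at the midpoint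
  \<open>x\<close> of \<open>p\<close> and \<open>q\<close>, so its derivative vanishes along every
  geodesic through \<open>x\<close>.\<close>

lemma opposite_tvec:
  fixes x :: 'a
  assumes v: "tvec x c v" and reg: "regular_at x (sqd p)" "regular_at x (sqd q)"
    and b: "dist p x = b" "dist q x = b" "dist p q = 2 * b"
  shows "v (sqd q) = - v (sqd p)"
proof -
  define h where "h y = sqd p y + sqd q y" for y
  have rh: "regular_at x h" unfolding h_def by (rule regular_at_add[OF reg])
  have hx: "h x \<le> h y" for y
  proof -
    have "2 * b \<le> dist p y + dist q y" using dist_triangle[of p q y] b by (simp add: dist_commute)
    then have "(2 * b)\<^sup>2 \<le> (dist p y + dist q y)\<^sup>2" using b zero_le_dist[of p x] by (intro power_mono) auto
    also have "\<dots> \<le> 2 * h y" unfolding h_def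
      using zero_le_power2[of "dist p y - dist q y"] by (simp add: power2_eq_square algebra_simps)
    finally show ?thesis using b unfolding h_def by (simp add: power2_eq_square)
  qed
  obtain \<beta> \<gamma> where \<beta>: "\<beta> > 0" and \<gamma>: "shortest_path {-\<beta>..\<beta>} \<gamma>" "\<gamma> 0 = x"
    and v1: "v = (\<lambda>u. if regular_at x u then c * deriv (\<lambda>t. u (\<gamma> t)) 0 else 0)"
    using v unfolding tvec_def by blast
  have "deriv (\<lambda>t. h (\<gamma> t)) 0 = 0"
    using DERIV_local_min[OF regular_at_path[OF rh \<gamma> \<beta>] \<beta>] hx \<gamma>(2) by simp
  then have "v h = 0" unfolding v1 by simp
  then show ?thesis using tvec_additive[OF v reg] unfolding h_def by simp
qed

text \<open>The geodesic from \<open>y\<close> through \<open>z\<close>, prolonged to the sphere,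
  hits it at some \<open>q\<close>, and the distance to \<open>q\<close> falls at unit speed.
  Replacing \<open>q\<close> by a point \<open>p\<close> of a finite net costs a fixed error,
  harmless at the fixed scale \<open>\<tau>\<close> but not at the scale \<open>dist y z\<close>;
  semiconvexity carries the estimate from \<open>\<tau>\<close> down to
  \<open>dist y z\<close>.\<close>

lemma separating_net:
  fixes x :: 'a
  assumes e: "0 < e" "lam \<ge> 0" "\<And>p. p \<in> ball x e \<Longrightarrow> semi (ball x e) lam (sqd p)"
  obtains P b r where "finite P" "0 < b" "b < e" "0 < r" "r \<le> e" "\<And>p. p \<in> P \<Longrightarrow> dist x p = b"
    "\<And>p. p \<in> P \<Longrightarrow> \<exists>q. dist x q = b \<and> dist p q = 2 * b"
    "\<And>y z. y \<in> ball x r \<Longrightarrow> z \<in> ball x r \<Longrightarrow> \<exists>p\<in>P. b * dist y z \<le> sqd p y - sqd p z"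
proof -
  obtain a where a: "a > 0" and pth: "\<And>y z. y \<in> ball x a \<Longrightarrow> z \<in> ball x a \<Longrightarrow>
      \<exists>\<gamma>. shortest_path {-3*a..3*a} \<gamma> \<and> \<gamma> 0 = y \<and> \<gamma> (dist y z) = z"
    by (rule two_sided_path[of x]) (rule that; assumption)
  define b where "b = min e a / 4"
  have b: "0 < b" "4 * b \<le> e" "4 * b \<le> a" using e a unfolding b_def by auto
  \<comment> \<open>At this scale the quadratic terms contribute \<open>(1 + lam) * \<tau>\<close>,
    a quarter of \<open>b\<close>, against a main term of about \<open>2 * b\<close>.\<close>
  define \<tau> where "\<tau> = b / (4 * (1 + lam))"
  have \<tau>: "0 < \<tau>" "4 * ((1 + lam) * \<tau>) = b" using b e unfolding \<tau>_def by (auto simp: field_simps)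
  have \<tau>b: "4 * \<tau> \<le> b"
  proof -
    have "4 * (1 * \<tau>) \<le> 4 * ((1 + lam) * \<tau>)" using \<tau>(1) e(2) by (intro mult_left_mono mult_right_mono) auto
    then show ?thesis using \<tau>(2) by simp
  qed
  \<comment> \<open>The net error \<open>8 * b * \<epsilon>\<close> is then
    \<open>\<tau> * (b / 4)\<close>. With \<open>r\<close> half of \<open>\<tau>\<close>, any two
    points of \<open>ball x r\<close> are less than \<open>\<tau>\<close> apart.\<close>
  define \<epsilon> where "\<epsilon> = \<tau> / 32"
  define r where "r = \<tau> / 2"
  have \<epsilon>: "\<epsilon> > 0" "32 * \<epsilon> = \<tau>" and r: "r > 0" "2 * r = \<tau>" unfolding \<epsilon>_def r_def using \<tau> by auto
  define K where "K = sphere x b"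
  have "compact K"
  proof (rule closed_bounded_compact)
    show "closed K" unfolding K_def sphere_def by (intro closed_Collect_eq continuous_intros)
    show "bounded K" unfolding K_def by (rule bounded_subset[of "cball x b"]) auto
  qed
  then obtain P where P: "finite P" "P \<subseteq> K" "K \<subseteq> (\<Union>p\<in>P. ball p \<epsilon>)"
    using seq_compact_imp_totally_bounded[of K] \<epsilon> compact_eq_seq_compact_metric by metis
  have opp: "\<exists>q. dist x q = b \<and> dist p q = 2 * b" if "p \<in> K" for p
  proof -
    have "dist x p = b" using that unfolding K_def by (simp add: dist_commute)
    then obtain \<gamma> where \<gamma>: "shortest_path {-3*a..3*a} \<gamma>" "\<gamma> 0 = x" "\<gamma> b = p"
      using pth[of x p] a b by auto
    have "dist (\<gamma> 0) (\<gamma> (-b)) = \<bar>0 - - b\<bar>" "dist (\<gamma> b) (\<gamma> (-b)) = \<bar>b - - b\<bar>"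
      using a b shortest_path_dist[OF \<gamma>(1), of 0 "-b"] shortest_path_dist[OF \<gamma>(1), of b "-b"] by auto
    then show ?thesis using \<gamma> b by (intro exI[of _ "\<gamma> (-b)"]) auto
  qed
  have main: "\<exists>p\<in>P. b * dist y z \<le> sqd p y - sqd p z" if yz: "y \<in> ball x r" "z \<in> ball x r" for y z
  proof -
    have ra: "r \<le> a" "r < b" using r \<tau>b b \<tau> by auto
    then obtain \<gamma> where \<gamma>: "shortest_path {-3*a..3*a} \<gamma>" "\<gamma> 0 = y" "\<gamma> (dist y z) = z"
      using pth[of y z] yz by auto
    define d where "d = dist y z"
    have d: "0 \<le> d" "d < \<tau>" "\<gamma> d = z"
      using dist_triangle[of y z x] yz r \<gamma>(3) unfolding d_def by (auto simp: dist_commute)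
    have dy: "dist y (\<gamma> t) = t" if "0 \<le> t" "t \<le> 3 * a" for t
      using shortest_path_dist[OF \<gamma>(1), of 0 t] that a \<gamma>(2) by auto
    have "continuous_on {0..2*a} (\<lambda>t. dist x (\<gamma> t))"
      by (intro continuous_intros continuous_on_subset[OF shortest_path_continuous_on[OF \<gamma>(1)]])
        (use a in auto)
    moreover have "dist x (\<gamma> 0) \<le> b" using \<gamma>(2) yz ra by auto
    moreover have "b \<le> dist x (\<gamma> (2*a))"
      using dy[of "2*a"] dist_triangle[of y "\<gamma> (2*a)" x] yz ra a b by (auto simp: dist_commute)
    ultimately obtain t where t: "0 \<le> t" "t \<le> 2*a" "dist x (\<gamma> t) = b"
      using IVT'[of "\<lambda>t. dist x (\<gamma> t)" 0 b "2*a"] a by auto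
    have tb: "b - r \<le> t" "t \<le> b + r"
      using dy[of t] t dist_triangle[of x "\<gamma> t" y] dist_triangle[of y "\<gamma> t" x] yz a
      by (auto simp: dist_commute)
    define q where "q = \<gamma> t"
    have "q \<in> K" using t unfolding K_def q_def by simp
    then obtain p where p: "p \<in> P" "dist p q < \<epsilon>" using P(3) by auto
    have pK: "dist x p = b" using p(1) P(2) unfolding K_def by auto
    define k where "k s = sqd p (\<gamma> s) + lam * s\<^sup>2" for s
    have "convex_on {0..\<tau>} k"
    proof -
      have sp: "shortest_path {0..\<tau>} \<gamma>"
        by (rule shortest_path_subset[OF \<gamma>(1)]) (use \<tau> \<tau>b a b in \<open>auto simp: is_interval_cc\<close>)
      moreover have "\<gamma> s \<in> ball x e" if "s \<in> {0..\<tau>}" for s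
        using dy[of s] that dist_triangle[of x "\<gamma> s" y] yz \<tau> \<tau>b a b r by auto
      moreover have "p \<in> ball x e" using pK b by auto
      ultimately show ?thesis using e(3) unfolding semi_def k_def by blast
    qed
    then have "k ((1 - d/\<tau>) *\<^sub>R 0 + (d/\<tau>) *\<^sub>R \<tau>) \<le> (1 - d/\<tau>) * k 0 + (d/\<tau>) * k \<tau>"
      using d \<tau> by (intro convex_onD) auto
    \<comment> \<open>Convexity bounds the change up to time \<open>d\<close> by the proportional
      part of the change up to time \<open>\<tau>\<close>.\<close>
    then have kd: "k d - k 0 \<le> (d/\<tau>) * (k \<tau> - k 0)" using \<tau> by (simp add: algebra_simps)
    have pq: "\<bar>sqd p w - sqd q w\<bar> \<le> 4 * b * \<epsilon>" if "dist q w \<le> t" for w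
    proof -
      have 1: "\<bar>dist p w - dist q w\<bar> \<le> \<epsilon>"
        using dist_triangle[of p w q] dist_triangle[of q w p] p(2) by (simp add: dist_commute abs_le_iff)
      then have 2: "dist p w + dist q w \<le> 4 * b" using that tb r \<tau>b \<epsilon> by linarith
      have "\<bar>sqd p w - sqd q w\<bar> = \<bar>dist p w - dist q w\<bar> * \<bar>dist p w + dist q w\<bar>"
        unfolding abs_mult[symmetric] by (simp add: power2_eq_square algebra_simps)
      also have "\<dots> \<le> \<epsilon> * (4 * b)" using 1 2 \<epsilon> by (intro mult_mono) auto
      finally show ?thesis by (simp add: mult_ac)
    qed
    have q0: "dist q y = t" using dy[of t] t a unfolding q_def by (simp add: dist_commute)
    have q\<tau>: "dist q (\<gamma> \<tau>) = t - \<tau>"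
      using shortest_path_dist[OF \<gamma>(1), of t \<tau>] t a b tb r \<tau> \<tau>b unfolding q_def by auto
    have "k \<tau> - k 0 = sqd p (\<gamma> \<tau>) - sqd p y + lam * \<tau>\<^sup>2" unfolding k_def \<gamma>(2) by simp
    also have "\<dots> \<le> (t - \<tau>)\<^sup>2 - t\<^sup>2 + 8 * b * \<epsilon> + lam * \<tau>\<^sup>2"
      using pq[of "\<gamma> \<tau>"] pq[of y] q0 q\<tau> \<tau> by simp
    also have "\<dots> = \<tau> * ((1 + lam) * \<tau> - 2 * t) + 8 * b * \<epsilon>"
      by (simp add: power2_eq_square algebra_simps)
    also have "\<dots> \<le> \<tau> * (b / 4 - 3 / 2 * b) + \<tau> * (b / 4)"
    proof -
      have "(1 + lam) * \<tau> - 2 * t \<le> b / 4 - 3 / 2 * b" using \<tau>(2) tb r \<tau>b by linarith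
      moreover have "8 * b * \<epsilon> = \<tau> * (b / 4)" using \<epsilon>(2)[symmetric] by simp
      moreover have "\<tau> * ((1 + lam) * \<tau> - 2 * t) \<le> \<tau> * (b / 4 - 3 / 2 * b)"
        using calculation(1) \<tau>(1) by (intro mult_left_mono) auto
      ultimately show ?thesis by linarith
    qed
    also have "\<dots> = - b * \<tau>" by (simp add: algebra_simps)
    finally have "(d/\<tau>) * (k \<tau> - k 0) \<le> (d/\<tau>) * (- b * \<tau>)" using d \<tau> by (intro mult_left_mono) auto
    moreover have "(d/\<tau>) * (- b * \<tau>) = - b * d" using \<tau> by simp
    ultimately have "k d - k 0 \<le> - b * d" using kd by linarith
    moreover have "0 \<le> lam * d\<^sup>2" using e by simp
    ultimately have "b * d \<le> sqd p y - sqd p z" unfolding k_def using d(3) \<gamma>(2) by simp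
    then show ?thesis using p(1) unfolding d_def by blast
  qed
  show ?thesis
  proof (rule that[of P b r])
    show "b < e" "r \<le> e" using b r \<tau>b by auto
    show "dist x p = b" if "p \<in> P" for p using that P(2) unfolding K_def by auto
  qed (use P b r opp main in blast)+
qed

end

lemma tendsto_inverse_Suc: "(\<lambda>k. 1 / real (Suc k)) \<longlonglongrightarrow> 0"
  using LIMSEQ_Suc[OF lim_1_over_n] by simp

lemma tendsto_0_if_abs_less:
  fixes a :: "nat \<Rightarrow> real"
  assumes "\<And>k. \<bar>a k\<bar> < 1 / real (Suc k)" shows "a \<longlonglongrightarrow> 0"
proof (rule metric_tendsto_imp_tendsto[OF tendsto_inverse_Suc])
  show "\<forall>\<^sub>F k in sequentially. dist (a k) 0 \<le> dist (1 / real (Suc k)) 0"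
    using assms by (auto simp: dist_real_def intro!: always_eventually less_imp_le)
qed

lemma tendsto_if_dist_less:
  fixes y z :: "nat \<Rightarrow> 'b::metric_space"
  assumes y: "y \<longlonglongrightarrow> x" and zy: "\<And>k. dist (z k) (y k) < 1 / real (Suc k)" shows "z \<longlonglongrightarrow> x"
proof -
  have "(\<lambda>k. dist (z k) (y k)) \<longlonglongrightarrow> 0" using zy by (intro tendsto_0_if_abs_less) simp
  then have "(\<lambda>k. dist (z k) (y k) + dist (y k) x) \<longlonglongrightarrow> 0 + dist x x"
    by (intro tendsto_add tendsto_dist y tendsto_const)
  then have d0: "(\<lambda>k. dist (z k) (y k) + dist (y k) x) \<longlonglongrightarrow> 0" by simp
  show ?thesis
  proof (rule metric_tendsto_imp_tendsto[OF d0])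
    have "dist (z k) x \<le> dist (dist (z k) (y k) + dist (y k) x) 0" for k
      using dist_triangle[of "z k" x "y k"] by (simp add: dist_real_def)
    then show "\<forall>\<^sub>F k in sequentially. dist (z k) x \<le> dist (dist (z k) (y k) + dist (y k) x) 0" by simp
  qed
qed

section \<open>Construction of a good chart\<close>

context semiconvex_gspace
begin

lemma tendsto_ball_inverse:
  fixes x :: 'a
  assumes "\<And>k::nat. y k \<in> ball x (1 / real (Suc k))" shows "y \<longlonglongrightarrow> x"
  using tendsto_if_dist_less[OF tendsto_const, of y x] assms by (simp add: dist_commute)

text \<open>A first-order statement at a point holds with uniform constants for all pairs near it;
  the failing pairs are rescaled by their distance.\<close>

lemma near_pairs:
  fixes x :: 'a
  assumes reg: "\<And>i. i \<in> J \<Longrightarrow> regular_at x (f i)"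
    and first_order: "\<And>y z v. \<lbrakk>tvec x 1 v; \<And>k. y k \<noteq> z k; y \<longlonglongrightarrow> x; z \<longlonglongrightarrow> x;
      \<And>i. i \<in> J \<Longrightarrow> (\<lambda>k. (f i (z k) - f i (y k)) / dist (y k) (z k)) \<longlonglongrightarrow> v (f i);
      \<And>k. \<exists>n\<ge>k. \<not> Q n (y k) (z k)\<rbrakk> \<Longrightarrow> False"
    and Q_refl: "\<And>n y. Q n y y"
  shows "\<exists>n r. 0 < r \<and> (\<forall>y\<in>ball x r. \<forall>z\<in>ball x r. Q (n::nat) y z)"
proof (rule ccontr)
  assume contr: "\<not> (\<exists>n r. 0 < r \<and> (\<forall>y\<in>ball x r. \<forall>z\<in>ball x r. Q (n::nat) y z))"
  have "\<forall>k. \<exists>y z. y \<in> ball x (1 / real (Suc k)) \<and> z \<in> ball x (1 / real (Suc k)) \<and> \<not> Q k y z"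
  proof
    fix k :: nat
    have "0 < 1 / real (Suc k)" by simp
    then show "\<exists>y z. y \<in> ball x (1 / real (Suc k)) \<and> z \<in> ball x (1 / real (Suc k)) \<and> \<not> Q k y z"
      using contr by blast
  qed
  then obtain y z where yz: "\<And>k. y k \<in> ball x (1 / real (Suc k))" "\<And>k. z k \<in> ball x (1 / real (Suc k))"
    "\<And>k. \<not> Q k (y k) (z k)" by metis
  have lim: "y \<longlonglongrightarrow> x" "z \<longlonglongrightarrow> x" using yz tendsto_ball_inverse by auto
  have ne: "y k \<noteq> z k" for k using yz(3)[of k] Q_refl by metis
  have "(\<lambda>k. dist (y k) (z k)) \<longlonglongrightarrow> dist x x" by (intro tendsto_intros lim)
  then have d0: "(\<lambda>k. dist (y k) (z k)) \<longlonglongrightarrow> 0" by simp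
  obtain r c v where r: "strict_mono (r :: nat \<Rightarrow> nat)" and v: "tvec x c v"
    and c: "(\<lambda>k. dist (y (r k)) (z (r k)) / dist (y (r k)) (z (r k))) \<longlonglongrightarrow> c"
    and fv: "\<And>u. regular_at x u \<Longrightarrow> (\<lambda>k. (u (z (r k)) - u (y (r k))) / dist (y (r k)) (z (r k))) \<longlonglongrightarrow> v u"
    using tangent_limit[OF lim _ d0, of 1] ne by auto
  have "(\<lambda>k. 1::real) \<longlonglongrightarrow> c" using c ne by simp
  then have "c = 1" using LIMSEQ_const_iff by metis
  show False
  proof (rule first_order[of v "\<lambda>k. y (r k)" "\<lambda>k. z (r k)"])
    show "tvec x 1 v" using v \<open>c = 1\<close> by simp
    show "(\<lambda>k. y (r k)) \<longlonglongrightarrow> x" "(\<lambda>k. z (r k)) \<longlonglongrightarrow> x"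
      using LIMSEQ_subseq_LIMSEQ[OF lim(1) r] LIMSEQ_subseq_LIMSEQ[OF lim(2) r] unfolding o_def by auto
    show "\<exists>n\<ge>k. \<not> Q n (y (r k)) (z (r k))" for k
      using yz(3)[of "r k"] seq_suble[OF r, of k] by blast
  qed (use ne fv reg in auto)
qed

text \<open>Take a subset of \<open>P\<close> minimal among those detecting every nonzero tangent
  vector. Without \<open>j\<close> some nonzero vector goes undetected; \<open>j\<close> must then
  detect it, and it can be normalized. This yields a basis of differentials and its dual basis at
  once.\<close>

lemma dual_basis:
  fixes x :: 'a
  assumes P: "finite P" and inj: "\<And>c v. tvec x c v \<Longrightarrow> (\<And>p. p \<in> P \<Longrightarrow> v (f p) = 0) \<Longrightarrow> c = 0"
  shows "\<exists>J. J \<subseteq> P \<and> (\<forall>c v. tvec x c v \<longrightarrow> (\<forall>p\<in>J. v (f p) = 0) \<longrightarrow> c = 0) \<and>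
    (\<forall>j\<in>J. \<exists>c v. tvec x c v \<and> v (f j) = 1 \<and> (\<forall>i\<in>J - {j}. v (f i) = 0))"
proof -
  let ?inj = "\<lambda>J. \<forall>c v. tvec x c v \<longrightarrow> (\<forall>p\<in>J. v (f p) = 0) \<longrightarrow> c = 0"
  have "\<exists>J. J \<subseteq> P \<and> ?inj J \<and> (\<forall>K. K \<subset> J \<longrightarrow> \<not> ?inj K)"
  proof -
    have "?inj P" using inj by blast
    with P show ?thesis
    proof (induction P rule: finite_psubset_induct)
    case (psubset A)
    show ?case
    proof (cases "\<exists>K. K \<subset> A \<and> ?inj K")
      case True
      then obtain K where "K \<subset> A" "?inj K" by (elim exE conjE)
      then have "\<exists>J\<subseteq>K. ?inj J \<and> (\<forall>L. L \<subset> J \<longrightarrow> \<not> ?inj L)" by (rule psubset.IH)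
      then obtain J where J: "J \<subseteq> K" "?inj J \<and> (\<forall>L. L \<subset> J \<longrightarrow> \<not> ?inj L)" by (elim exE conjE) (rule that; blast)
      have "J \<subseteq> A" using J(1) \<open>K \<subset> A\<close> by auto
      with J(2) show ?thesis by (intro exI[of _ J] conjI) auto
    next
      case False
      then have "\<forall>K. K \<subset> A \<longrightarrow> \<not> ?inj K" by (simp only: not_ex de_Morgan_conj imp_conv_disj simp_thms)
      then show ?thesis using psubset.prems by (intro exI[of _ A] conjI subset_refl)
    qed
    qed
  qed
  then obtain J where J: "J \<subseteq> P" "?inj J" "\<And>K. K \<subset> J \<Longrightarrow> \<not> ?inj K" by blast
  show ?thesis
  proof (intro exI[of _ J] conjI ballI)
    show "J \<subseteq> P" "?inj J" using J by auto
    fix j assume j: "j \<in> J"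
    then have "\<not> ?inj (J - {j})" by (intro J(3)) auto
    then obtain c v where v: "tvec x c v" "\<forall>p\<in>J - {j}. v (f p) = 0" "c \<noteq> 0" by blast
    then have nz: "v (f j) \<noteq> 0" using J(2) j by (metis DiffI singletonD)
    have "tvec x (\<bar>1 / v (f j)\<bar> * c) (\<lambda>u. 1 / v (f j) * v u)" by (rule tvec_scale[OF v(1)])
    then show "\<exists>c v. tvec x c v \<and> v (f j) = 1 \<and> (\<forall>i\<in>J - {j}. v (f i) = 0)"
      using v(2) nz
      by (intro exI[of _ "\<bar>1 / v (f j)\<bar> * c"] exI[of _ "\<lambda>u. 1 / v (f j) * v u"]) auto
  qed
qed

text \<open>Realize the vector by points \<open>z k\<close>: the net bounds \<open>b * c\<close> by
  the difference quotients of the functions, which tend to 0.\<close>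

lemma net_injective:
  fixes x :: 'a
  assumes P: "finite P" "\<And>p. p \<in> P \<Longrightarrow> regular_at x (f p)" and b: "b > 0" "0 < r"
    and net: "\<And>y z. y \<in> ball x r \<Longrightarrow> z \<in> ball x r \<Longrightarrow> \<exists>p\<in>P. b * dist y z \<le> f p y - f p z"
    and v: "tvec x c v" "\<And>p. p \<in> P \<Longrightarrow> v (f p) = 0"
  shows "c = 0"
proof -
  define \<sigma> where "\<sigma> k = 1 / real (Suc k)" for k
  have \<sigma>: "\<And>k. \<sigma> k > 0" "\<sigma> \<longlonglongrightarrow> 0" unfolding \<sigma>_def using tendsto_inverse_Suc by auto
  obtain s z where s: "strict_mono (s :: nat \<Rightarrow> nat)" and z: "z \<longlonglongrightarrow> x"
    and dz: "\<And>k. dist x (z k) = c * \<sigma> (s k)"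
    and vz: "\<And>u. regular_at x u \<Longrightarrow> (\<lambda>k. (u (z k) - u x) / \<sigma> (s k)) \<longlonglongrightarrow> v u"
    by (rule tangent_realize[OF v(1) tendsto_const[of x] \<sigma>]) (rule that; assumption)
  have "(\<lambda>k. \<Sum>p\<in>P. \<bar>(f p (z k) - f p x) / \<sigma> (s k)\<bar>) \<longlonglongrightarrow> (\<Sum>p\<in>P. \<bar>v (f p)\<bar>)"
    by (intro tendsto_intros vz P)
  then have lim: "(\<lambda>k. \<Sum>p\<in>P. \<bar>(f p (z k) - f p x) / \<sigma> (s k)\<bar>) \<longlonglongrightarrow> 0" using v(2) by simp
  have "\<forall>\<^sub>F k in sequentially. b * c \<le> (\<Sum>p\<in>P. \<bar>(f p (z k) - f p x) / \<sigma> (s k)\<bar>)"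
    using tendstoD[OF z b(2)]
  proof eventually_elim
    case (elim k)
    then obtain p where p: "p \<in> P" "b * dist x (z k) \<le> f p x - f p (z k)"
      using net[of x "z k"] b by (auto simp: dist_commute)
    have "b * c = b * dist x (z k) / \<sigma> (s k)" using \<sigma>(1)[of "s k"] dz[of k] by simp
    also have "\<dots> \<le> (f p x - f p (z k)) / \<sigma> (s k)" using p \<sigma>(1)[of "s k"] by (intro divide_right_mono) auto
    also have "\<dots> \<le> \<bar>(f p (z k) - f p x) / \<sigma> (s k)\<bar>"
      by (metis abs_ge_minus_self minus_diff_eq minus_divide_left)
    also have "\<dots> \<le> (\<Sum>p\<in>P. \<bar>(f p (z k) - f p x) / \<sigma> (s k)\<bar>)"
      using p P by (intro member_le_sum) auto
    finally show ?case .
  qed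
  then have "b * c \<le> 0" using tendsto_lowerbound[OF lim] by simp
  then show "c = 0" using b tvec_ge0[OF v(1)] by (simp add: mult_le_0_iff)
qed

text \<open>\<open>K\<close> is free because \<open>s\<close> must later outweigh a sum of up to
  \<open>card P\<close> squared distances.\<close>

lemma strongly_convex_function:
  fixes x :: 'a
  assumes e: "0 < e" "lam \<ge> 0" "\<And>p. p \<in> ball x e \<Longrightarrow> semi (ball x e) lam (sqd p)"
      "\<And>p. p \<in> ball x e \<Longrightarrow> regular_on (ball x e) (sqd p)"
      "\<And>p y z. p \<in> ball x e \<Longrightarrow> y \<in> ball x e \<Longrightarrow> z \<in> ball x e \<Longrightarrow> \<bar>sqd p y - sqd p z\<bar> \<le> 4 * dist y z"
    and P: "finite P" "0 < b" "b < e" "0 < r" "r \<le> e" "\<And>p. p \<in> P \<Longrightarrow> dist x p = b"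
      "\<And>p. p \<in> P \<Longrightarrow> dist x (opp p) = b \<and> dist p (opp p) = 2 * b"
      "\<And>y z. y \<in> ball x r \<Longrightarrow> z \<in> ball x r \<Longrightarrow> \<exists>p\<in>P. b * dist y z \<le> sqd p y - sqd p z"
    and K: "K \<ge> 0"
  obtains s r' where "0 < r'" "r' \<le> r" "regular_on (ball x r') s" "semi (ball x r') (- K) s"
    "\<And>c v. tvec x c v \<Longrightarrow> v s = 0"
proof -
  define N where "N = real (card P)"
  \<comment> \<open>Each of the \<open>2 * N\<close> squares loses \<open>3 * M * lam\<close>, while
    a single square gains \<open>(M * b)\<^sup>2\<close>: the gain is quadratic in \<open>M\<close>
    and the loss linear. This value leaves a surplus of at least \<open>K\<close>.\<close>
  define M where "M = 1 + (6 * N * lam + K) / b\<^sup>2"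
  have N0: "N \<ge> 0" unfolding N_def by simp
  have b2: "b\<^sup>2 > 0" using P by simp
  have frac0: "0 \<le> (6 * N * lam + K) / b\<^sup>2" using N0 e(2) K b2 by (intro divide_nonneg_pos) auto
  have M1: "M \<ge> 1" unfolding M_def using frac0 by simp
  have Mb: "M * b\<^sup>2 - 6 * N * lam \<ge> K"
  proof -
    have "(6 * N * lam + K) / b\<^sup>2 * b\<^sup>2 = 6 * N * lam + K" using b2 by simp
    then have "M * b\<^sup>2 = b\<^sup>2 + (6 * N * lam + K)" unfolding M_def by (simp add: distrib_right)
    then show ?thesis using b2 by simp
  qed
  have MK: "(M * b)\<^sup>2 - 6 * N * (M * lam) \<ge> K"
  proof -
    have "1 * K \<le> M * (M * b\<^sup>2 - 6 * N * lam)" using M1 Mb K by (intro mult_mono) auto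
    then show ?thesis by (simp add: power2_eq_square algebra_simps)
  qed
  define w where "w p y = 1 + M * (sqd p y - b\<^sup>2)" for p y
  define s where "s y = (\<Sum>p\<in>P. (w p y)\<^sup>2 + (w (opp p) y)\<^sup>2)" for y
  \<comment> \<open>Squared distances are 4-Lipschitz here, so within \<open>1 / (8 * M)\<close> of
    \<open>x\<close> each \<open>w p\<close> with \<open>p\<close> in \<open>Q\<close> stays within
    1/2 of its value 1 at \<open>x\<close>.\<close>
  define r' where "r' = min r (1 / (8 * M))"
  have r': "0 < r'" "r' \<le> r" "r' \<le> 1 / (8 * M)" using P(4) M1 unfolding r'_def by auto
  define Q where "Q = P \<union> opp ` P"
  have Q: "dist x p = b" "p \<in> ball x e" if "p \<in> Q" for p using that P unfolding Q_def by auto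
  have sub: "ball x r' \<subseteq> ball x e" using r' P(5) by auto
  have xb: "x \<in> ball x r'" using r' by simp
  have near1: "\<bar>w p y - 1\<bar> \<le> 1/2" if "p \<in> Q" "y \<in> ball x r'" for p y
  proof -
    have "\<bar>sqd p y - sqd p x\<bar> \<le> 4 * dist y x" using that sub Q(2) xb e(1) by (intro e(5)) auto
    also have "\<dots> \<le> 4 * (1 / (8 * M))" using that r' by (auto simp: dist_commute)
    finally have "M * \<bar>sqd p y - b\<^sup>2\<bar> \<le> M * (4 * (1 / (8 * M)))"
      using Q(1)[OF that(1)] M1 by (intro mult_left_mono) (auto simp: dist_commute)
    then show ?thesis unfolding w_def using M1 by (simp add: abs_mult)
  qed
  have w_eq: "w p = (\<lambda>y. M * sqd p y + (1 - M * b\<^sup>2))" for p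
    unfolding w_def by (simp add: algebra_simps)
  have wreg: "regular_on (ball x r') (w p)" if "p \<in> Q" for p
  proof -
    have "regular_on (ball x r') (sqd p)" using e(4)[OF Q(2)[OF that]] sub by (rule regular_on_subset)
    then show ?thesis unfolding w_eq using M1 by (intro regular_on_add regular_on_cmul) auto
  qed
  have const: "semi W 0 (\<lambda>y::'a. c)" for W c
    unfolding semi_def by (auto simp: shortest_path_def is_interval_convex_1 convex_on_const)
  have wsemi: "semi (ball x r') (M * lam) (w p)" if "p \<in> Q" for p
  proof -
    have "semi (ball x r') lam (sqd p)" using e(3)[OF Q(2)[OF that]] sub by (rule semi_subset)
    then have "semi (ball x r') (M * lam) (\<lambda>y. M * sqd p y)" using M1 by (intro semi_cmul) auto
    then have "semi (ball x r') (M * lam + 0) (w p)" unfolding w_eq by (rule semi_add[OF _ const])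
    then show ?thesis by simp
  qed
  have sqreg: "regular_on (ball x r') (\<lambda>y. (w p y)\<^sup>2)" if "p \<in> Q" for p
    using wreg[OF that] near1[OF that] by (rule regular_on_square)
  have PQ: "p \<in> Q" "opp p \<in> Q" if "p \<in> P" for p using that unfolding Q_def by auto
  have sreg: "regular_on (ball x r') s"
    unfolding s_def by (intro regular_on_sum regular_on_add sqreg PQ)
  have Mlam: "M * lam \<ge> 0" using M1 e(2) by simp
  have "semi (ball x r') (- K) s"
    unfolding semi_def
  proof (intro allI impI)
    fix I \<gamma> assume *: "shortest_path I \<gamma> \<and> \<gamma> ` I \<subseteq> ball x r'"
    then have sp: "shortest_path I \<gamma>" and im: "\<gamma> ` I \<subseteq> ball x r'" by auto
    show "convex_on I (\<lambda>t. s (\<gamma> t) + - K * t\<^sup>2)"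
    proof (rule convex_on_by_support)
      show "is_interval I" using sp by (simp add: shortest_path_def)
      fix t assume t: "t \<in> interior I"
      then have tI: "t \<in> I" using interior_subset by blast
      have "\<forall>p\<in>Q. \<exists>m. \<forall>h\<in>I. (w p (\<gamma> h))\<^sup>2 \<ge> (w p (\<gamma> t))\<^sup>2 + m * (h - t) - 3 * (M * lam) * (h - t)\<^sup>2 + (w p (\<gamma> h) - w p (\<gamma> t))\<^sup>2"
        using regular_on_square_support[OF wreg wsemi Mlam near1 sp im t] by blast
      then obtain m where m: "\<And>p h. p \<in> Q \<Longrightarrow> h \<in> I \<Longrightarrow>
          (w p (\<gamma> h))\<^sup>2 \<ge> (w p (\<gamma> t))\<^sup>2 + m p * (h - t) - 3 * (M * lam) * (h - t)\<^sup>2 + (w p (\<gamma> h) - w p (\<gamma> t))\<^sup>2"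
        by metis
      define m' where "m' = (\<Sum>p\<in>P. m p + m (opp p))"
      have "s (\<gamma> h) + - K * h\<^sup>2 \<ge> s (\<gamma> t) + - K * t\<^sup>2 + (m' - 2 * K * t) * (h - t)" if h: "h \<in> I" for h
      proof -
        have "\<gamma> t \<in> ball x r" "\<gamma> h \<in> ball x r" using im h tI r' by auto
        \<comment> \<open>One net point separating \<open>\<gamma> t\<close> from
          \<open>\<gamma> h\<close> supplies the whole gain.\<close>
        then obtain q where q: "q \<in> P" "b * dist (\<gamma> t) (\<gamma> h) \<le> sqd q (\<gamma> t) - sqd q (\<gamma> h)"
          using P(8) by blast
        have dth: "dist (\<gamma> t) (\<gamma> h) = \<bar>t - h\<bar>" using shortest_path_dist[OF sp tI h] .
        have "M * (b * \<bar>t - h\<bar>) \<le> M * (sqd q (\<gamma> t) - sqd q (\<gamma> h))"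
          using q(2) M1 unfolding dth by (intro mult_left_mono) auto
        also have "\<dots> = w q (\<gamma> t) - w q (\<gamma> h)" unfolding w_def by (simp add: algebra_simps)
        finally have "(M * (b * \<bar>t - h\<bar>))\<^sup>2 \<le> (w q (\<gamma> t) - w q (\<gamma> h))\<^sup>2"
          using M1 P(2) by (intro power_mono) auto
        then have "(M * b)\<^sup>2 * (h - t)\<^sup>2 \<le> (w q (\<gamma> h) - w q (\<gamma> t))\<^sup>2"
          by (simp add: power_mult_distrib power2_commute mult_ac)
        also have "\<dots> \<le> (\<Sum>p\<in>P. (w p (\<gamma> h) - w p (\<gamma> t))\<^sup>2)"
          using q(1) P(1) member_le_sum[of q P "\<lambda>p. (w p (\<gamma> h) - w p (\<gamma> t))\<^sup>2"] by simp
        finally have sq: "(M * b)\<^sup>2 * (h - t)\<^sup>2 \<le> (\<Sum>p\<in>P. (w p (\<gamma> h) - w p (\<gamma> t))\<^sup>2)" .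
        have "(\<Sum>p\<in>P. ((w p (\<gamma> t))\<^sup>2 + (w (opp p) (\<gamma> t))\<^sup>2) + (m p + m (opp p)) * (h - t)
            - 6 * (M * lam) * (h - t)\<^sup>2 + (w p (\<gamma> h) - w p (\<gamma> t))\<^sup>2) \<le> s (\<gamma> h)"
          unfolding s_def
        proof (rule sum_mono)
          fix p assume "p \<in> P"
          then show "((w p (\<gamma> t))\<^sup>2 + (w (opp p) (\<gamma> t))\<^sup>2) + (m p + m (opp p)) * (h - t)
            - 6 * (M * lam) * (h - t)\<^sup>2 + (w p (\<gamma> h) - w p (\<gamma> t))\<^sup>2 \<le> (w p (\<gamma> h))\<^sup>2 + (w (opp p) (\<gamma> h))\<^sup>2"
            using m[OF PQ(1) h, of p] m[OF PQ(2) h, of p] zero_le_power2[of "w (opp p) (\<gamma> h) - w (opp p) (\<gamma> t)"]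
            unfolding distrib_right by linarith
        qed
        also have "(\<Sum>p\<in>P. ((w p (\<gamma> t))\<^sup>2 + (w (opp p) (\<gamma> t))\<^sup>2) + (m p + m (opp p)) * (h - t)
            - 6 * (M * lam) * (h - t)\<^sup>2 + (w p (\<gamma> h) - w p (\<gamma> t))\<^sup>2) =
            s (\<gamma> t) + m' * (h - t) - N * (6 * (M * lam) * (h - t)\<^sup>2) + (\<Sum>p\<in>P. (w p (\<gamma> h) - w p (\<gamma> t))\<^sup>2)"
          unfolding s_def m'_def N_def by (simp add: sum.distrib sum_subtractf sum_distrib_right distrib_right)
        finally have "s (\<gamma> t) + m' * (h - t) + ((M * b)\<^sup>2 - 6 * N * (M * lam)) * (h - t)\<^sup>2 \<le> s (\<gamma> h)"
          using sq by (simp add: algebra_simps)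
        moreover have "K * (h - t)\<^sup>2 \<le> ((M * b)\<^sup>2 - 6 * N * (M * lam)) * (h - t)\<^sup>2"
          using MK by (intro mult_right_mono) auto
        ultimately have "s (\<gamma> t) + m' * (h - t) + K * (h - t)\<^sup>2 \<le> s (\<gamma> h)" by linarith
        moreover have "K * (h - t)\<^sup>2 - K * h\<^sup>2 = - K * t\<^sup>2 - 2 * K * t * (h - t)"
          by (simp add: power2_eq_square algebra_simps)
        ultimately show ?thesis by (simp add: algebra_simps)
      qed
      then show "\<exists>m. \<forall>h\<in>I. s (\<gamma> h) + - K * h\<^sup>2 \<ge> s (\<gamma> t) + - K * t\<^sup>2 + m * (h - t)" by blast
    qed
  qed
  moreover have "v s = 0" if v: "tvec x c v" for c v
  proof -
    have at: "regular_at x f" if "regular_on (ball x r') f" for f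
      using that regular_on_at[of "ball x r'"] xb by auto
    have sqat: "regular_at x (\<lambda>y. (w p y)\<^sup>2)" if "p \<in> Q" for p using at[OF sqreg[OF that]] .
    have dat: "regular_at x (sqd p)" if "p \<in> Q" for p
      using regular_on_at[OF e(4)[OF Q(2)[OF that]]] e(1) by simp
    have vw: "v (\<lambda>y. (w p y)\<^sup>2) = 2 * M * v (sqd p)" if "p \<in> Q" for p
      using tvec_affine_square[OF v dat[OF that], of "b\<^sup>2" M] sqat[OF that] Q(1)[OF that]
      unfolding w_def by (simp add: dist_commute)
    have "v s = (\<Sum>p\<in>P. v (\<lambda>y. (w p y)\<^sup>2 + (w (opp p) y)\<^sup>2))"
      unfolding s_def by (rule tvec_sum[OF v]) (intro regular_at_add sqat PQ)
    also have "\<dots> = (\<Sum>p\<in>P. 0)"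
    proof (rule sum.cong[OF refl])
      fix p assume p: "p \<in> P"
      have "v (sqd (opp p)) = - v (sqd p)"
        using P(6)[OF p] P(7)[OF p] PQ[OF p] by (intro opposite_tvec[OF v, of p "opp p" b] dat) (auto simp: dist_commute)
      then show "v (\<lambda>y. (w p y)\<^sup>2 + (w (opp p) y)\<^sup>2) = 0"
        using tvec_additive[OF v sqat[OF PQ(1)[OF p]] sqat[OF PQ(2)[OF p]]] vw PQ[OF p] by simp
    qed
    finally show ?thesis by simp
  qed
  ultimately show ?thesis using that r'(1,2) sreg by blast
qed

text \<open>The radius does not depend on the base point \<open>y\<close>: a sequence of failing
  base points and times would contradict \<open>tangent_realize\<close>, which follows moving base
  points. The error \<open>t / 2\<close> is half of the change that a unit step in one coordinate
  produces.\<close>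

lemma coordinate_move:
  fixes x :: 'a and n :: nat
  assumes v: "tvec x c v" and reg: "\<And>i. i < n \<Longrightarrow> regular_at x (\<lambda>y. \<psi> y i)"
  obtains \<delta> where "\<delta> > 0" "\<And>y t. y \<in> ball x \<delta> \<Longrightarrow> 0 < t \<Longrightarrow> t < \<delta> \<Longrightarrow>
    \<exists>z. dist y z = c * t \<and> (\<Sum>i<n. \<bar>\<psi> z i - \<psi> y i - t * v (\<lambda>y. \<psi> y i)\<bar>) \<le> t / 2"
proof -
  let ?G = "\<lambda>y t z. dist y z = c * t \<and> (\<Sum>i<n. \<bar>\<psi> z i - \<psi> y i - t * v (\<lambda>y. \<psi> y i)\<bar>) \<le> t / 2"
  have "\<exists>\<delta>>0. \<forall>y\<in>ball x \<delta>. \<forall>t. 0 < t \<and> t < \<delta> \<longrightarrow> (\<exists>z. ?G y t z)"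
  proof (rule ccontr)
    assume contr: "\<not> ?thesis"
    have "\<forall>k. \<exists>y t. y \<in> ball x (1 / real (Suc k)) \<and> 0 < t \<and> t < 1 / real (Suc k) \<and> (\<forall>z. \<not> ?G y t z)"
    proof
      fix k :: nat
      have "0 < 1 / real (Suc k)" by simp
      then show "\<exists>y t. y \<in> ball x (1 / real (Suc k)) \<and> 0 < t \<and> t < 1 / real (Suc k) \<and> (\<forall>z. \<not> ?G y t z)"
        using contr by blast
    qed
    then have "\<exists>y t. \<forall>k. y k \<in> ball x (1 / real (Suc k)) \<and> 0 < t k \<and> t k < 1 / real (Suc k) \<and> (\<forall>z. \<not> ?G (y k) (t k) z)"
      by (simp only: choice_iff)
    then obtain y t where yt0: "\<forall>k. y k \<in> ball x (1 / real (Suc k)) \<and> 0 < t k \<and> t k < 1 / real (Suc k) \<and> (\<forall>z. \<not> ?G (y k) (t k) z)"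
      by (elim exE)
    have yt: "\<And>k. y k \<in> ball x (1 / real (Suc k))" "\<And>k. 0 < t k" "\<And>k. t k < 1 / real (Suc k)"
      "\<And>k z. \<not> ?G (y k) (t k) z" using yt0 by (simp_all only: simp_thms)
    have y: "y \<longlonglongrightarrow> x" using yt(1) tendsto_ball_inverse by auto
    have t0: "t \<longlonglongrightarrow> 0"
      by (rule tendsto_sandwich[OF _ _ tendsto_const tendsto_inverse_Suc])
        (use yt(2,3) in \<open>auto intro: less_imp_le eventuallyI\<close>)
    obtain s z where s: "strict_mono (s :: nat \<Rightarrow> nat)"
      and dz: "\<And>k. dist (y (s k)) (z k) = c * t (s k)"
      and vz: "\<And>u. regular_at x u \<Longrightarrow> (\<lambda>k. (u (z k) - u (y (s k))) / t (s k)) \<longlonglongrightarrow> v u"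
      by (rule tangent_realize[OF v y yt(2) t0]) (rule that; assumption)
    have "(\<lambda>k. \<Sum>i<n. \<bar>(\<psi> (z k) i - \<psi> (y (s k)) i) / t (s k) - v (\<lambda>y. \<psi> y i)\<bar>) \<longlonglongrightarrow>
        (\<Sum>i<n. \<bar>v (\<lambda>y. \<psi> y i) - v (\<lambda>y. \<psi> y i)\<bar>)"
      by (intro tendsto_sum tendsto_rabs tendsto_diff tendsto_const vz reg) auto
    then have "(\<lambda>k. \<Sum>i<n. \<bar>(\<psi> (z k) i - \<psi> (y (s k)) i) / t (s k) - v (\<lambda>y. \<psi> y i)\<bar>) \<longlonglongrightarrow> 0" by simp
    then have "\<forall>\<^sub>F k in sequentially. (\<Sum>i<n. \<bar>(\<psi> (z k) i - \<psi> (y (s k)) i) / t (s k) - v (\<lambda>y. \<psi> y i)\<bar>) < 1/2"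
      by (rule order_tendstoD(2)) simp
    then obtain k where k: "(\<Sum>i<n. \<bar>(\<psi> (z k) i - \<psi> (y (s k)) i) / t (s k) - v (\<lambda>y. \<psi> y i)\<bar>) < 1/2"
      using eventually_happens' sequentially_bot by blast
    have tp: "t (s k) > 0" using yt(2) .
    have "(\<Sum>i<n. \<bar>\<psi> (z k) i - \<psi> (y (s k)) i - t (s k) * v (\<lambda>y. \<psi> y i)\<bar>) =
        t (s k) * (\<Sum>i<n. \<bar>(\<psi> (z k) i - \<psi> (y (s k)) i) / t (s k) - v (\<lambda>y. \<psi> y i)\<bar>)"
      unfolding sum_distrib_left
    proof (rule sum.cong[OF refl])
      fix i
      have "t (s k) * ((\<psi> (z k) i - \<psi> (y (s k)) i) / t (s k) - v (\<lambda>y. \<psi> y i)) = \<psi> (z k) i - \<psi> (y (s k)) i - t (s k) * v (\<lambda>y. \<psi> y i)"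
        using tp by (simp add: field_simps)
      then show "\<bar>\<psi> (z k) i - \<psi> (y (s k)) i - t (s k) * v (\<lambda>y. \<psi> y i)\<bar> = t (s k) * \<bar>(\<psi> (z k) i - \<psi> (y (s k)) i) / t (s k) - v (\<lambda>y. \<psi> y i)\<bar>"
        using tp by (metis abs_mult abs_of_pos)
    qed
    also have "\<dots> \<le> t (s k) * (1/2)" using k tp by (intro mult_left_mono) auto
    finally show False using yt(4)[of "s k" "z k"] dz[of k] by simp
  qed
  then show ?thesis using that by blast
qed

text \<open>A minimizer cannot miss the target: a step along plus or minus a dual vector improves a
  wrong coordinate by \<open>t\<close>, while the total error over all coordinates is at most
  \<open>t / 2\<close>.\<close>

lemma coordinates_onto:
  fixes x :: 'a and n :: nat
  assumes reg: "\<And>i. i < n \<Longrightarrow> regular_on (ball x r) (\<lambda>y. \<psi> y i)" and r: "0 < r" and \<kappa>: "\<kappa> > 0"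
    and lower: "\<And>y z. y \<in> ball x r \<Longrightarrow> z \<in> ball x r \<Longrightarrow> \<kappa> * dist y z \<le> (\<Sum>i<n. \<bar>\<psi> y i - \<psi> z i\<bar>)"
    and dual: "\<And>j. j < n \<Longrightarrow> tvec x (c j) (v j)"
      "\<And>i j. i < n \<Longrightarrow> j < n \<Longrightarrow> v j (\<lambda>y. \<psi> y i) = (if i = j then 1 else 0)"
  obtains \<rho> \<eta> where "0 < \<rho>" "\<rho> < r" "0 < \<eta>"
    "\<And>w. (\<Sum>i<n. \<bar>w i - \<psi> x i\<bar>) < \<eta> \<Longrightarrow> \<exists>y\<in>ball x \<rho>. \<forall>i<n. \<psi> y i = w i"
proof -
  have rega: "regular_at x (\<lambda>y. \<psi> y i)" if "i < n" for i
    using regular_on_at[OF reg[OF that]] r by auto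
  have "\<exists>\<delta>>0. \<forall>y\<in>ball x \<delta>. \<forall>t. 0 < t \<and> t < \<delta> \<longrightarrow>
      (\<exists>z. dist y z = c j * t \<and> (\<Sum>i<n. \<bar>\<psi> z i - \<psi> y i - t * (a * (if i = j then 1 else 0))\<bar>) \<le> t / 2)"
    if j: "j < n" and a: "a \<in> {1, -1}" for j and a :: real
  proof -
    have "tvec x (\<bar>a\<bar> * c j) (\<lambda>u. a * v j u)" by (rule tvec_scale[OF dual(1)[OF j]])
    then have tv: "tvec x (c j) (\<lambda>u. a * v j u)" using a by auto
    obtain \<delta> where \<delta>: "\<delta> > 0" "\<And>y t. y \<in> ball x \<delta> \<Longrightarrow> 0 < t \<Longrightarrow> t < \<delta> \<Longrightarrow>
      \<exists>z. dist y z = c j * t \<and> (\<Sum>i<n. \<bar>\<psi> z i - \<psi> y i - t * (a * v j (\<lambda>y. \<psi> y i))\<bar>) \<le> t / 2"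
      by (rule coordinate_move[where n = n and \<psi> = \<psi>, OF tv rega]) (assumption, (rule that; assumption))
    have "(\<Sum>i<n. \<bar>\<psi> z i - \<psi> y i - t * (a * v j (\<lambda>y. \<psi> y i))\<bar>) =
        (\<Sum>i<n. \<bar>\<psi> z i - \<psi> y i - t * (a * (if i = j then 1 else 0))\<bar>)" for y z t
      using dual(2)[OF _ j] by (intro sum.cong) auto
    then show ?thesis using \<delta> by (intro exI[of _ \<delta>]) auto
  qed
  note move = this
  \<comment> \<open>The guards make the statement total in \<open>j\<close> and \<open>a\<close>, so
    that radii can be chosen for all of them together.\<close>
  let ?M = "\<lambda>j (a::real) \<delta>. j < n \<longrightarrow> a \<in> {1, -1} \<longrightarrow> (\<forall>y\<in>ball x \<delta>. \<forall>t. 0 < t \<and> t < \<delta> \<longrightarrow>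
      (\<exists>z. dist y z = c j * t \<and> (\<Sum>i<n. \<bar>\<psi> z i - \<psi> y i - t * (a * (if i = j then 1 else 0))\<bar>) \<le> t / 2))"
  have "\<forall>j a. \<exists>\<delta>. \<delta> > 0 \<and> ?M j a \<delta>"
  proof (intro allI)
    fix j and a :: real
    show "\<exists>\<delta>. \<delta> > 0 \<and> ?M j a \<delta>"
    proof (cases "j < n \<and> a \<in> {1, -1}")
      case True
      then show ?thesis using move[OF conjunct1[OF True] conjunct2[OF True]]
        by (elim exE conjE) (intro exI conjI impI; assumption)
    next
      case False
      then show ?thesis by (intro exI[of _ 1]) auto
    qed
  qed
  then have "\<exists>\<delta>. \<forall>j a. \<delta> j a > 0 \<and> ?M j a (\<delta> j a)" by (simp only: choice_iff)
  then obtain \<delta> where \<delta>M: "\<forall>j a. \<delta> j a > 0 \<and> ?M j a (\<delta> j a)" by (elim exE)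
  then have \<delta>: "\<And>j a. \<delta> j a > 0" by (simp only: simp_thms)
  have mv: "\<exists>z. dist y z = c j * t \<and> (\<Sum>i<n. \<bar>\<psi> z i - \<psi> y i - t * (a * (if i = j then 1 else 0))\<bar>) \<le> t / 2"
    if "j < n" "a \<in> {1, -1}" "y \<in> ball x (\<delta> j a)" "0 < t" "t < \<delta> j a" for j and a :: real and y t
    using \<delta>M[THEN spec, THEN spec, of j a, THEN conjunct2, rule_format, OF that(1,2,3)] that(4,5) by blast
  define S where "S = insert r ((\<lambda>(j, a). \<delta> j a) ` ({..<n} \<times> {1, -1::real}))"
  define d where "d = Min S"
  have S: "finite S" "S \<noteq> {}" unfolding S_def by auto
  have "0 < d" unfolding d_def using S \<delta> r by (subst Min_gr_iff) (auto simp: S_def)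
  moreover have "d \<le> r" unfolding d_def using S by (intro Min_le) (auto simp: S_def)
  moreover have "d \<le> \<delta> j a" if "j < n" "a \<in> {1, -1}" for j a
    unfolding d_def using S that by (intro Min_le) (auto simp: S_def image_iff)
  ultimately have d: "0 < d" "d \<le> r" "\<And>j a. j < n \<Longrightarrow> a \<in> {1, -1} \<Longrightarrow> d \<le> \<delta> j a" by auto
  define C where "C = 1 + (\<Sum>j<n. c j)"
  have c0: "0 \<le> c j" if "j < n" for j using tvec_ge0[OF dual(1)[OF that]] .
  have C: "C \<ge> 1" unfolding C_def using c0 by (auto intro!: sum_nonneg)
  have cC: "c j \<le> C" if "j < n" for j
    using member_le_sum[of j "{..<n}" c] c0 that unfolding C_def by simp
  define \<rho> where "\<rho> = d / 2"
  \<comment> \<open>For a target within \<open>\<eta>\<close> of \<open>\<psi> x\<close>, the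
    minimizer is closer to \<open>x\<close> than \<open>2 * \<eta> / \<kappa> = \<rho> / 2\<close>.
    This leaves \<open>\<rho> / 2\<close> for the corrective step.\<close>
  define \<eta> where "\<eta> = \<kappa> * \<rho> / 4"
  have \<rho>: "0 < \<rho>" "\<rho> < d" and \<eta>: "0 < \<eta>" unfolding \<rho>_def \<eta>_def using d \<kappa> by auto
  have surj: "\<exists>y\<in>ball x \<rho>. \<forall>i<n. \<psi> y i = w i" if w: "(\<Sum>i<n. \<bar>w i - \<psi> x i\<bar>) < \<eta>" for w
  proof -
    define F where "F y = (\<Sum>i<n. \<bar>w i - \<psi> y i\<bar>)" for y
    have "continuous_on (cball x \<rho>) F"
      unfolding F_def
    proof (intro continuous_intros)
      fix i assume "i \<in> {..<n}"
      then have "isCont (\<lambda>y. \<psi> y i) y" if "y \<in> cball x \<rho>" for y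
        using regular_on_isCont[OF reg[of i]] that \<rho> d by auto
      then show "continuous_on (cball x \<rho>) (\<lambda>y. \<psi> y i)" using continuous_at_imp_continuous_on by blast
    qed
    moreover have "compact (cball x \<rho>)" "cball x \<rho> \<noteq> {}" using cball_compact \<rho> by auto
    ultimately obtain y where y: "y \<in> cball x \<rho>" and min: "\<And>z. z \<in> cball x \<rho> \<Longrightarrow> F y \<le> F z"
      using continuous_attains_inf[of "cball x \<rho>" F] by blast
    have Fx: "F y \<le> F x" "F x < \<eta>" using min[of x] \<rho> w unfolding F_def by auto
    have "\<kappa> * dist x y \<le> (\<Sum>i<n. \<bar>\<psi> x i - \<psi> y i\<bar>)" using y \<rho> d r by (intro lower) auto
    also have "\<dots> \<le> (\<Sum>i<n. \<bar>w i - \<psi> x i\<bar> + \<bar>w i - \<psi> y i\<bar>)" by (intro sum_mono) auto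
    also have "\<dots> < 2 * \<eta>" using Fx w unfolding F_def sum.distrib by simp
    finally have "\<kappa> * dist x y < \<kappa> * (\<rho> / 2)" unfolding \<eta>_def by simp
    then have xy: "dist x y < \<rho> / 2" using \<kappa> by simp
    have "F y = 0"
    proof (rule ccontr)
      assume "F y \<noteq> 0"
      have "\<exists>j<n. w j - \<psi> y j \<noteq> 0"
      proof (rule ccontr)
        assume "\<not> (\<exists>j<n. w j - \<psi> y j \<noteq> 0)"
        then have "F y = 0" unfolding F_def by (intro sum.neutral) auto
        then show False using \<open>F y \<noteq> 0\<close> by simp
      qed
      then obtain j where j: "j < n" "w j - \<psi> y j \<noteq> 0" by blast
      define a :: real where "a = (if w j - \<psi> y j > 0 then 1 else -1)"
      have a: "a \<in> {1, -1}" "a * \<bar>w j - \<psi> y j\<bar> = w j - \<psi> y j" unfolding a_def using j by auto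
      \<comment> \<open>The three bounds avoid overshooting the target coordinate, stay in the range
        of \<open>mv\<close>, and keep \<open>z\<close> in \<open>cball x \<rho>\<close>.\<close>
      define t where "t = min \<bar>w j - \<psi> y j\<bar> (min (d / 2) (\<rho> / (2 * C)))"
      have t: "0 < t" "t \<le> \<bar>w j - \<psi> y j\<bar>" "t < d" "t \<le> \<rho> / (2 * C)"
        unfolding t_def using j d \<rho> C by auto
      obtain z where z: "dist y z = c j * t"
        "(\<Sum>i<n. \<bar>\<psi> z i - \<psi> y i - t * (a * (if i = j then 1 else 0))\<bar>) \<le> t / 2"
        using mv[OF j(1) a(1), of y t] t d(3)[OF j(1) a(1)] xy \<rho> by auto
      have "c j * t \<le> C * (\<rho> / (2 * C))" using t C cC[OF j(1)] by (intro mult_mono) auto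
      then have "dist y z \<le> \<rho> / 2" using z C by simp
      then have "z \<in> cball x \<rho>" using xy dist_triangle[of x z y] by simp
      then have "F y \<le> F z" by (rule min)
      also have "F z \<le> (\<Sum>i<n. \<bar>w i - \<psi> y i - t * (a * (if i = j then 1 else 0))\<bar> +
          \<bar>\<psi> z i - \<psi> y i - t * (a * (if i = j then 1 else 0))\<bar>)"
        unfolding F_def by (intro sum_mono) linarith
      also have "\<dots> \<le> (\<Sum>i<n. \<bar>w i - \<psi> y i\<bar> - (if i = j then t else 0)) + t / 2"
        unfolding sum.distrib
      proof (intro add_mono z sum_mono)
        fix i
        show "\<bar>w i - \<psi> y i - t * (a * (if i = j then 1 else 0))\<bar> \<le> \<bar>w i - \<psi> y i\<bar> - (if i = j then t else 0)"
          using a t unfolding a_def by (auto split: if_splits)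
      qed
      also have "\<dots> = F y - t + t / 2" unfolding F_def using j by (simp add: sum_subtractf)
      finally show False using t by simp
    qed
    then have "\<forall>i<n. \<psi> y i = w i" unfolding F_def by (subst (asm) sum_nonneg_eq_0_iff) auto
    then show ?thesis using xy \<rho> by (intro bexI[of _ y]) auto
  qed
  show ?thesis by (rule that[of \<rho> \<eta>]) (use \<rho> d \<eta> surj in auto)
qed

lemma semi_sum:
  fixes lam :: real
  assumes "finite J" "\<And>i. i \<in> J \<Longrightarrow> semi W lam (f i)"
  shows "semi (W :: 'a set) (card J * lam) (\<lambda>y. \<Sum>i\<in>J. f i y)"
  using assms
proof (induction J rule: finite_induct)
  case empty
  then show ?case
    unfolding semi_def by (auto simp: shortest_path_def is_interval_convex_1 convex_on_const)
next
  case (insert i J)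
  then have "semi W (lam + card J * lam) (\<lambda>y. f i y + (\<Sum>i\<in>J. f i y))" by (intro semi_add) auto
  then show ?case using insert by (simp add: algebra_simps)
qed

text \<open>The two-point inequalities in \<open>good_chart\<close> are facts about differentials at
  \<open>x\<close>, spread to nearby pairs by \<open>near_pairs\<close>; the convexity conditions
  come from adding \<open>s\<close>.\<close>

theorem good_chart_exists:
  fixes x :: 'a
  shows "\<exists>n V \<psi>. good_chart n V \<psi> \<and> x \<in> V"
proof -
  obtain e lam where e: "0 < e" "lam \<ge> 0" "\<And>p. p \<in> ball x e \<Longrightarrow> semi (ball x e) lam (sqd p)"
      "\<And>p. p \<in> ball x e \<Longrightarrow> regular_on (ball x e) (sqd p)"
      "\<And>p y z. p \<in> ball x e \<Longrightarrow> y \<in> ball x e \<Longrightarrow> z \<in> ball x e \<Longrightarrow> \<bar>sqd p y - sqd p z\<bar> \<le> 4 * dist y z"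
    by (rule sqd_regular[of x]) (rule that; assumption)
  obtain P b r where P: "finite P" "0 < b" "b < e" "0 < r" "r \<le> e" "\<And>p. p \<in> P \<Longrightarrow> dist x p = b"
    and opp_ex: "\<And>p. p \<in> P \<Longrightarrow> \<exists>q. dist x q = b \<and> dist p q = 2 * b"
    and net: "\<And>y z. y \<in> ball x r \<Longrightarrow> z \<in> ball x r \<Longrightarrow> \<exists>p\<in>P. b * dist y z \<le> sqd p y - sqd p z"
    by (rule separating_net[OF e(1,2,3)]) (assumption, (rule that; assumption))
  obtain opp where opp: "\<And>p. p \<in> P \<Longrightarrow> dist x (opp p) = b \<and> dist p (opp p) = 2 * b"
    using opp_ex by metis
  have dat: "regular_at x (sqd p)" if "dist x p = b" for p
    by (rule regular_on_at[OF e(4)]) (use that P e in auto)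
  have injP: "c = 0" if "tvec x c v" "\<And>p. p \<in> P \<Longrightarrow> v (sqd p) = 0" for c v
    by (rule net_injective[OF P(1) dat[OF P(6)] P(2,4) net that]) assumption+
  have "\<exists>J. J \<subseteq> P \<and> (\<forall>c v. tvec x c v \<longrightarrow> (\<forall>p\<in>J. v (sqd p) = 0) \<longrightarrow> c = 0) \<and>
    (\<forall>j\<in>J. \<exists>c v. tvec x c v \<and> v (sqd j) = 1 \<and> (\<forall>i\<in>J - {j}. v (sqd i) = 0))"
  proof (rule dual_basis[OF P(1)])
    fix c v assume "tvec x c v" "\<And>p. p \<in> P \<Longrightarrow> v (sqd p) = 0"
    then show "c = 0" by (rule injP)
  qed
  then obtain J where J: "J \<subseteq> P"
    and injJ: "\<forall>c v. tvec x c v \<longrightarrow> (\<forall>p\<in>J. v (sqd p) = 0) \<longrightarrow> c = 0"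
    and dualJ: "\<forall>j\<in>J. \<exists>c v. tvec x c v \<and> v (sqd j) = 1 \<and> (\<forall>i\<in>J - {j}. v (sqd i) = 0)"
    by (elim exE conjE)
  \<comment> \<open>Enough to absorb \<open>lam\<close> in each coordinate and
    \<open>n * lam\<close> in \<open>\<psi>0\<close>, and at least 1, as needed for
    \<open>semi V (-1) s\<close>.\<close>
  define K where "K = 1 + real (card P) * lam"
  have K0: "K \<ge> 0" unfolding K_def using e(2) by simp
  obtain s r' where s: "0 < r'" "r' \<le> r" "regular_on (ball x r') s" "semi (ball x r') (- K) s"
    and vs: "\<And>c v. tvec x c v \<Longrightarrow> v s = 0"
    by (rule strongly_convex_function[OF e P opp net K0]) (assumption | (rule that; assumption))+
  have finJ: "finite J" using J P(1) finite_subset by blast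
  define n where "n = card J"
  obtain h where h: "bij_betw h {0..<n} J" unfolding n_def using ex_bij_betw_nat_finite[OF finJ] by blast
  have hJ: "h i \<in> J" "h i \<in> P" if "i < n" for i using that h J unfolding bij_betw_def by auto
  have nP: "n \<le> card P" unfolding n_def using J P(1) card_mono by blast
  define \<psi> where "\<psi> y i = (if i < n then sqd (h i) y + s y else 0)" for y i
  \<comment> \<open>Opposite points have opposite differentials and \<open>s\<close> has none at
    \<open>x\<close>, so the differential of \<open>\<psi>0\<close> there is minus the sum of the
    coordinate differentials.\<close>
  define \<psi>0 where "\<psi>0 y = (\<Sum>i<n. sqd (opp (h i)) y) + s y" for y
  have sub: "ball x r' \<subseteq> ball x e" using s P by auto
  have xr': "x \<in> ball x r'" using s by simp
  have sph: "p \<in> ball x e" if "dist x p = b" for p using that P by simp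
  have sqreg: "regular_on (ball x r') (sqd p)" "semi (ball x r') lam (sqd p)" if "dist x p = b" for p
    using regular_on_subset[OF e(4)[OF sph[OF that]] sub] semi_subset[OF e(3)[OF sph[OF that]] sub] by auto
  have \<psi>_eq: "(\<lambda>y. \<psi> y i) = (\<lambda>y. sqd (h i) y + s y)" if "i < n" for i
    unfolding \<psi>_def using that by simp
  have \<psi>reg: "regular_on (ball x r') (\<lambda>y. \<psi> y i)" "semi (ball x r') 0 (\<lambda>y. \<psi> y i)" if i: "i < n" for i
  proof -
    show "regular_on (ball x r') (\<lambda>y. \<psi> y i)"
      unfolding \<psi>_eq[OF i] by (intro regular_on_add sqreg s P hJ i)
    have "card P \<ge> 1" using nP i by simp
    then have "1 * lam \<le> card P * lam" using e(2) by (intro mult_right_mono) auto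
    then have "lam + - K \<le> 0" unfolding K_def by simp
    moreover have "semi (ball x r') (lam + - K) (\<lambda>y. \<psi> y i)"
      unfolding \<psi>_eq[OF i] by (intro semi_add sqreg s P hJ i)
    ultimately show "semi (ball x r') 0 (\<lambda>y. \<psi> y i)" by (rule semi_mono[rotated])
  qed
  have oppb: "dist x (opp (h i)) = b" if "i < n" for i using opp[OF hJ(2)[OF that]] by simp
  have \<psi>0reg: "regular_on (ball x r') \<psi>0"
    unfolding \<psi>0_def by (intro regular_on_add regular_on_sum sqreg oppb s) simp
  have \<psi>0semi: "semi (ball x r') 0 \<psi>0"
  proof (rule semi_mono)
    show "semi (ball x r') (card {..<n} * lam + - K) \<psi>0"
      unfolding \<psi>0_def by (intro semi_add semi_sum sqreg oppb s) simp_all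
    have "real n * lam \<le> card P * lam" using nP e(2) by (intro mult_right_mono) auto
    then show "card {..<n} * lam + - K \<le> 0" unfolding K_def by simp
  qed
  have at: "regular_at x f" if "regular_on (ball x r') f" for f
    using that regular_on_at[of "ball x r'"] xr' by auto
  have v\<psi>: "v (\<lambda>y. \<psi> y i) = v (sqd (h i))" if v: "tvec x c v" and i: "i < n" for c v i
    unfolding \<psi>_eq[OF i] using tvec_additive[OF v at[OF sqreg(1)[OF P(6)[OF hJ(2)[OF i]]]] at[OF s(3)]] vs[OF v] by simp
  have v\<psi>0: "v \<psi>0 = - (\<Sum>i<n. v (\<lambda>y. \<psi> y i))" if v: "tvec x c v" for c v
  proof -
    have "v \<psi>0 = v (\<lambda>y. \<Sum>i<n. sqd (opp (h i)) y) + v s"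
      unfolding \<psi>0_def
      by (rule tvec_additive[OF v _ at[OF s(3)]]) (intro at regular_on_sum sqreg oppb, simp)
    also have "v (\<lambda>y. \<Sum>i<n. sqd (opp (h i)) y) = (\<Sum>i<n. v (sqd (opp (h i))))"
      by (rule tvec_sum[OF v]) (intro at sqreg oppb, simp)
    also have "\<dots> = (\<Sum>i<n. - v (\<lambda>y. \<psi> y i))"
    proof (rule sum.cong[OF refl])
      fix i assume "i \<in> {..<n}"
      then have i: "i < n" by simp
      have "v (sqd (opp (h i))) = - v (sqd (h i))"
        using P(6)[OF hJ(2)[OF i]] opp[OF hJ(2)[OF i]]
        by (intro opposite_tvec[OF v, of "h i" "opp (h i)" b] dat) (auto simp: dist_commute)
      then show "v (sqd (opp (h i))) = - v (\<lambda>y. \<psi> y i)" using v\<psi>[OF v i] by simp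
    qed
    finally show ?thesis using vs[OF v] by (simp add: sum_negf)
  qed
  have \<psi>inj: "c = 0" if v: "tvec x c v" "\<And>i. i < n \<Longrightarrow> v (\<lambda>y. \<psi> y i) = 0" for c v
  proof (rule injJ[rule_format, OF v(1)])
    fix p assume "p \<in> J"
    then obtain i where "i < n" "p = h i" using h unfolding bij_betw_def by auto
    then show "v (sqd p) = 0" using v(2) v\<psi>[OF v(1)] by simp
  qed
  have "\<exists>c v. tvec x c v \<and> (\<forall>i<n. v (\<lambda>y. \<psi> y i) = (if i = j then 1 else 0))" if j: "j < n" for j
  proof -
    obtain c v where v: "tvec x c v" "v (sqd (h j)) = 1" "\<forall>i\<in>J - {h j}. v (sqd i) = 0"
      using dualJ[rule_format, OF hJ(1)[OF j]] by (elim exE conjE)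
    have "v (\<lambda>y. \<psi> y i) = (if i = j then 1 else 0)" if i: "i < n" for i
    proof (cases "i = j")
      case True
      then show ?thesis using v\<psi>[OF v(1) i] v(2) by simp
    next
      case False
      then have "h i \<noteq> h j" using h i j unfolding bij_betw_def inj_on_def by auto
      then show ?thesis using v\<psi>[OF v(1) i] v(3) hJ(1)[OF i] False by simp
    qed
    then show ?thesis using v(1) by blast
  qed
  then obtain c v where dual: "\<And>j. j < n \<Longrightarrow> tvec x (c j) (v j)"
    "\<And>i j. i < n \<Longrightarrow> j < n \<Longrightarrow> v j (\<lambda>y. \<psi> y i) = (if i = j then 1 else 0)" by metis
  \<comment> \<open>Lower bi-Lipschitz bound: if it failed at all scales, some unit tangent vector
    would vanish on all coordinates.\<close>
  have "\<exists>m r. 0 < r \<and> (\<forall>y\<in>ball x r. \<forall>z\<in>ball x r. dist y z \<le> real (Suc m) * (\<Sum>i<n. \<bar>\<psi> y i - \<psi> z i\<bar>))"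
  proof (rule near_pairs[where J = "{..<n}" and f = "\<lambda>i y. \<psi> y i"])
    show "regular_at x (\<lambda>y. \<psi> y i)" if "i \<in> {..<n}" for i using at[OF \<psi>reg(1)] that by simp
    fix y z v
    assume v: "tvec x 1 v" and ne: "\<And>k. y k \<noteq> z k"
      and lim: "\<And>i. i \<in> {..<n} \<Longrightarrow> (\<lambda>k. (\<psi> (z k) i - \<psi> (y k) i) / dist (y k) (z k)) \<longlonglongrightarrow> v (\<lambda>y. \<psi> y i)"
      and bad: "\<And>k. \<exists>m\<ge>k. \<not> dist (y k) (z k) \<le> real (Suc m) * (\<Sum>i<n. \<bar>\<psi> (y k) i - \<psi> (z k) i\<bar>)"
    have "(\<lambda>k. \<Sum>i<n. \<bar>(\<psi> (z k) i - \<psi> (y k) i) / dist (y k) (z k)\<bar>) \<longlonglongrightarrow> (\<Sum>i<n. \<bar>v (\<lambda>y. \<psi> y i)\<bar>)"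
      by (intro tendsto_sum tendsto_rabs lim)
    moreover have "(\<Sum>i<n. \<bar>(\<psi> (z k) i - \<psi> (y k) i) / dist (y k) (z k)\<bar>) \<le> 1 / real (Suc k)" for k
    proof -
      let ?S = "\<Sum>i<n. \<bar>\<psi> (y k) i - \<psi> (z k) i\<bar>"
      obtain m where m: "m \<ge> k" "dist (y k) (z k) > real (Suc m) * ?S" using bad[of k] by auto
      have "real (Suc k) * ?S \<le> real (Suc m) * ?S" using m(1) by (intro mult_right_mono sum_nonneg) auto
      then have "?S * real (Suc k) \<le> dist (y k) (z k)" using m(2) by (simp add: mult.commute)
      then have "?S / dist (y k) (z k) \<le> 1 / real (Suc k)" using ne[of k]
        by (simp add: field_simps)
      then show ?thesis by (simp add: sum_divide_distrib abs_minus_commute)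
    qed
    ultimately have "(\<Sum>i<n. \<bar>v (\<lambda>y. \<psi> y i)\<bar>) \<le> 0"
      using tendsto_inverse_Suc by (intro LIMSEQ_le) auto
    then have "v (\<lambda>y. \<psi> y i) = 0" if "i < n" for i
      using that sum_nonneg_eq_0_iff[of "{..<n}" "\<lambda>i. \<bar>v (\<lambda>y. \<psi> y i)\<bar>"]
      by (simp add: order_antisym sum_nonneg)
    then show False using \<psi>inj[OF v] by simp
  qed (auto intro!: mult_nonneg_nonneg sum_nonneg)
  then obtain m r1 where r1: "0 < r1"
    and bil: "\<And>y z. y \<in> ball x r1 \<Longrightarrow> z \<in> ball x r1 \<Longrightarrow> dist y z \<le> real (Suc m) * (\<Sum>i<n. \<bar>\<psi> y i - \<psi> z i\<bar>)"
    by blast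
  define \<kappa> where "\<kappa> = 1 / real (Suc m)"
  have \<kappa>: "\<kappa> > 0" unfolding \<kappa>_def by simp
  have lower: "\<kappa> * dist y z \<le> (\<Sum>i<n. \<bar>\<psi> y i - \<psi> z i\<bar>)" if "y \<in> ball x r1" "z \<in> ball x r1" for y z
    using bil[OF that] unfolding \<kappa>_def by (simp add: field_simps)
  let ?E = "\<lambda>y z. \<bar>\<psi>0 y - \<psi>0 z + (\<Sum>i<n. \<psi> y i - \<psi> z i)\<bar> \<le> (\<Sum>i<n. \<bar>\<psi> y i - \<psi> z i\<bar>) / 2"
  have "\<exists>(m::nat) r. 0 < r \<and> (\<forall>y\<in>ball x r. \<forall>z\<in>ball x r. ?E y z)"
  \<comment> \<open>The index \<open>n\<close> stands for \<open>\<psi>0\<close>, so that one limit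
    vector serves it together with the coordinates.\<close>
  proof (rule near_pairs[where J = "{..n}" and Q = "\<lambda>_ y z. ?E y z" and f = "\<lambda>i. if i < n then (\<lambda>y. \<psi> y i) else \<psi>0"])
    show "regular_at x (if i < n then (\<lambda>y. \<psi> y i) else \<psi>0)" for i using at[OF \<psi>reg(1)] at[OF \<psi>0reg] by simp
    fix y z v
    assume v: "tvec x 1 v" and ne: "\<And>k::nat. y k \<noteq> z k" and yz: "y \<longlonglongrightarrow> x" "z \<longlonglongrightarrow> x"
      and lim: "\<And>i. i \<in> {..n} \<Longrightarrow> (\<lambda>k. ((if i < n then (\<lambda>y. \<psi> y i) else \<psi>0) (z k) - (if i < n then (\<lambda>y. \<psi> y i) else \<psi>0) (y k)) / dist (y k) (z k))
          \<longlonglongrightarrow> v (if i < n then (\<lambda>y. \<psi> y i) else \<psi>0)"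
      and bad: "\<And>k. \<exists>m\<ge>k. \<not> ?E (y k) (z k)"
    have lim1: "(\<lambda>k. (\<psi> (z k) i - \<psi> (y k) i) / dist (y k) (z k)) \<longlonglongrightarrow> v (\<lambda>y. \<psi> y i)" if "i < n" for i
      using lim[of i] that by simp
    have lim0: "(\<lambda>k. (\<psi>0 (z k) - \<psi>0 (y k)) / dist (y k) (z k)) \<longlonglongrightarrow> v \<psi>0"
      using lim[of n] by simp
    \<comment> \<open>The left side of \<open>?E\<close>, rescaled by the distance. It tends to 0
      because the differentials cancel, whereas failing pairs keep it above
      \<open>\<kappa> / 2\<close>.\<close>
    define a where "a k = \<bar>(\<psi>0 (z k) - \<psi>0 (y k)) / dist (y k) (z k) + (\<Sum>i<n. (\<psi> (z k) i - \<psi> (y k) i) / dist (y k) (z k))\<bar>" for k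
    have "a \<longlonglongrightarrow> \<bar>v \<psi>0 + (\<Sum>i<n. v (\<lambda>y. \<psi> y i))\<bar>"
      unfolding a_def by (intro tendsto_rabs tendsto_add tendsto_sum lim0 lim1) simp
    then have a0: "a \<longlonglongrightarrow> 0" using v\<psi>0[OF v] by simp
    have "\<forall>\<^sub>F k in sequentially. \<kappa> / 2 \<le> a k"
      using tendstoD[OF yz(1) r1] tendstoD[OF yz(2) r1]
    proof eventually_elim
      case (elim k)
      have d: "dist (y k) (z k) > 0" using ne by simp
      have 1: "\<kappa> * dist (y k) (z k) \<le> (\<Sum>i<n. \<bar>\<psi> (y k) i - \<psi> (z k) i\<bar>)"
        using elim by (intro lower) (auto simp: dist_commute)
      have 2: "(\<Sum>i<n. \<bar>\<psi> (y k) i - \<psi> (z k) i\<bar>) / 2 <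
          \<bar>\<psi>0 (y k) - \<psi>0 (z k) + (\<Sum>i<n. \<psi> (y k) i - \<psi> (z k) i)\<bar>" using bad[of k] by auto
      have "\<psi>0 (y k) - \<psi>0 (z k) + (\<Sum>i<n. \<psi> (y k) i - \<psi> (z k) i) =
          - (\<psi>0 (z k) - \<psi>0 (y k) + (\<Sum>i<n. \<psi> (z k) i - \<psi> (y k) i))" by (simp add: sum_subtractf)
      then have 3: "\<bar>\<psi>0 (y k) - \<psi>0 (z k) + (\<Sum>i<n. \<psi> (y k) i - \<psi> (z k) i)\<bar> =
          \<bar>\<psi>0 (z k) - \<psi>0 (y k) + (\<Sum>i<n. \<psi> (z k) i - \<psi> (y k) i)\<bar>" by (simp only: abs_minus_cancel)
      have "a k = \<bar>(\<psi>0 (z k) - \<psi>0 (y k) + (\<Sum>i<n. \<psi> (z k) i - \<psi> (y k) i)) / dist (y k) (z k)\<bar>"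
        unfolding a_def by (simp add: add_divide_distrib sum_divide_distrib)
      then have "a k * dist (y k) (z k) = \<bar>\<psi>0 (z k) - \<psi>0 (y k) + (\<Sum>i<n. \<psi> (z k) i - \<psi> (y k) i)\<bar>"
        using d by (simp add: abs_divide)
      then have "\<kappa> / 2 * dist (y k) (z k) < a k * dist (y k) (z k)" using 1 2 3 by linarith
      then show ?case using d by simp
    qed
    from tendsto_lowerbound[OF a0 this] have "\<kappa> / 2 \<le> 0" by simp
    then show False using \<kappa> by simp
  qed simp
  then obtain r2 where r2: "0 < r2" and E: "\<And>y z. y \<in> ball x r2 \<Longrightarrow> z \<in> ball x r2 \<Longrightarrow> ?E y z" by blast
  define R where "R = min r' (min r1 r2)"
  have R: "0 < R" "R \<le> r'" "R \<le> r1" "R \<le> r2" unfolding R_def using s(1) r1 r2 by auto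
  have RegR: "regular_on (ball x R) (\<lambda>y. \<psi> y i)" if "i < n" for i
    using \<psi>reg(1)[OF that] by (rule regular_on_subset) (use R in auto)
  have lowR: "\<kappa> * dist y z \<le> (\<Sum>i<n. \<bar>\<psi> y i - \<psi> z i\<bar>)" if "y \<in> ball x R" "z \<in> ball x R" for y z
    using lower that R by auto
  obtain \<rho> \<eta> where \<rho>: "0 < \<rho>" "\<rho> < R" and \<eta>: "0 < \<eta>"
    and onto: "\<And>w. (\<Sum>i<n. \<bar>w i - \<psi> x i\<bar>) < \<eta> \<Longrightarrow> \<exists>y\<in>ball x \<rho>. \<forall>i<n. \<psi> y i = w i"
    by (rule coordinates_onto[where \<psi> = \<psi> and n = n and v = v and c = c, OF RegR R(1) \<kappa> lowR dual])
      (assumption | (rule that; assumption))+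
  \<comment> \<open>Cutting by the coordinates makes the image exactly an open l1 ball of the
    Euclidean space, since \<open>onto\<close> finds every point of that ball inside
    \<open>ball x \<rho>\<close>.\<close>
  define V where "V = {y\<in>ball x \<rho>. (\<Sum>i<n. \<bar>\<psi> y i - \<psi> x i\<bar>) < \<eta>}"
  have VR: "V \<subseteq> ball x R" "V \<subseteq> ball x r'" "V \<subseteq> ball x r2" unfolding V_def using \<rho> R by auto
  have cont: "continuous_on (ball x \<rho>) (\<lambda>y. \<psi> y i)" if "i < n" for i
    using regular_on_isCont[OF RegR[OF that]] \<rho> by (intro continuous_at_imp_continuous_on) auto
  have "open V"
  proof -
    have "continuous_on (ball x \<rho>) (\<lambda>y. \<Sum>i<n. \<bar>\<psi> y i - \<psi> x i\<bar>)"
      by (intro continuous_intros cont) auto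
    then have "open ((\<lambda>y. \<Sum>i<n. \<bar>\<psi> y i - \<psi> x i\<bar>) -` {..<\<eta>} \<inter> ball x \<rho>)"
      by (rule continuous_on_open_vimage[OF open_ball, THEN iffD1, rule_format]) (rule open_lessThan)
    moreover have "(\<lambda>y. \<Sum>i<n. \<bar>\<psi> y i - \<psi> x i\<bar>) -` {..<\<eta>} \<inter> ball x \<rho> = V" unfolding V_def by auto
    ultimately show ?thesis by simp
  qed
  moreover have "openin (Euclidean_space n) (\<psi> ` V)"
  proof -
    have "\<psi> ` V = {w. \<forall>i\<ge>n. w i = 0} \<inter> {w. (\<Sum>i<n. \<bar>w i - \<psi> x i\<bar>) < \<eta>}"
    proof (intro equalityI subsetI)
      fix w assume w: "w \<in> {w. \<forall>i\<ge>n. w i = 0} \<inter> {w. (\<Sum>i<n. \<bar>w i - \<psi> x i\<bar>) < \<eta>}"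
      then obtain y where y: "y \<in> ball x \<rho>" "\<forall>i<n. \<psi> y i = w i" using onto[of w] by blast
      then have "\<psi> y = w" using w unfolding \<psi>_def by (intro ext) auto
      moreover have "y \<in> V" unfolding V_def using y w by simp
      ultimately show "w \<in> \<psi> ` V" by blast
    qed (auto simp: V_def \<psi>_def)
    moreover have "open {w::nat \<Rightarrow> real. (\<Sum>i<n. \<bar>w i - \<psi> x i\<bar>) < \<eta>}"
      by (intro open_Collect_less continuous_intros continuous_on_product_coordinates)
    ultimately show ?thesis unfolding Euclidean_space_eq openin_open by blast
  qed
  moreover have "regular_on V (\<lambda>y. \<psi> y i) \<and> semi V 0 (\<lambda>y. \<psi> y i)" if "i < n" for i
    using regular_on_subset[OF \<psi>reg(1)[OF that] VR(2)] semi_subset[OF \<psi>reg(2)[OF that] VR(2)] by simp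
  moreover have "regular_on V \<psi>0" "semi V 0 \<psi>0"
    using regular_on_subset[OF \<psi>0reg VR(2)] semi_subset[OF \<psi>0semi VR(2)] by auto
  moreover have "regular_on V s" "semi V (-1) s"
    using regular_on_subset[OF s(3) VR(2)] semi_mono[OF semi_subset[OF s(4) VR(2)], of "-1"] e(2)
    unfolding K_def by auto
  moreover have "\<forall>y\<in>V. \<forall>z\<in>V. \<kappa> * dist y z \<le> (\<Sum>i<n. \<bar>\<psi> y i - \<psi> z i\<bar>)" using lowR VR by blast
  moreover have "\<forall>y\<in>V. \<forall>z\<in>V. ?E y z" using E VR(3) by blast
  moreover have "\<forall>y. \<forall>i\<ge>n. \<psi> y i = 0" unfolding \<psi>_def by simp
  ultimately have "good_chart n V \<psi>" unfolding good_chart_def using \<kappa> by blast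
  moreover have "x \<in> V" unfolding V_def using \<rho> \<eta> by simp
  ultimately show ?thesis by blast
qed

end

section \<open>Calculus in a chart\<close>

lemma tendsto_coordinatewise:
  fixes a :: "'b \<Rightarrow> nat \<Rightarrow> real"
  assumes "\<And>i. ((\<lambda>k. a k i) \<longlongrightarrow> l i) F" shows "(a \<longlongrightarrow> l) F"
proof -
  have "limitin (product_topology (\<lambda>i. euclidean) (UNIV::nat set)) a l F"
    unfolding limitin_componentwise using assms by auto
  then show ?thesis unfolding euclidean_product_topology by simp
qed

lemma tendsto_coordinate:
  fixes a :: "'b \<Rightarrow> nat \<Rightarrow> real"
  assumes "(a \<longlongrightarrow> l) F" shows "((\<lambda>k. a k i) \<longlongrightarrow> l i) F"
proof -
  have "isCont (\<lambda>x::nat \<Rightarrow> real. x i) l"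
  proof -
    have "continuous_on UNIV (\<lambda>x::nat \<Rightarrow> real. x i)" by (rule continuous_on_product_coordinates)
    then show ?thesis using continuous_on_eq_continuous_at[OF open_UNIV, of "\<lambda>x::nat \<Rightarrow> real. x i"] by blast
  qed
  then show ?thesis using assms by (rule isCont_tendsto_compose)
qed

section \<open>Topology of good charts\<close>

lemma good_chartD:
  assumes "good_chart n V \<psi>"
  shows "open V" "\<And>y i. i \<ge> n \<Longrightarrow> \<psi> y i = 0" "openin (Euclidean_space n) (\<psi> ` V)"
    "\<exists>\<kappa>>0. \<forall>y\<in>V. \<forall>z\<in>V. \<kappa> * dist y z \<le> (\<Sum>i<n. \<bar>\<psi> y i - \<psi> z i\<bar>)"
    "\<And>i. i < n \<Longrightarrow> regular_on V (\<lambda>y. \<psi> y i)"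
    "\<exists>\<psi>0. regular_on V \<psi>0 \<and> semi V 0 \<psi>0 \<and>
      (\<forall>y\<in>V. \<forall>z\<in>V. \<bar>\<psi>0 y - \<psi>0 z + (\<Sum>i<n. \<psi> y i - \<psi> z i)\<bar> \<le> (\<Sum>i<n. \<bar>\<psi> y i - \<psi> z i\<bar>) / 2)"
    "\<exists>s. regular_on V s \<and> semi V (-1) s"
    "\<And>i. i < n \<Longrightarrow> semi V 0 (\<lambda>y. \<psi> y i)"
  using assms unfolding good_chart_def by auto

lemma good_chart_regular_at:
  "good_chart n V \<psi> \<Longrightarrow> x \<in> V \<Longrightarrow> i < n \<Longrightarrow> regular_at x (\<lambda>y. \<psi> y i)"
  using regular_on_at good_chartD(1,5) by metis

lemma good_chart_inj:
  assumes "good_chart n V \<psi>" shows "inj_on \<psi> V"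
proof (rule inj_onI)
  fix y z assume *: "y \<in> V" "z \<in> V" "\<psi> y = \<psi> z"
  obtain \<kappa> where "\<kappa> > 0" "\<kappa> * dist y z \<le> (\<Sum>i<n. \<bar>\<psi> y i - \<psi> z i\<bar>)" using good_chartD(4)[OF assms] * by blast
  then show "y = z" using *(3) by (simp add: mult_le_0_iff)
qed

lemma good_chart_inv:
  assumes "good_chart n V \<psi>"
  shows "x \<in> V \<Longrightarrow> inv_into V \<psi> (\<psi> x) = x" "a \<in> \<psi> ` V \<Longrightarrow> inv_into V \<psi> a \<in> V" "a \<in> \<psi> ` V \<Longrightarrow> \<psi> (inv_into V \<psi> a) = a"
  using inv_into_f_f[OF good_chart_inj[OF assms]] inv_into_into f_inv_into_f by metis+

lemma good_chart_tendsto: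
  assumes g: "good_chart n V \<psi>" and x: "x \<in> V" and y: "\<forall>\<^sub>F k in F. y k \<in> V"
    and lim: "\<And>i. i < n \<Longrightarrow> ((\<lambda>k. \<psi> (y k) i) \<longlongrightarrow> \<psi> x i) F"
  shows "(y \<longlongrightarrow> x) F"
proof -
  obtain \<kappa> where \<kappa>: "\<kappa> > 0" "\<And>y z. y \<in> V \<Longrightarrow> z \<in> V \<Longrightarrow> \<kappa> * dist y z \<le> (\<Sum>i<n. \<bar>\<psi> y i - \<psi> z i\<bar>)"
    using good_chartD(4)[OF g] by blast
  have "((\<lambda>k. (\<Sum>i<n. \<bar>\<psi> (y k) i - \<psi> x i\<bar>) / \<kappa>) \<longlongrightarrow> (\<Sum>i<n. \<bar>\<psi> x i - \<psi> x i\<bar>) / \<kappa>) F"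
    using \<kappa>(1) by (intro tendsto_divide tendsto_sum tendsto_rabs tendsto_diff lim tendsto_const) auto
  then have l: "((\<lambda>k. (\<Sum>i<n. \<bar>\<psi> (y k) i - \<psi> x i\<bar>) / \<kappa>) \<longlongrightarrow> 0) F" by simp
  show ?thesis
  proof (rule metric_tendsto_imp_tendsto[OF l])
    show "\<forall>\<^sub>F k in F. dist (y k) x \<le> dist ((\<Sum>i<n. \<bar>\<psi> (y k) i - \<psi> x i\<bar>) / \<kappa>) 0"
      using y
    proof eventually_elim
      case (elim k)
      have "dist (y k) x \<le> (\<Sum>i<n. \<bar>\<psi> (y k) i - \<psi> x i\<bar>) / \<kappa>"
        using \<kappa>(2)[OF elim x] \<kappa>(1) by (simp add: field_simps)
      then show ?case using \<kappa>(1) by (simp add: dist_real_def)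
    qed
  qed
qed

lemma good_chart_continuous:
  assumes "good_chart n V \<psi>" shows "continuous_on V \<psi>"
proof (rule continuous_on_coordinatewise_then_product)
  fix i
  show "continuous_on V (\<lambda>y. \<psi> y i)"
  proof (cases "i < n")
    case True
    then show ?thesis using regular_on_isCont[OF good_chartD(5)[OF assms True] good_chartD(1)[OF assms]]
      by (intro continuous_at_imp_continuous_on) auto
  next
    case False
    then show ?thesis using good_chartD(2)[OF assms] by simp
  qed
qed

lemma good_chart_inv_continuous:
  assumes g: "good_chart n V \<psi>" shows "continuous_on (\<psi> ` V) (inv_into V \<psi>)"
proof (rule continuous_on_sequentiallyI)
  fix u a assume u: "\<forall>k. u k \<in> \<psi> ` V" "a \<in> \<psi> ` V" "u \<longlonglongrightarrow> a"
  show "(\<lambda>k. inv_into V \<psi> (u k)) \<longlonglongrightarrow> inv_into V \<psi> a"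
    using u tendsto_coordinate[OF u(3)] good_chart_inv[OF g]
    by (intro good_chart_tendsto[OF g]) auto
qed

lemma openin_image_good_chart:
  assumes g: "good_chart n V \<psi>" and "open O'"
  shows "openin (Euclidean_space n) (\<psi> ` (V \<inter> O'))"
proof -
  have "\<psi> ` (V \<inter> O') = \<psi> ` V \<inter> inv_into V \<psi> -` O'"
    using good_chart_inv[OF g] by (auto simp: image_iff)
  moreover have "openin (top_of_set (\<psi> ` V)) (\<psi> ` V \<inter> inv_into V \<psi> -` O')"
    using good_chart_inv_continuous[OF g] assms(2) by (rule continuous_openin_preimage_gen)
  note openin_trans[OF this good_chartD(3)[OF g, unfolded Euclidean_space_eq]]
  ultimately show ?thesis unfolding Euclidean_space_eq by simp
qed

lemma good_chart_is_chart:
  assumes g: "good_chart n V \<psi>" shows "is_chart n (V, \<psi>)"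
proof -
  have sub: "\<psi> ` V \<subseteq> {x. \<forall>i\<ge>n. x i = 0}" using good_chartD(2)[OF g] by auto
  have top: "subtopology (Euclidean_space n) (\<psi> ` V) = top_of_set (\<psi> ` V)"
    using sub unfolding Euclidean_space_eq subtopology_subtopology by (simp add: Int_absorb1)
  have "homeomorphic_maps (top_of_set V) (top_of_set (\<psi> ` V)) \<psi> (inv_into V \<psi>)"
    unfolding homeomorphic_maps_def
    using good_chart_continuous[OF g] good_chart_inv_continuous[OF g] good_chart_inv[OF g] by auto
  then have "homeomorphic_map (top_of_set V) (subtopology (Euclidean_space n) (\<psi> ` V)) \<psi>"
    unfolding top homeomorphic_map_maps by blast
  then show ?thesis unfolding is_chart_def using good_chartD(1,3)[OF g] by simp
qed

definition unit_vec :: "nat \<Rightarrow> nat \<Rightarrow> real" where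
  "unit_vec j = (\<lambda>i. if i = j then 1 else 0)"

lemma unit_vec_0: "j < n \<Longrightarrow> \<forall>i\<ge>n. unit_vec j i = 0"
  by (simp add: unit_vec_def)

section \<open>Strict differentiability, partial derivatives and dimension\<close>

context semiconvex_gspace
begin

lemma good_chart_tvec_inj:
  fixes x :: 'a
  assumes g: "good_chart n V \<psi>" and x: "x \<in> V" and v: "tvec x c v" "\<And>i. i < n \<Longrightarrow> v (\<lambda>y. \<psi> y i) = 0"
  shows "c = 0"
proof -
  obtain \<kappa> where \<kappa>: "\<kappa> > 0" "\<And>y z. y \<in> V \<Longrightarrow> z \<in> V \<Longrightarrow> \<kappa> * dist y z \<le> (\<Sum>i<n. \<bar>\<psi> y i - \<psi> z i\<bar>)"
    using good_chartD(4)[OF g] by blast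
  define \<sigma> where "\<sigma> k = 1 / real (Suc k)" for k
  have \<sigma>: "\<And>k. \<sigma> k > 0" "\<sigma> \<longlonglongrightarrow> 0" unfolding \<sigma>_def using tendsto_inverse_Suc by auto
  obtain s z where s: "strict_mono (s :: nat \<Rightarrow> nat)" and z: "z \<longlonglongrightarrow> x"
    and dz: "\<And>k. dist x (z k) = c * \<sigma> (s k)"
    and vz: "\<And>u. regular_at x u \<Longrightarrow> (\<lambda>k. (u (z k) - u x) / \<sigma> (s k)) \<longlonglongrightarrow> v u"
    by (rule tangent_realize[OF v(1) tendsto_const[of x] \<sigma>]) (rule that; assumption)
  have "(\<lambda>k. \<Sum>i<n. \<bar>(\<psi> (z k) i - \<psi> x i) / \<sigma> (s k)\<bar>) \<longlonglongrightarrow> (\<Sum>i<n. \<bar>v (\<lambda>y. \<psi> y i)\<bar>)"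
    using good_chart_regular_at[OF g x] by (intro tendsto_sum tendsto_rabs vz) auto
  then have lim: "(\<lambda>k. \<Sum>i<n. \<bar>(\<psi> (z k) i - \<psi> x i) / \<sigma> (s k)\<bar>) \<longlonglongrightarrow> 0" using v(2) by simp
  have "\<forall>\<^sub>F k in sequentially. z k \<in> V" using z good_chartD(1)[OF g] x topological_tendstoD by blast
  then have "\<forall>\<^sub>F k in sequentially. \<kappa> * c \<le> (\<Sum>i<n. \<bar>(\<psi> (z k) i - \<psi> x i) / \<sigma> (s k)\<bar>)"
  proof eventually_elim
    case (elim k)
    have "\<kappa> * c = \<kappa> * dist (z k) x / \<sigma> (s k)" using \<sigma>(1)[of "s k"] dz[of k] by (simp add: dist_commute)
    also have "\<dots> \<le> (\<Sum>i<n. \<bar>\<psi> (z k) i - \<psi> x i\<bar>) / \<sigma> (s k)"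
      using \<kappa>(2)[OF elim x] \<sigma>(1)[of "s k"] by (intro divide_right_mono) auto
    also have "\<dots> = (\<Sum>i<n. \<bar>(\<psi> (z k) i - \<psi> x i) / \<sigma> (s k)\<bar>)"
      using \<sigma>(1)[of "s k"] by (simp add: sum_divide_distrib abs_divide)
    finally show ?case .
  qed
  from tendsto_lowerbound[OF lim this] have "\<kappa> * c \<le> 0" by simp
  then show "c = 0" using \<kappa> tvec_ge0[OF v(1)] by (simp add: mult_le_0_iff)
qed

text \<open>The difference of the two is again a tangent vector, of length 0 by injectivity.\<close>

lemma good_chart_tvec_unique:
  fixes x :: 'a
  assumes g: "good_chart n V \<psi>" and x: "x \<in> V" and v: "tvec x c v" "tvec x d w"
    and eq: "\<And>i. i < n \<Longrightarrow> v (\<lambda>y. \<psi> y i) = w (\<lambda>y. \<psi> y i)"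
  shows "v = w" "c = d"
proof -
  obtain e where e: "tvec x e (\<lambda>u. v u + - w u)" using tvec_add[OF v(1) tvec_uminus[OF v(2)]] by blast
  have "e = 0" using good_chart_tvec_inj[OF g x e] eq by simp
  then show "v = w" using tvec_0 e by fastforce
  then show "c = d" using tvec_norm_unique v by blast
qed

text \<open>Convergent coordinate quotients bound the distances through \<open>\<kappa>\<close>, so
  \<open>tangent_limit\<close> applies to every subsequence. The limit vector is determined by its
  coordinates \<open>w\<close>, hence all subsequences have the same limit.\<close>

lemma chart_limit_pos:
  fixes x :: 'a
  assumes g: "good_chart n V \<psi>" and x: "x \<in> V" and y: "y \<longlonglongrightarrow> x" and z: "z \<longlonglongrightarrow> x"
    and \<tau>: "\<And>k. \<tau> k > 0" "\<tau> \<longlonglongrightarrow> 0"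
    and lim: "\<And>i. i < n \<Longrightarrow> (\<lambda>k. (\<psi> (z k) i - \<psi> (y k) i) / \<tau> k) \<longlonglongrightarrow> w i"
  shows "\<exists>c v. tvec x c v \<and> (\<forall>i<n. v (\<lambda>y. \<psi> y i) = w i) \<and>
    (\<lambda>k. dist (y k) (z k) / \<tau> k) \<longlonglongrightarrow> c \<and>
    (\<forall>u. regular_at x u \<longrightarrow> (\<lambda>k. (u (z k) - u (y k)) / \<tau> k) \<longlonglongrightarrow> v u)"
proof -
  obtain \<kappa> where \<kappa>: "\<kappa> > 0" "\<And>y z. y \<in> V \<Longrightarrow> z \<in> V \<Longrightarrow> \<kappa> * dist y z \<le> (\<Sum>i<n. \<bar>\<psi> y i - \<psi> z i\<bar>)"
    using good_chartD(4)[OF g] by blast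
  have inV: "\<forall>\<^sub>F k in sequentially. y k \<in> V" "\<forall>\<^sub>F k in sequentially. z k \<in> V"
    using y z good_chartD(1)[OF g] x topological_tendstoD by blast+
  have "Bseq (\<lambda>k. dist (y k) (z k) / \<tau> k)"
  proof (rule Bseq_eventually_mono)
    have "(\<lambda>k. (\<Sum>i<n. \<bar>(\<psi> (z k) i - \<psi> (y k) i) / \<tau> k\<bar>) / \<kappa>) \<longlonglongrightarrow> (\<Sum>i<n. \<bar>w i\<bar>) / \<kappa>"
      using \<kappa>(1) by (intro tendsto_divide tendsto_sum tendsto_rabs lim tendsto_const) auto
    then show "Bseq (\<lambda>k. (\<Sum>i<n. \<bar>(\<psi> (z k) i - \<psi> (y k) i) / \<tau> k\<bar>) / \<kappa>)"
      using convergent_imp_Bseq convergentI by blast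
    show "\<forall>\<^sub>F k in sequentially. norm (dist (y k) (z k) / \<tau> k) \<le> norm ((\<Sum>i<n. \<bar>(\<psi> (z k) i - \<psi> (y k) i) / \<tau> k\<bar>) / \<kappa>)"
      using inV
    proof eventually_elim
      case (elim k)
      have "\<kappa> * dist (y k) (z k) / \<tau> k \<le> (\<Sum>i<n. \<bar>\<psi> (y k) i - \<psi> (z k) i\<bar>) / \<tau> k"
        using \<kappa>(2)[OF elim] \<tau>(1)[of k] by (intro divide_right_mono) auto
      also have "\<dots> = (\<Sum>i<n. \<bar>(\<psi> (z k) i - \<psi> (y k) i) / \<tau> k\<bar>)"
        using \<tau>(1)[of k] by (simp add: sum_divide_distrib abs_divide abs_minus_commute)
      finally have "dist (y k) (z k) / \<tau> k \<le> (\<Sum>i<n. \<bar>(\<psi> (z k) i - \<psi> (y k) i) / \<tau> k\<bar>) / \<kappa>"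
        using \<kappa>(1) by (simp add: pos_le_divide_eq mult.commute)
      moreover have "0 \<le> dist (y k) (z k) / \<tau> k" using \<tau>(1)[of k] by simp
      ultimately show ?case unfolding real_norm_def by linarith
    qed
  qed
  then obtain B where B: "\<And>k. norm (dist (y k) (z k) / \<tau> k) \<le> B" unfolding Bseq_def by blast
  have Bd: "dist (y k) (z k) \<le> B * \<tau> k" for k
    using B[of k] \<tau>(1)[of k] by (simp add: pos_divide_le_eq)
  have sub: "\<exists>s c v. strict_mono (s :: nat \<Rightarrow> nat) \<and> tvec x c v \<and> (\<forall>i<n. v (\<lambda>y. \<psi> y i) = w i) \<and>
    (\<lambda>k. dist (y (r (s k))) (z (r (s k))) / \<tau> (r (s k))) \<longlonglongrightarrow> c \<and>
    (\<forall>u. regular_at x u \<longrightarrow> (\<lambda>k. (u (z (r (s k))) - u (y (r (s k)))) / \<tau> (r (s k))) \<longlonglongrightarrow> v u)"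
    if r: "strict_mono (r :: nat \<Rightarrow> nat)" for r
  proof -
    have yr: "(\<lambda>k. y (r k)) \<longlonglongrightarrow> x" and zr: "(\<lambda>k. z (r k)) \<longlonglongrightarrow> x" and \<tau>r: "(\<lambda>k. \<tau> (r k)) \<longlonglongrightarrow> 0"
      using LIMSEQ_subseq_LIMSEQ[OF y r] LIMSEQ_subseq_LIMSEQ[OF z r] LIMSEQ_subseq_LIMSEQ[OF \<tau>(2) r]
      unfolding o_def by auto
    obtain s c v where s: "strict_mono (s :: nat \<Rightarrow> nat)" and v: "tvec x c v"
      and c: "(\<lambda>k. dist (y (r (s k))) (z (r (s k))) / \<tau> (r (s k))) \<longlonglongrightarrow> c"
      and vu: "\<forall>u. regular_at x u \<longrightarrow> (\<lambda>k. (u (z (r (s k))) - u (y (r (s k)))) / \<tau> (r (s k))) \<longlonglongrightarrow> v u"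
      using tangent_limit[OF yr zr \<tau>(1) \<tau>r Bd] by (elim exE conjE)
    have "v (\<lambda>y. \<psi> y i) = w i" if i: "i < n" for i
    proof (rule LIMSEQ_unique)
      show "(\<lambda>k. (\<psi> (z (r (s k))) i - \<psi> (y (r (s k))) i) / \<tau> (r (s k))) \<longlonglongrightarrow> v (\<lambda>y. \<psi> y i)"
        using vu good_chart_regular_at[OF g x i] by blast
      have "strict_mono (\<lambda>k. r (s k))" using r s unfolding strict_mono_def by auto
      then show "(\<lambda>k. (\<psi> (z (r (s k))) i - \<psi> (y (r (s k))) i) / \<tau> (r (s k))) \<longlonglongrightarrow> w i"
        using LIMSEQ_subseq_LIMSEQ[OF lim[OF i]] unfolding o_def by blast
    qed
    then show ?thesis using s v c vu by blast
  qed
  obtain c v where v: "tvec x c v" "\<forall>i<n. v (\<lambda>y. \<psi> y i) = w i" using sub[OF strict_mono_id] by blast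
  have main: "\<exists>s. strict_mono (s :: nat \<Rightarrow> nat) \<and> (\<lambda>k. dist (y (r (s k))) (z (r (s k))) / \<tau> (r (s k))) \<longlonglongrightarrow> c \<and>
    (\<forall>u. regular_at x u \<longrightarrow> (\<lambda>k. (u (z (r (s k))) - u (y (r (s k)))) / \<tau> (r (s k))) \<longlonglongrightarrow> v u)"
    if r: "strict_mono (r :: nat \<Rightarrow> nat)" for r
  proof -
    obtain s d v' where s: "strict_mono (s :: nat \<Rightarrow> nat)" and v': "tvec x d v'" "\<forall>i<n. v' (\<lambda>y. \<psi> y i) = w i"
      and c: "(\<lambda>k. dist (y (r (s k))) (z (r (s k))) / \<tau> (r (s k))) \<longlonglongrightarrow> d"
      and vu: "\<forall>u. regular_at x u \<longrightarrow> (\<lambda>k. (u (z (r (s k))) - u (y (r (s k)))) / \<tau> (r (s k))) \<longlonglongrightarrow> v' u"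
      using sub[OF r] by (elim exE conjE)
    have "v' = v" "d = c" using good_chart_tvec_unique[OF g x v'(1) v(1)] v v' by auto
    then show ?thesis using s c vu by blast
  qed
  show ?thesis
  proof (intro exI conjI allI impI)
    show "tvec x c v" by (rule v)
    show "v (\<lambda>y. \<psi> y i) = w i" if "i < n" for i using v that by blast
    show "(\<lambda>k. dist (y k) (z k) / \<tau> k) \<longlonglongrightarrow> c"
      by (rule LIMSEQ_by_subseq) (use main in blast)
    show "(\<lambda>k. (u (z k) - u (y k)) / \<tau> k) \<longlonglongrightarrow> v u" if "regular_at x u" for u
      by (rule LIMSEQ_by_subseq) (use main that in blast)
  qed
qed

text \<open>Both endpoints of the difference quotients move, so this is strict differentiability in the chart. It is what
  makes the derivatives continuous.\<close>

lemma chart_limit: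
  fixes x :: 'a
  assumes g: "good_chart n V \<psi>" and x: "x \<in> V" and y: "y \<longlonglongrightarrow> x" and z: "z \<longlonglongrightarrow> x"
    and \<tau>: "\<And>k. \<tau> k \<noteq> 0" "\<tau> \<longlonglongrightarrow> 0" and v: "tvec x c v"
    and lim: "\<And>i. i < n \<Longrightarrow> (\<lambda>k. (\<psi> (z k) i - \<psi> (y k) i) / \<tau> k) \<longlonglongrightarrow> v (\<lambda>y. \<psi> y i)"
  shows "(\<lambda>k. dist (y k) (z k) / \<bar>\<tau> k\<bar>) \<longlonglongrightarrow> c"
    "\<And>u. regular_at x u \<Longrightarrow> (\<lambda>k. (u (z k) - u (y k)) / \<tau> k) \<longlonglongrightarrow> v u"
proof -
  \<comment> \<open>For negative \<open>\<tau> k\<close> the pair is swapped, which leaves the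
    quotients unchanged.\<close>
  define y' where "y' k = (if \<tau> k > 0 then y k else z k)" for k
  define z' where "z' k = (if \<tau> k > 0 then z k else y k)" for k
  have eq: "(u (z' k) - u (y' k)) / \<bar>\<tau> k\<bar> = (u (z k) - u (y k)) / \<tau> k" for u :: "'a \<Rightarrow> real" and k
    using \<tau>(1)[of k] unfolding y'_def z'_def by (simp add: field_simps)
  have d: "dist (y' k) (z' k) = dist (y k) (z k)" for k unfolding y'_def z'_def by (simp add: dist_commute)
  have lim': "(\<lambda>k. if \<tau> k > 0 then a k else b k) \<longlonglongrightarrow> x" if "a \<longlonglongrightarrow> x" "b \<longlonglongrightarrow> x" for a b :: "nat \<Rightarrow> 'a"
  proof (rule topological_tendstoI)
    fix S assume "open S" "x \<in> S"
    then have "\<forall>\<^sub>F k in sequentially. a k \<in> S" "\<forall>\<^sub>F k in sequentially. b k \<in> S"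
      using that topological_tendstoD by blast+
    then show "\<forall>\<^sub>F k in sequentially. (if \<tau> k > 0 then a k else b k) \<in> S" by eventually_elim auto
  qed
  have "y' \<longlonglongrightarrow> x" "z' \<longlonglongrightarrow> x" using lim'[OF y z] lim'[OF z y] unfolding y'_def z'_def by auto
  moreover have "(\<lambda>k. \<bar>\<tau> k\<bar>) \<longlonglongrightarrow> 0" using tendsto_rabs[OF \<tau>(2)] by simp
  moreover have "(\<lambda>k. (\<psi> (z' k) i - \<psi> (y' k) i) / \<bar>\<tau> k\<bar>) \<longlonglongrightarrow> v (\<lambda>y. \<psi> y i)" if "i < n" for i
    using lim[OF that] eq[of "\<lambda>y. \<psi> y i"] by simp
  ultimately obtain d' v' where v': "tvec x d' v'" "\<forall>i<n. v' (\<lambda>y. \<psi> y i) = v (\<lambda>y. \<psi> y i)"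
    and 1: "(\<lambda>k. dist (y' k) (z' k) / \<bar>\<tau> k\<bar>) \<longlonglongrightarrow> d'"
    and 2: "\<forall>u. regular_at x u \<longrightarrow> (\<lambda>k. (u (z' k) - u (y' k)) / \<bar>\<tau> k\<bar>) \<longlonglongrightarrow> v' u"
    using chart_limit_pos[OF g x, of y' z' "\<lambda>k. \<bar>\<tau> k\<bar>" "\<lambda>i. v (\<lambda>y. \<psi> y i)"] \<tau>(1) by auto
  have eqs: "v' = v" "d' = c" using good_chart_tvec_unique[OF g x v'(1) v] v'(2) by auto
  show "(\<lambda>k. dist (y k) (z k) / \<bar>\<tau> k\<bar>) \<longlonglongrightarrow> c" using 1 unfolding d eqs .
  show "(\<lambda>k. (u (z k) - u (y k)) / \<tau> k) \<longlonglongrightarrow> v u" if "regular_at x u" for u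
    using 2 that unfolding eq eqs by blast
qed

lemma chart_point:
  fixes x :: 'a and w :: "nat \<Rightarrow> real"
  assumes g: "good_chart n V \<psi>" and x: "x \<in> V" and \<tau>: "\<tau> \<longlonglongrightarrow> (0::real)" and w: "\<forall>i\<ge>n. w i = 0"
  shows "\<exists>z. z \<longlonglongrightarrow> x \<and> (\<forall>k. z k \<in> V) \<and>
    (\<forall>\<^sub>F k in sequentially. \<psi> (z k) = (\<lambda>i. \<psi> x i + \<tau> k * w i)) \<and>
    (\<forall>\<^sub>F k in sequentially. (\<lambda>i. \<psi> x i + \<tau> k * w i) \<in> \<psi> ` V) \<and>
    (\<forall>k. (\<lambda>i. \<psi> x i + \<tau> k * w i) \<in> \<psi> ` V \<longrightarrow> z k = inv_into V \<psi> (\<lambda>i. \<psi> x i + \<tau> k * w i))"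
proof -
  define b where "b k = (\<lambda>i. \<psi> x i + \<tau> k * w i)" for k
  have b: "b \<longlonglongrightarrow> \<psi> x"
  proof (rule tendsto_coordinatewise)
    fix i
    have "(\<lambda>k. \<psi> x i + \<tau> k * w i) \<longlonglongrightarrow> \<psi> x i + 0 * w i" by (intro tendsto_intros \<tau>)
    then show "(\<lambda>k. b k i) \<longlonglongrightarrow> \<psi> x i" unfolding b_def by simp
  qed
  obtain S where S: "open S" "\<psi> ` V = {x. \<forall>i\<ge>n. x i = 0} \<inter> S"
    using good_chartD(3)[OF g] unfolding Euclidean_space_eq openin_open by blast
  have "\<psi> x \<in> S" using S x by blast
  then have "\<forall>\<^sub>F k in sequentially. b k \<in> S" using b S topological_tendstoD by blast
  moreover have "b k \<in> {x. \<forall>i\<ge>n. x i = 0}" for k unfolding b_def using w good_chartD(2)[OF g] by simp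
  ultimately have ev: "\<forall>\<^sub>F k in sequentially. b k \<in> \<psi> ` V" unfolding S(2) by simp
  \<comment> \<open>Early terms may fall outside the image; the default \<open>x\<close> keeps the
    sequence in \<open>V\<close> without affecting its limit.\<close>
  define z where "z k = (if b k \<in> \<psi> ` V then inv_into V \<psi> (b k) else x)" for k
  have zV: "z k \<in> V" for k unfolding z_def using x good_chart_inv(2)[OF g] by auto
  have z\<psi>: "\<forall>\<^sub>F k in sequentially. \<psi> (z k) = b k"
    using ev by eventually_elim (auto simp: z_def good_chart_inv[OF g])
  have "z \<longlonglongrightarrow> x"
  proof (rule good_chart_tendsto[OF g x])
    show "(\<lambda>k. \<psi> (z k) i) \<longlonglongrightarrow> \<psi> x i" for i
      by (rule Lim_transform_eventually[OF tendsto_coordinate[OF b, of i]])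
        (use z\<psi> in eventually_elim, simp)
  qed (use zV in auto)
  moreover have "b k \<in> \<psi> ` V \<Longrightarrow> z k = inv_into V \<psi> (b k)" for k unfolding z_def by simp
  ultimately show ?thesis using zV z\<psi> ev unfolding b_def by blast
qed

text \<open>Follow a straight line in the chart, which stays in the open image for small times. So
  the tangent space is the full coordinate space.\<close>

lemma chart_vector:
  fixes x :: 'a and w :: "nat \<Rightarrow> real"
  assumes g: "good_chart n V \<psi>" and x: "x \<in> V"
  shows "\<exists>c v. tvec x c v \<and> (\<forall>i<n. v (\<lambda>y. \<psi> y i) = w i)"
proof -
  define w' where "w' i = (if i < n then w i else 0)" for i
  define \<tau> where "\<tau> k = 1 / real (Suc k)" for k
  have \<tau>: "\<And>k. \<tau> k > 0" "\<tau> \<longlonglongrightarrow> 0" unfolding \<tau>_def using tendsto_inverse_Suc by auto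
  obtain z where z: "z \<longlonglongrightarrow> x" "\<forall>\<^sub>F k in sequentially. \<psi> (z k) = (\<lambda>i. \<psi> x i + \<tau> k * w' i)"
    using chart_point[OF g x \<tau>(2), of w'] by (auto simp: w'_def)
  have "(\<lambda>k. (\<psi> (z k) i - \<psi> x i) / \<tau> k) \<longlonglongrightarrow> w' i" for i
  proof (rule tendsto_eventually)
    show "\<forall>\<^sub>F k in sequentially. (\<psi> (z k) i - \<psi> x i) / \<tau> k = w' i"
      using z(2)
    proof eventually_elim
      case (elim k)
      then show ?case using \<tau>(1)[of k] by simp
    qed
  qed
  then have "\<exists>c v. tvec x c v \<and> (\<forall>i<n. v (\<lambda>y. \<psi> y i) = w' i)"
    using chart_limit_pos[OF g x tendsto_const z(1) \<tau>, of w'] by blast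
  then show ?thesis unfolding w'_def by auto
qed

lemma chart_partial_derivative:
  fixes x :: 'a
  assumes g: "good_chart n V \<psi>" and x: "x \<in> V" and u: "regular_at x u" and i: "i < n"
    and v: "tvec x c v" "\<And>j. j < n \<Longrightarrow> v (\<lambda>y. \<psi> y j) = unit_vec i j"
  shows "((\<lambda>t. u (inv_into V \<psi> ((\<psi> x)(i := t)))) has_real_derivative v u) (at (\<psi> x i))"
  unfolding DERIV_def tendsto_at_iff_sequentially
proof (intro allI impI)
  fix X assume X: "\<forall>k. X k \<in> UNIV - {0::real}" "X \<longlonglongrightarrow> 0"
  let ?b = "\<lambda>k i'. \<psi> x i' + X k * unit_vec i i'"
  obtain z where z: "z \<longlonglongrightarrow> x" "\<forall>k. z k \<in> V" "\<forall>\<^sub>F k in sequentially. \<psi> (z k) = ?b k"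
    "\<forall>\<^sub>F k in sequentially. ?b k \<in> \<psi> ` V" "\<forall>k. ?b k \<in> \<psi> ` V \<longrightarrow> z k = inv_into V \<psi> (?b k)"
    using chart_point[where w = "unit_vec i", OF g x X(2) unit_vec_0[OF i]] by (elim exE conjE)
  have b: "?b k = (\<psi> x)(i := \<psi> x i + X k)" for k by (auto simp: unit_vec_def fun_eq_iff)
  have "(\<lambda>k. (u (z k) - u x) / X k) \<longlonglongrightarrow> v u"
  proof (rule chart_limit(2)[OF g x tendsto_const z(1) _ X(2) v(1) _ u])
    show "X k \<noteq> 0" for k using X by auto
    fix j assume j: "j < n"
    show "(\<lambda>k. (\<psi> (z k) j - \<psi> x j) / X k) \<longlonglongrightarrow> v (\<lambda>y. \<psi> y j)"
    proof (rule tendsto_eventually)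
      show "\<forall>\<^sub>F k in sequentially. (\<psi> (z k) j - \<psi> x j) / X k = v (\<lambda>y. \<psi> y j)"
        using z(3)
      proof eventually_elim
        case (elim k)
        have "X k \<noteq> 0" using X by auto
        then show ?case using elim v(2)[OF j] by simp
      qed
    qed
  qed
  then show "((\<lambda>h. (u (inv_into V \<psi> ((\<psi> x)(i := \<psi> x i + h))) - u (inv_into V \<psi> ((\<psi> x)(i := \<psi> x i)))) / h) \<circ> X) \<longlonglongrightarrow> v u"
  proof (rule Lim_transform_eventually)
    show "\<forall>\<^sub>F k in sequentially. (u (z k) - u x) / X k =
      ((\<lambda>h. (u (inv_into V \<psi> ((\<psi> x)(i := \<psi> x i + h))) - u (inv_into V \<psi> ((\<psi> x)(i := \<psi> x i)))) / h) \<circ> X) k"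
      using z(4)
    proof eventually_elim
      case (elim k)
      then show ?case using z(5)[rule_format, OF elim] b[of k] good_chart_inv(1)[OF g x] by simp
    qed
  qed
qed

lemma chart_partial_deriv:
  fixes x :: 'a
  assumes "good_chart n V \<psi>" "x \<in> V" "regular_at x u" "i < n"
    "tvec x c v" "\<And>j. j < n \<Longrightarrow> v (\<lambda>y. \<psi> y j) = unit_vec i j"
  shows "partial_deriv i (\<lambda>a. u (inv_into V \<psi> a)) (\<psi> x) = v u"
  unfolding partial_deriv_def by (rule DERIV_imp_deriv[OF chart_partial_derivative[OF assms]])

text \<open>Chain rule: by uniqueness \<open>v\<close> is the combination of the vectors dual to the
  coordinates whose coefficients are its own coordinates. Applied to the coordinates of a second
  chart, it becomes the Jacobian law.\<close>

lemma tvec_chart_formula: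
  fixes x :: 'a
  assumes g: "good_chart n V \<psi>" and x: "x \<in> V" and u: "regular_at x u" and v: "tvec x c v"
  shows "v u = (\<Sum>j<n. partial_deriv j (\<lambda>a. u (inv_into V \<psi> a)) (\<psi> x) * v (\<lambda>y. \<psi> y j))"
proof -
  have "\<forall>j. \<exists>c e. tvec x c e \<and> (\<forall>i<n. e (\<lambda>y. \<psi> y i) = unit_vec j i)"
    by (intro allI chart_vector[OF g x])
  then obtain c' e where e: "\<And>j. tvec x (c' j) (e j)" "\<And>i j. i < n \<Longrightarrow> e j (\<lambda>y. \<psi> y i) = unit_vec j i"
    by metis
  obtain d where d: "tvec x d (\<lambda>u. \<Sum>j<n. v (\<lambda>y. \<psi> y j) * e j u)"
    using tvec_lincomb[of "{..<n}" x c' e "\<lambda>j. v (\<lambda>y. \<psi> y j)"] e(1) by auto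
  have "(\<lambda>u. \<Sum>j<n. v (\<lambda>y. \<psi> y j) * e j u) = v"
  proof (rule good_chart_tvec_unique(1)[OF g x d v])
    fix i assume i: "i < n"
    have "(\<Sum>j<n. v (\<lambda>y. \<psi> y j) * e j (\<lambda>y. \<psi> y i)) = (\<Sum>j<n. if j = i then v (\<lambda>y. \<psi> y j) else 0)"
      using e(2)[OF i] unfolding unit_vec_def by (intro sum.cong) auto
    then show "(\<Sum>j<n. v (\<lambda>y. \<psi> y j) * e j (\<lambda>y. \<psi> y i)) = v (\<lambda>y. \<psi> y i)" using i by simp
  qed
  then have "v u = (\<Sum>j<n. v (\<lambda>y. \<psi> y j) * e j u)" by metis
  then show ?thesis using chart_partial_deriv[OF g x u _ e(1) e(2)] by (simp add: mult.commute)
qed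

text \<open>For the continuity of the derivative, each partial derivative at
  \<open>\<alpha> k\<close> is replaced by a difference quotient with error below
  \<open>1 / real (Suc k)\<close>; both ends of these quotients move, and strict differentiability
  at the limit point makes them converge.\<close>

lemma C1_function_chart:
  fixes u :: "'a \<Rightarrow> real"
  assumes g: "good_chart n V \<psi>" and O': "open O'" and u: "\<And>x. x \<in> V \<inter> O' \<Longrightarrow> regular_at x u"
  shows "C1_function n (\<psi> ` (V \<inter> O')) (\<lambda>a. u (inv_into V \<psi> a))"
  unfolding C1_function_def
proof (intro allI impI conjI ballI)
  fix i assume i: "i < n"
  let ?f = "\<lambda>a. u (inv_into V \<psi> a)"
  have ex: "\<exists>c v. tvec x c v \<and> (\<forall>j<n. v (\<lambda>y. \<psi> y j) = unit_vec i j)" if "x \<in> V" for x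
    by (rule chart_vector[OF g that])
  fix a assume "a \<in> \<psi> ` (V \<inter> O')"
  then obtain x where x: "x \<in> V" "x \<in> O'" "a = \<psi> x" by auto
  obtain c v where v: "tvec x c v" "\<forall>j<n. v (\<lambda>y. \<psi> y j) = unit_vec i j" using ex[OF x(1)] by blast
  show "(\<lambda>t. ?f (a(i := t))) differentiable at (a i)"
    using chart_partial_derivative[OF g x(1) u i v(1)] v(2) x real_differentiable_def by blast
next
  fix i assume i: "i < n"
  let ?f = "\<lambda>a. u (inv_into V \<psi> a)"
  have ex: "\<exists>c v. tvec x c v \<and> (\<forall>j<n. v (\<lambda>y. \<psi> y j) = unit_vec i j)" if "x \<in> V" for x
    by (rule chart_vector[OF g that])
  have "continuous_on (\<psi> ` (V \<inter> O')) (partial_deriv i ?f)"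
  proof (rule continuous_on_sequentiallyI)
    fix \<alpha> a assume \<alpha>: "\<forall>k. \<alpha> k \<in> \<psi> ` (V \<inter> O')" and a: "a \<in> \<psi> ` (V \<inter> O')" and lim: "\<alpha> \<longlonglongrightarrow> a"
    obtain x where x: "x \<in> V" "x \<in> O'" "a = \<psi> x" using a by auto
    define y where "y k = inv_into V \<psi> (\<alpha> k)" for k
    have yV: "y k \<in> V" "y k \<in> O'" "\<psi> (y k) = \<alpha> k" for k
      using \<alpha>[rule_format, of k] good_chart_inv[OF g] unfolding y_def by auto
    have y: "y \<longlonglongrightarrow> x"
      using yV x tendsto_coordinate[OF lim] by (intro good_chart_tendsto[OF g]) auto
    obtain c v where v: "tvec x c v" "\<forall>j<n. v (\<lambda>y. \<psi> y j) = unit_vec i j" using ex[OF x(1)] by blast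
    have "\<exists>h z. h \<noteq> 0 \<and> \<bar>h\<bar> < 1 / real (Suc k) \<and> z \<in> V \<and> dist z (y k) < 1 / real (Suc k) \<and>
        \<psi> z = (\<lambda>i'. \<psi> (y k) i' + h * unit_vec i i') \<and>
        \<bar>(u z - u (y k)) / h - partial_deriv i ?f (\<alpha> k)\<bar> < 1 / real (Suc k)" for k
    proof -
      obtain c' v' where v': "tvec (y k) c' v'" "\<forall>j<n. v' (\<lambda>y. \<psi> y j) = unit_vec i j"
        using ex[OF yV(1)] by blast
      have uk: "regular_at (y k) u" using u yV by auto
      have pd: "partial_deriv i ?f (\<alpha> k) = v' u"
        using chart_partial_deriv[OF g yV(1) uk i v'(1)] v'(2) yV(3) by simp
      let ?\<tau> = "\<lambda>m. 1 / real (Suc m)"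
      obtain z where z: "z \<longlonglongrightarrow> y k" "\<forall>m. z m \<in> V" "\<forall>\<^sub>F m in sequentially. \<psi> (z m) = (\<lambda>i'. \<psi> (y k) i' + ?\<tau> m * unit_vec i i')"
        using chart_point[where w = "unit_vec i", OF g yV(1)[of k] tendsto_inverse_Suc unit_vec_0[OF i]]
        by (elim exE conjE)
      have "(\<lambda>m. (u (z m) - u (y k)) / ?\<tau> m) \<longlonglongrightarrow> v' u"
      proof (rule chart_limit(2)[OF g yV(1) tendsto_const z(1) _ tendsto_inverse_Suc v'(1) _ uk])
        fix j assume j: "j < n"
        show "(\<lambda>m. (\<psi> (z m) j - \<psi> (y k) j) / ?\<tau> m) \<longlonglongrightarrow> v' (\<lambda>y. \<psi> y j)"
        proof (rule tendsto_eventually)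
          show "\<forall>\<^sub>F m in sequentially. (\<psi> (z m) j - \<psi> (y k) j) / ?\<tau> m = v' (\<lambda>y. \<psi> y j)"
            using z(3) by eventually_elim (use v'(2) j in \<open>simp del: of_nat_Suc\<close>)
        qed
      qed simp
      then have "\<forall>\<^sub>F m in sequentially. dist ((u (z m) - u (y k)) / ?\<tau> m) (v' u) < 1 / real (Suc k)"
        by (rule tendstoD) simp
      moreover have "\<forall>\<^sub>F m in sequentially. dist (z m) (y k) < 1 / real (Suc k)"
        using z(1) by (rule tendstoD) simp
      moreover have "\<forall>\<^sub>F m in sequentially. ?\<tau> m < 1 / real (Suc k)"
        using tendsto_inverse_Suc by (rule order_tendstoD(2)) simp
      ultimately have "\<forall>\<^sub>F m in sequentially. dist ((u (z m) - u (y k)) / ?\<tau> m) (v' u) < 1 / real (Suc k) \<and>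
          dist (z m) (y k) < 1 / real (Suc k) \<and> ?\<tau> m < 1 / real (Suc k) \<and> \<psi> (z m) = (\<lambda>i'. \<psi> (y k) i' + ?\<tau> m * unit_vec i i')"
        using z(3) by eventually_elim blast
      then obtain m where m: "dist ((u (z m) - u (y k)) / ?\<tau> m) (v' u) < 1 / real (Suc k)"
          "dist (z m) (y k) < 1 / real (Suc k)" "?\<tau> m < 1 / real (Suc k)" "\<psi> (z m) = (\<lambda>i'. \<psi> (y k) i' + ?\<tau> m * unit_vec i i')"
        using eventually_happens' sequentially_bot by blast
      show ?thesis
      proof (intro exI conjI)
        show "?\<tau> m \<noteq> 0" by simp
        show "\<bar>?\<tau> m\<bar> < 1 / real (Suc k)" using m(3) by simp
        show "\<bar>(u (z m) - u (y k)) / ?\<tau> m - partial_deriv i ?f (\<alpha> k)\<bar> < 1 / real (Suc k)"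
          using m(1) unfolding pd dist_real_def .
      qed (use m z(2) in auto)
    qed
    then have "\<forall>k. \<exists>h z. h \<noteq> 0 \<and> \<bar>h\<bar> < 1 / real (Suc k) \<and> z \<in> V \<and> dist z (y k) < 1 / real (Suc k) \<and>
        \<psi> z = (\<lambda>i'. \<psi> (y k) i' + h * unit_vec i i') \<and>
        \<bar>(u z - u (y k)) / h - partial_deriv i ?f (\<alpha> k)\<bar> < 1 / real (Suc k)" by blast
    then have "\<exists>h z. \<forall>k. h k \<noteq> 0 \<and> \<bar>h k\<bar> < 1 / real (Suc k) \<and> z k \<in> V \<and> dist (z k) (y k) < 1 / real (Suc k) \<and>
        \<psi> (z k) = (\<lambda>i'. \<psi> (y k) i' + h k * unit_vec i i') \<and>
        \<bar>(u (z k) - u (y k)) / h k - partial_deriv i ?f (\<alpha> k)\<bar> < 1 / real (Suc k)"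
      by (simp only: choice_iff)
    then obtain h z where hz: "\<forall>k. h k \<noteq> 0 \<and> \<bar>h k\<bar> < 1 / real (Suc k) \<and> z k \<in> V \<and> dist (z k) (y k) < 1 / real (Suc k) \<and>
        \<psi> (z k) = (\<lambda>i'. \<psi> (y k) i' + h k * unit_vec i i') \<and>
        \<bar>(u (z k) - u (y k)) / h k - partial_deriv i ?f (\<alpha> k)\<bar> < 1 / real (Suc k)" by (elim exE)
    have h: "\<And>k. h k \<noteq> 0" "\<And>k. \<bar>h k\<bar> < 1 / real (Suc k)" "\<And>k. dist (z k) (y k) < 1 / real (Suc k)"
      and z\<psi>: "\<And>k. \<psi> (z k) = (\<lambda>i'. \<psi> (y k) i' + h k * unit_vec i i')"
      and quot: "\<And>k. \<bar>(u (z k) - u (y k)) / h k - partial_deriv i ?f (\<alpha> k)\<bar> < 1 / real (Suc k)"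
      using hz by (simp_all only: simp_thms)
    have z: "z \<longlonglongrightarrow> x" using y h(3) by (rule tendsto_if_dist_less)
    have "(\<lambda>k. (u (z k) - u (y k)) / h k) \<longlonglongrightarrow> v u"
    proof (rule chart_limit(2)[OF g x(1) y z h(1) tendsto_0_if_abs_less[OF h(2)] v(1)])
      show "regular_at x u" using u x by blast
      fix j assume j: "j < n"
      have "(\<psi> (z k) j - \<psi> (y k) j) / h k = v (\<lambda>y. \<psi> y j)" for k
        using h(1)[of k] z\<psi>[of k] v(2) j by simp
      then show "(\<lambda>k. (\<psi> (z k) j - \<psi> (y k) j) / h k) \<longlonglongrightarrow> v (\<lambda>y. \<psi> y j)" by simp
    qed
    from tendsto_diff[OF this tendsto_0_if_abs_less[OF quot]]
    have "(\<lambda>k. partial_deriv i ?f (\<alpha> k)) \<longlonglongrightarrow> v u" by simp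
    moreover have "partial_deriv i ?f a = v u"
      using chart_partial_deriv[OF g x(1) u i v(1)] v(2) x by simp
    ultimately show "(\<lambda>k. partial_deriv i ?f (\<alpha> k)) \<longlonglongrightarrow> partial_deriv i ?f a" by simp
  qed
  moreover have "\<psi> ` (V \<inter> O') \<subseteq> {x. \<forall>i\<ge>n. x i = 0}" using good_chartD(2)[OF g] by auto
  ultimately show "continuous_map (subtopology (Euclidean_space n) (\<psi> ` (V \<inter> O'))) euclideanreal (partial_deriv i ?f)"
    unfolding Euclidean_space_eq subtopology_subtopology by (simp add: Int_absorb1)
qed

text \<open>The dual bases of the two charts give mutually inverse linear maps between the Euclidean
  spaces; being homeomorphisms, they fall under invariance of dimension.\<close>

lemma good_chart_dimension:
  fixes x :: 'a
  assumes g: "good_chart n V \<psi>" "x \<in> V" and g': "good_chart m V' \<psi>'" "x \<in> V'"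
  shows "n = m"
proof -
  have "\<forall>j. \<exists>c e. tvec x c e \<and> (\<forall>i<n. e (\<lambda>y. \<psi> y i) = unit_vec j i)" by (intro allI chart_vector[OF g])
  then obtain c e where e: "\<And>j. tvec x (c j) (e j)" "\<And>i j. i < n \<Longrightarrow> e j (\<lambda>y. \<psi> y i) = unit_vec j i" by metis
  have "\<forall>j. \<exists>c e. tvec x c e \<and> (\<forall>i<m. e (\<lambda>y. \<psi>' y i) = unit_vec j i)" by (intro allI chart_vector[OF g'])
  then obtain c' e' where e': "\<And>j. tvec x (c' j) (e' j)" "\<And>i j. i < m \<Longrightarrow> e' j (\<lambda>y. \<psi>' y i) = unit_vec j i" by metis
  define f where "f w i = (if i < m then \<Sum>j<n. w j * e j (\<lambda>y. \<psi>' y i) else 0)" for w i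
  define h where "h w i = (if i < n then \<Sum>j<m. w j * e' j (\<lambda>y. \<psi> y i) else 0)" for w i
  have pick: "(\<Sum>j<k. w j * unit_vec j i) = w i" if "i < k" for k i and w :: "nat \<Rightarrow> real"
    using that by (simp add: unit_vec_def if_distrib cong: if_cong)
  have ret: "(\<Sum>j<m. (\<Sum>l<n. w l * e l (\<lambda>y. \<psi>' y j)) * e' j (\<lambda>y. \<psi> y i)) = w i" if i: "i < n" for w i
  proof -
    obtain d where d: "tvec x d (\<lambda>u. \<Sum>l<n. w l * e l u)"
      using tvec_lincomb[of "{..<n}" x c e w] e(1) by auto
    obtain d' where d': "tvec x d' (\<lambda>u. \<Sum>j<m. (\<Sum>l<n. w l * e l (\<lambda>y. \<psi>' y j)) * e' j u)"
      using tvec_lincomb[of "{..<m}" x c' e' "\<lambda>j. \<Sum>l<n. w l * e l (\<lambda>y. \<psi>' y j)"] e'(1) by auto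
    have "(\<lambda>u. \<Sum>j<m. (\<Sum>l<n. w l * e l (\<lambda>y. \<psi>' y j)) * e' j u) = (\<lambda>u. \<Sum>l<n. w l * e l u)"
      by (rule good_chart_tvec_unique(1)[OF g' d' d]) (simp add: e'(2) pick)
    from fun_cong[OF this, of "\<lambda>y. \<psi> y i"] show ?thesis using i by (simp add: e(2) pick)
  qed
  have ret': "(\<Sum>j<n. (\<Sum>l<m. w l * e' l (\<lambda>y. \<psi> y j)) * e j (\<lambda>y. \<psi>' y i)) = w i" if i: "i < m" for w i
  proof -
    obtain d where d: "tvec x d (\<lambda>u. \<Sum>l<m. w l * e' l u)"
      using tvec_lincomb[of "{..<m}" x c' e' w] e'(1) by auto
    obtain d' where d': "tvec x d' (\<lambda>u. \<Sum>j<n. (\<Sum>l<m. w l * e' l (\<lambda>y. \<psi> y j)) * e j u)"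
      using tvec_lincomb[of "{..<n}" x c e "\<lambda>j. \<Sum>l<m. w l * e' l (\<lambda>y. \<psi> y j)"] e(1) by auto
    have "(\<lambda>u. \<Sum>j<n. (\<Sum>l<m. w l * e' l (\<lambda>y. \<psi> y j)) * e j u) = (\<lambda>u. \<Sum>l<m. w l * e' l u)"
      by (rule good_chart_tvec_unique(1)[OF g d' d]) (simp add: e(2) pick)
    from fun_cong[OF this, of "\<lambda>y. \<psi>' y i"] show ?thesis using i by (simp add: e'(2) pick)
  qed
  have cont: "continuous_on S (\<lambda>w. \<lambda>i. if i < k then \<Sum>j<l. w j * b j i else (0::real))"
    for S :: "(nat \<Rightarrow> real) set" and k l :: nat and b :: "nat \<Rightarrow> nat \<Rightarrow> real"
  proof (rule continuous_on_coordinatewise_then_product)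
    fix i
    show "continuous_on S (\<lambda>w. if i < k then \<Sum>j<l. w j * b j i else 0)"
      by (cases "i < k") (auto intro!: continuous_intros continuous_on_subset[OF continuous_on_product_coordinates])
  qed
  have "homeomorphic_maps (Euclidean_space n) (Euclidean_space m) f h"
    unfolding homeomorphic_maps_def Euclidean_space_eq
  proof (intro conjI ballI)
    show "continuous_map (top_of_set {x. \<forall>i\<ge>n. x i = 0}) (top_of_set {x. \<forall>i\<ge>m. x i = 0}) f"
      using cont unfolding f_def by auto
    show "continuous_map (top_of_set {x. \<forall>i\<ge>m. x i = 0}) (top_of_set {x. \<forall>i\<ge>n. x i = 0}) h"
      using cont unfolding h_def by auto
    fix w assume "w \<in> topspace (top_of_set {x. \<forall>i\<ge>n. x i = (0::real)})"
    then show "h (f w) = w"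
      by (intro ext) (use ret in \<open>auto simp: h_def f_def not_less\<close>)
  next
    fix w assume "w \<in> topspace (top_of_set {x. \<forall>i\<ge>m. x i = (0::real)})"
    then show "f (h w) = w"
      by (intro ext) (use ret' in \<open>auto simp: h_def f_def not_less\<close>)
  qed
  then show ?thesis using invariance_of_dimension_Euclidean_space homeomorphic_space_def by metis
qed

text \<open>The sets of points with a given chart dimension are open and pairwise disjoint, and the
  space is connected.\<close>

lemma good_chart_dimension_constant: "\<exists>n. \<forall>x::'a. \<exists>V \<psi>. good_chart n V \<psi> \<and> x \<in> V"
proof -
  define D where "D n = {x::'a. \<exists>V \<psi>. good_chart n V \<psi> \<and> x \<in> V}" for n
  have op: "open (D n)" for n
  proof -
    have "D n = \<Union>{V. \<exists>\<psi>. good_chart n V (\<psi> :: 'a \<Rightarrow> _)}" unfolding D_def by auto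
    then show ?thesis using good_chartD(1) by (auto intro!: open_Union)
  qed
  obtain n V \<psi> where "good_chart n V \<psi> \<and> (undefined::'a) \<in> V"
    using good_chart_exists[of undefined] by (elim exE)
  then have n: "D n \<noteq> {}" unfolding D_def by blast
  have "- D n = (\<Union>m\<in>-{n}. D m)"
  proof (intro equalityI subsetI)
    fix x assume "x \<in> - D n"
    moreover obtain m V \<psi> where "good_chart m V \<psi> \<and> x \<in> V" using good_chart_exists[of x] by (elim exE)
    then have "x \<in> D m" unfolding D_def by blast
    ultimately show "x \<in> (\<Union>m\<in>-{n}. D m)" by (cases "m = n") auto
  next
    fix x assume "x \<in> (\<Union>m\<in>-{n}. D m)"
    then obtain m V' \<psi>' where m: "m \<noteq> n" "good_chart m V' \<psi>'" "x \<in> V'" unfolding D_def by auto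
    show "x \<in> - D n"
    proof
      assume "x \<in> D n"
      then obtain V \<psi> where "good_chart n V \<psi>" "x \<in> V" unfolding D_def by auto
      then show False using good_chart_dimension[of n V \<psi> x m V' \<psi>'] m by simp
    qed
  qed
  then have "closed (D n)" unfolding closed_def using op by auto
  then have "D n = UNIV" using op[of n] n connected_space connected_clopen[of "UNIV::'a set"] by auto
  then have "\<forall>x::'a. x \<in> D n" by simp
  then show ?thesis unfolding D_def mem_Collect_eq by (rule exI)
qed

end

section \<open>DC structure and the atlas\<close>

lemma enorm_le_sum: "enorm n v \<le> (\<Sum>i<n. \<bar>v i\<bar>)"
  unfolding enorm_def by (rule L2_set_le_sum_abs)

lemma abs_le_enorm: "i < n \<Longrightarrow> \<bar>v i\<bar> \<le> enorm n v"
  unfolding enorm_def L2_set_def by (rule real_le_rsqrt) (auto intro!: member_le_sum[of i "{..<n}" "\<lambda>i. (v i)\<^sup>2"])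

lemma sum_le_enorm: "(\<Sum>i<n. \<bar>v i\<bar>) \<le> n * enorm n v"
  using sum_bounded_above[of "{..<n}" "\<lambda>i. \<bar>v i\<bar>" "enorm n v"] abs_le_enorm[of _ n v] by simp

lemma openin_Euclidean_ball:
  "openin (Euclidean_space n) {b. (\<forall>i\<ge>n. b i = 0) \<and> (\<Sum>i<n. \<bar>b i - a i\<bar>) < \<delta>}"
proof -
  have "open {w::nat \<Rightarrow> real. (\<Sum>i<n. \<bar>w i - a i\<bar>) < \<delta>}"
    by (intro open_Collect_less continuous_intros continuous_on_product_coordinates)
  moreover have "{b. (\<forall>i\<ge>n. b i = 0) \<and> (\<Sum>i<n. \<bar>b i - a i\<bar>) < \<delta>} =
      {x. \<forall>i\<ge>n. x i = 0} \<inter> {w. (\<Sum>i<n. \<bar>w i - a i\<bar>) < \<delta>}" by auto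
  ultimately show ?thesis unfolding Euclidean_space_eq openin_open by blast
qed

text \<open>Points of shrinking l1 balls outside \<open>S\<close> would converge to \<open>a\<close>
  coordinatewise, which is convergence in the product topology; from index \<open>n\<close> on all
  coordinates are 0.\<close>

lemma openin_Euclidean_contains_ball:
  assumes "openin (Euclidean_space n) S" "a \<in> S"
  shows "\<exists>\<delta>>0. {b. (\<forall>i\<ge>n. b i = 0) \<and> (\<Sum>i<n. \<bar>b i - a i\<bar>) < \<delta>} \<subseteq> S"
proof (rule ccontr)
  assume contr: "\<not> ?thesis"
  have "\<forall>k. \<exists>b. (\<forall>i\<ge>n. b i = 0) \<and> (\<Sum>i<n. \<bar>b i - a i\<bar>) < 1 / real (Suc k) \<and> b \<notin> S"
  proof
    fix k :: nat
    have "0 < 1 / real (Suc k)" by simp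
    then show "\<exists>b. (\<forall>i\<ge>n. b i = 0) \<and> (\<Sum>i<n. \<bar>b i - a i\<bar>) < 1 / real (Suc k) \<and> b \<notin> S" using contr by blast
  qed
  then obtain b where b: "\<forall>k. (\<forall>i\<ge>n. b k i = 0) \<and> (\<Sum>i<n. \<bar>b k i - a i\<bar>) < 1 / real (Suc k) \<and> b k \<notin> S"
    by (auto dest!: choice)
  obtain S' where S': "open S'" "S = {x. \<forall>i\<ge>n. x i = 0} \<inter> S'"
    using assms(1) unfolding Euclidean_space_eq openin_open by blast
  have "b \<longlonglongrightarrow> a"
  proof (rule tendsto_coordinatewise)
    fix i
    show "(\<lambda>k. b k i) \<longlonglongrightarrow> a i"
    proof (cases "i < n")
      case True
      show ?thesis
      proof (rule metric_tendsto_imp_tendsto)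
        show "(\<lambda>k. 1 / real (Suc k)) \<longlonglongrightarrow> 0" using LIMSEQ_Suc[OF lim_1_over_n] by simp
        have "dist (b k i) (a i) \<le> dist (1 / real (Suc k)) 0" for k
        proof -
          have "\<bar>b k i - a i\<bar> \<le> (\<Sum>i<n. \<bar>b k i - a i\<bar>)" using True by (intro member_le_sum) auto
          also have "\<dots> < 1 / real (Suc k)" using b by blast
          finally show ?thesis by (simp add: dist_real_def)
        qed
        then show "\<forall>\<^sub>F k in sequentially. dist (b k i) (a i) \<le> dist (1 / real (Suc k)) 0" by simp
      qed
    next
      case False
      then show ?thesis using b assms(2) S'(2) by simp
    qed
  qed
  then have "\<forall>\<^sub>F k in sequentially. b k \<in> S'" using S' assms(2) topological_tendstoD by blast
  then obtain k where "b k \<in> S'" using eventually_happens' sequentially_bot by blast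
  then show False using b S'(2) by blast
qed

lemma good_chart_bilipschitz:
  assumes g: "good_chart n V \<psi>"
  shows "\<exists>A>0. \<forall>y\<in>V. \<forall>z\<in>V. dist y z \<le> A * edist n (\<psi> y) (\<psi> z) \<and> edist n (\<psi> y) (\<psi> z) \<le> A * dist y z"
proof -
  obtain \<kappa> where \<kappa>: "\<kappa> > 0" "\<And>y z. y \<in> V \<Longrightarrow> z \<in> V \<Longrightarrow> \<kappa> * dist y z \<le> (\<Sum>i<n. \<bar>\<psi> y i - \<psi> z i\<bar>)"
    using good_chartD(4)[OF g] by blast
  have "\<forall>i. \<exists>L. i < n \<longrightarrow> L \<ge> 0 \<and> (\<forall>y\<in>V. \<forall>z\<in>V. \<bar>\<psi> y i - \<psi> z i\<bar> \<le> L * dist y z)"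
    using regular_on_lip[OF good_chartD(5)[OF g]] by blast
  then have "\<exists>L. \<forall>i. i < n \<longrightarrow> L i \<ge> 0 \<and> (\<forall>y\<in>V. \<forall>z\<in>V. \<bar>\<psi> y i - \<psi> z i\<bar> \<le> L i * dist y z)"
    by (rule choice)
  then obtain L where L: "\<forall>i. i < n \<longrightarrow> L i \<ge> 0 \<and> (\<forall>y\<in>V. \<forall>z\<in>V. \<bar>\<psi> y i - \<psi> z i\<bar> \<le> L i * dist y z)"
    by (elim exE)
  define A where "A = n / \<kappa> + (\<Sum>i<n. L i) + 1"
  have sL: "0 \<le> (\<Sum>i<n. L i)" using L by (intro sum_nonneg) auto
  have nk: "0 \<le> n / \<kappa>" using \<kappa>(1) by simp
  have A: "A > 0" unfolding A_def using sL nk by simp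
  have "dist y z \<le> A * edist n (\<psi> y) (\<psi> z) \<and> edist n (\<psi> y) (\<psi> z) \<le> A * dist y z" if yz: "y \<in> V" "z \<in> V" for y z
  proof
    have e0: "0 \<le> edist n (\<psi> y) (\<psi> z)" unfolding edist_def enorm_def by (rule L2_set_nonneg)
    have "\<kappa> * dist y z \<le> n * edist n (\<psi> y) (\<psi> z)"
      using \<kappa>(2)[OF yz] sum_le_enorm[where n = n and v = "\<lambda>i. \<psi> y i - \<psi> z i"] unfolding edist_def by linarith
    then have "dist y z \<le> n / \<kappa> * edist n (\<psi> y) (\<psi> z)" using \<kappa>(1) by (simp add: field_simps)
    also have "\<dots> \<le> A * edist n (\<psi> y) (\<psi> z)" unfolding A_def using sL e0 by (intro mult_right_mono) auto
    finally show "dist y z \<le> A * edist n (\<psi> y) (\<psi> z)" .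
    have "edist n (\<psi> y) (\<psi> z) \<le> (\<Sum>i<n. \<bar>\<psi> y i - \<psi> z i\<bar>)" unfolding edist_def by (rule enorm_le_sum)
    also have "\<dots> \<le> (\<Sum>i<n. L i * dist y z)" using L yz by (intro sum_mono) auto
    also have "\<dots> = (\<Sum>i<n. L i) * dist y z" by (simp add: sum_distrib_right)
    also have "\<dots> \<le> A * dist y z" unfolding A_def using nk by (intro mult_right_mono) auto
    finally show "edist n (\<psi> y) (\<psi> z) \<le> A * dist y z" .
  qed
  then show ?thesis using A by blast
qed

section \<open>DC coordinate expressions\<close>

context semiconvex_gspace
begin

text \<open>If all coordinates decrease, then \<open>\<psi>0\<close> increases at a definite rate and dominates \<open>k\<close>.\<close>

lemma chart_monotone:
  fixes y z :: 'a
  assumes E: "\<bar>\<psi>0 y - \<psi>0 z + (\<Sum>i<n. \<psi> y i - \<psi> z i)\<bar> \<le> (\<Sum>i<n. \<bar>\<psi> y i - \<psi> z i\<bar>) / 2"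
    and \<kappa>: "\<kappa> * dist y z \<le> (\<Sum>i<n. \<bar>\<psi> y i - \<psi> z i\<bar>)"
    and k: "\<bar>k y - k z\<bar> \<le> L * dist y z" and C: "C \<ge> 0" "2 * L \<le> C * \<kappa>"
    and le: "\<And>i. i < n \<Longrightarrow> \<psi> z i \<le> \<psi> y i"
  shows "k y + C * \<psi>0 y \<le> k z + C * \<psi>0 z"
proof -
  let ?S = "\<Sum>i<n. \<bar>\<psi> y i - \<psi> z i\<bar>"
  have "(\<Sum>i<n. \<psi> y i - \<psi> z i) = ?S" using le by (intro sum.cong) auto
  then have "\<psi>0 y - \<psi>0 z \<le> - (?S / 2)" using E by linarith
  then have "C * (\<psi>0 y - \<psi>0 z) \<le> C * - (?S / 2)" using C(1) by (rule mult_left_mono)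
  moreover have "C * (\<kappa> * dist y z) \<le> C * ?S" using \<kappa> C(1) by (rule mult_left_mono)
  moreover have "2 * L * dist y z \<le> C * \<kappa> * dist y z" using C(2) by (intro mult_right_mono) auto
  ultimately have "C * (\<psi>0 y - \<psi>0 z) \<le> - (L * dist y z)" by (simp add: mult.assoc)
  then show ?thesis using k by (simp add: right_diff_distrib)
qed

text \<open>Geodesic convexity becomes convexity in the coordinates: the coordinates of the point \<open>m\<close> of a
  geodesic are at most those of the point \<open>q\<close> of the segment, so by monotonicity the value at \<open>q\<close> is at most
  the value at \<open>m\<close>.\<close>

lemma value_convex:
  fixes x :: 'a
  assumes g: "good_chart n V \<psi>" and sub: "ball x (2 * \<epsilon>) \<subseteq> V"
    and W: "W \<subseteq> \<psi> ` (V \<inter> ball x \<epsilon>)"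
    and K: "semi (ball x (2 * \<epsilon>)) 0 K"
    and mono: "\<And>y z. y \<in> ball x (2 * \<epsilon>) \<Longrightarrow> z \<in> ball x (2 * \<epsilon>) \<Longrightarrow> (\<And>i. i < n \<Longrightarrow> \<psi> z i \<le> \<psi> y i) \<Longrightarrow> K y \<le> K z"
    and b: "b \<in> W" "b' \<in> W" "(\<lambda>i. (1 - \<theta>) * b i + \<theta> * b' i) \<in> W" and \<theta>: "0 \<le> \<theta>" "\<theta> \<le> 1"
  shows "K (inv_into V \<psi> (\<lambda>i. (1 - \<theta>) * b i + \<theta> * b' i)) \<le>
    (1 - \<theta>) * K (inv_into V \<psi> b) + \<theta> * K (inv_into V \<psi> b')"
proof -
  have inv: "inv_into V \<psi> a \<in> ball x \<epsilon> \<and> \<psi> (inv_into V \<psi> a) = a" if "a \<in> W" for a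
    using that W good_chart_inv[OF g] by auto
  define y where "y = inv_into V \<psi> b"
  define z where "z = inv_into V \<psi> b'"
  define q where "q = inv_into V \<psi> (\<lambda>i. (1 - \<theta>) * b i + \<theta> * b' i)"
  have y: "y \<in> ball x \<epsilon>" "\<psi> y = b" and z: "z \<in> ball x \<epsilon>" "\<psi> z = b'"
    and q: "q \<in> ball x \<epsilon>" "\<psi> q = (\<lambda>i. (1 - \<theta>) * b i + \<theta> * b' i)"
    using inv b unfolding y_def z_def q_def by auto
  define d where "d = dist y z"
  obtain \<gamma> where \<gamma>: "shortest_path {0..d} \<gamma>" "\<gamma> 0 = y" "\<gamma> d = z"
    unfolding d_def by (rule shortest_path_exists)
  have d: "0 \<le> d" "d < 2 * \<epsilon>" using dist_triangle[of y z x] y z unfolding d_def by (auto simp: dist_commute)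
  \<comment> \<open>The ends are less than \<open>2 * \<epsilon>\<close> apart, so each point of the
    geodesic is within \<open>\<epsilon>\<close> of one of them; hence the doubled ball.\<close>
  have im: "\<gamma> ` {0..d} \<subseteq> ball x (2 * \<epsilon>)"
  proof
    fix p assume "p \<in> \<gamma> ` {0..d}"
    then obtain t where t: "0 \<le> t" "t \<le> d" "p = \<gamma> t" by auto
    have "dist y p = t" "dist p z = d - t"
      using shortest_path_dist[OF \<gamma>(1), of 0 t] shortest_path_dist[OF \<gamma>(1), of t d] t \<gamma> by auto
    then show "p \<in> ball x (2 * \<epsilon>)"
      using dist_triangle[of x p y] dist_triangle[of x p z] y z d t by (auto simp: dist_commute)
  qed
  define m where "m = \<gamma> (\<theta> * d)"
  have \<theta>d: "\<theta> * d \<in> {0..d}" using \<theta> d mult_left_le_one_le[of d \<theta>] by auto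
  have conv: "f m \<le> (1 - \<theta>) * f y + \<theta> * f z" if "semi (ball x (2 * \<epsilon>)) 0 f" for f
  proof -
    have "convex_on {0..d} (\<lambda>t. f (\<gamma> t) + 0 * t\<^sup>2)" using that \<gamma>(1) im unfolding semi_def by blast
    then have "convex_on {0..d} (\<lambda>t. f (\<gamma> t))" by simp
    from convex_onD[OF this \<theta>, of 0 d] d show ?thesis unfolding m_def using \<gamma> by simp
  qed
  have mb: "m \<in> ball x (2 * \<epsilon>)" using im \<theta>d unfolding m_def by blast
  have qb: "q \<in> ball x (2 * \<epsilon>)" using q d by auto
  have "K q \<le> K m"
  proof (rule mono[OF qb mb])
    fix i assume i: "i < n"
    have "semi (ball x (2 * \<epsilon>)) 0 (\<lambda>y. \<psi> y i)" using good_chartD(8)[OF g i] sub by (rule semi_subset)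
    from conv[OF this] show "\<psi> m i \<le> \<psi> q i" using y z q by simp
  qed
  also have "K m \<le> (1 - \<theta>) * K y + \<theta> * K z" by (rule conv[OF K])
  finally show ?thesis unfolding y_def z_def q_def .
qed

lemma semiconcave_value:
  fixes x :: 'a
  assumes g: "good_chart n V \<psi>" and sub: "ball x (2 * \<epsilon>) \<subseteq> V"
    and W: "W = {b. (\<forall>i\<ge>n. b i = 0) \<and> (\<Sum>i<n. \<bar>b i - a i\<bar>) < \<delta>}" "W \<subseteq> \<psi> ` (V \<inter> ball x \<epsilon>)"
    and K: "semi (ball x (2 * \<epsilon>)) 0 K" "regular_on (ball x (2 * \<epsilon>)) K"
    and mono: "\<And>y z. y \<in> ball x (2 * \<epsilon>) \<Longrightarrow> z \<in> ball x (2 * \<epsilon>) \<Longrightarrow> (\<And>i. i < n \<Longrightarrow> \<psi> z i \<le> \<psi> y i) \<Longrightarrow> K y \<le> K z"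
  shows "semiconcave n W (\<lambda>b. - K (inv_into V \<psi> b))"
  unfolding semiconcave_def
proof
  have opW: "openin (Euclidean_space n) W" unfolding W(1) by (rule openin_Euclidean_ball)
  obtain A where A: "A > 0" "\<And>y z. y \<in> V \<Longrightarrow> z \<in> V \<Longrightarrow> dist y z \<le> A * edist n (\<psi> y) (\<psi> z)"
    using good_chart_bilipschitz[OF g] by blast
  obtain L where L: "L \<ge> 0" "\<And>y z. y \<in> ball x (2 * \<epsilon>) \<Longrightarrow> z \<in> ball x (2 * \<epsilon>) \<Longrightarrow> \<bar>K y - K z\<bar> \<le> L * dist y z"
    using regular_on_lip[OF K(2)] by blast
  have inv: "inv_into V \<psi> b \<in> V \<and> inv_into V \<psi> b \<in> ball x (2 * \<epsilon>) \<and> \<psi> (inv_into V \<psi> b) = b" if b: "b \<in> W" for b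
  proof -
    obtain y where y: "y \<in> V" "y \<in> ball x \<epsilon>" "b = \<psi> y" using b W(2) by auto
    then have "0 < \<epsilon>" using zero_le_dist[of x y] by simp (meson le_less_trans zero_le_dist)
    then show ?thesis using y good_chart_inv(1)[OF g y(1)] by auto
  qed
  have "\<bar>- K (inv_into V \<psi> b) - - K (inv_into V \<psi> b')\<bar> \<le> (L * A) * edist n b b'" if "b \<in> W" "b' \<in> W" for b b'
  proof -
    have "\<bar>K (inv_into V \<psi> b) - K (inv_into V \<psi> b')\<bar> \<le> L * dist (inv_into V \<psi> b) (inv_into V \<psi> b')"
      using inv that by (intro L(2)) auto
    also have "\<dots> \<le> L * (A * edist n b b')"
      using A(2)[of "inv_into V \<psi> b" "inv_into V \<psi> b'"] inv that L(1) by (intro mult_left_mono) auto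
    finally show ?thesis by (simp add: abs_minus_commute mult.assoc)
  qed
  then show "locally_lipschitz n W (\<lambda>b. - K (inv_into V \<psi> b))"
    unfolding locally_lipschitz_def using opW by blast
  \<comment> \<open>The function is concave by itself; subtracting \<open>t\<^sup>2\<close> provides
    the positive constant that the definition of \<open>semiconcave\<close> asks for.\<close>
  have conc: "concave_on I (\<lambda>t. - K (inv_into V \<psi> (\<lambda>i. c i + t * v i)) - 1 * t\<^sup>2)"
    if I: "is_interval I" "\<forall>t\<in>I. (\<lambda>i. c i + t * v i) \<in> W" for c v I
  proof -
    have cI: "convex I" using I(1) by (simp add: is_interval_convex_1)
    have "convex_on I (\<lambda>t. K (inv_into V \<psi> (\<lambda>i. c i + t * v i)))"
    proof (rule convex_on_linorderI[OF _ cI])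
      fix t s s' :: real assume t: "0 < t" "t < 1" and s: "s \<in> I" "s' \<in> I"
      have eq: "(\<lambda>i. c i + ((1 - t) *\<^sub>R s + t *\<^sub>R s') * v i) = (\<lambda>i. (1 - t) * (c i + s * v i) + t * (c i + s' * v i))"
        by (simp add: fun_eq_iff algebra_simps)
      have "(1 - t) *\<^sub>R s + t *\<^sub>R s' \<in> I" using cI s t by (simp add: convex_def)
      then have "(\<lambda>i. (1 - t) * (c i + s * v i) + t * (c i + s' * v i)) \<in> W" using I(2) unfolding eq[symmetric] by blast
      then show "K (inv_into V \<psi> (\<lambda>i. c i + ((1 - t) *\<^sub>R s + t *\<^sub>R s') * v i)) \<le>
          (1 - t) * K (inv_into V \<psi> (\<lambda>i. c i + s * v i)) + t * K (inv_into V \<psi> (\<lambda>i. c i + s' * v i))"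
        unfolding eq using s I(2) t by (intro value_convex[OF g sub W(2) K(1) mono]) auto
    qed
    then have "convex_on I (\<lambda>t. K (inv_into V \<psi> (\<lambda>i. c i + t * v i)) + 1 * t\<^sup>2)"
      by (rule convex_on_add[OF _ convex_on_square]) (use cI in auto)
    then show ?thesis unfolding concave_on_def by (simp add: algebra_simps)
  qed
  show "\<forall>b\<in>W. \<exists>Wa. openin (Euclidean_space n) Wa \<and> b \<in> Wa \<and> Wa \<subseteq> W \<and>
     (\<exists>lam>0. \<forall>a\<in>topspace (Euclidean_space n). \<forall>v\<in>topspace (Euclidean_space n). \<forall>I.
           enorm n v = 1 \<and> is_interval I \<and> (\<forall>t\<in>I. (\<lambda>i. a i + t * v i) \<in> Wa) \<longrightarrow>
           concave_on I (\<lambda>t. - K (inv_into V \<psi> (\<lambda>i. a i + t * v i)) - lam * t\<^sup>2))"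
  proof
    fix b assume "b \<in> W"
    show "\<exists>Wa. openin (Euclidean_space n) Wa \<and> b \<in> Wa \<and> Wa \<subseteq> W \<and>
     (\<exists>lam>0. \<forall>a\<in>topspace (Euclidean_space n). \<forall>v\<in>topspace (Euclidean_space n). \<forall>I.
           enorm n v = 1 \<and> is_interval I \<and> (\<forall>t\<in>I. (\<lambda>i. a i + t * v i) \<in> Wa) \<longrightarrow>
           concave_on I (\<lambda>t. - K (inv_into V \<psi> (\<lambda>i. a i + t * v i)) - lam * t\<^sup>2))"
      by (rule exI[of _ W], intro conjI, rule opW, rule \<open>b \<in> W\<close>, rule subset_refl, rule exI[of _ 1])
        (use conc in simp)
  qed
qed

text \<open>The strongly convex \<open>s\<close> splits \<open>u\<close> as \<open>k1 - k2\<close>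
  with both terms geodesically convex. A common multiple of \<open>\<psi>0\<close> makes both
  monotone in the coordinates, so convex in the chart, and cancels in the difference.\<close>

lemma DC_function_chart:
  fixes u :: "'a \<Rightarrow> real"
  assumes g: "good_chart n V \<psi>" and O': "open O'" and u: "\<And>x. x \<in> V \<inter> O' \<Longrightarrow> regular_at x u"
  shows "DC_function n (\<psi> ` (V \<inter> O')) (\<lambda>a. u (inv_into V \<psi> a))"
  unfolding DC_function_def
proof
  fix a assume "a \<in> \<psi> ` (V \<inter> O')"
  then obtain x where x: "x \<in> V" "x \<in> O'" "a = \<psi> x" by auto
  obtain U where U: "open U" "x \<in> U" "regular_on U u" using u x unfolding regular_at_def by blast
  have "open (V \<inter> O' \<inter> U)" using U O' good_chartD(1)[OF g] by auto
  moreover have "x \<in> V \<inter> O' \<inter> U" using x U by simp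
  ultimately obtain e where e: "e > 0" "ball x e \<subseteq> V \<inter> O' \<inter> U" using open_contains_ball by blast
  define \<epsilon> where "\<epsilon> = e / 2"
  have \<epsilon>: "\<epsilon> > 0" "2 * \<epsilon> = e" unfolding \<epsilon>_def using e by auto
  let ?B = "ball x (2 * \<epsilon>)"
  have B: "?B \<subseteq> V" "?B \<subseteq> O'" "?B \<subseteq> U" using e unfolding \<epsilon>(2) by auto
  have "openin (Euclidean_space n) (\<psi> ` (V \<inter> ball x \<epsilon>))" by (rule openin_image_good_chart[OF g open_ball])
  moreover have "a \<in> \<psi> ` (V \<inter> ball x \<epsilon>)" using x \<epsilon> by simp
  ultimately obtain \<delta> where \<delta>: "\<delta> > 0" "{b. (\<forall>i\<ge>n. b i = 0) \<and> (\<Sum>i<n. \<bar>b i - a i\<bar>) < \<delta>} \<subseteq> \<psi> ` (V \<inter> ball x \<epsilon>)"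
    using openin_Euclidean_contains_ball by blast
  define W where "W = {b. (\<forall>i\<ge>n. b i = 0) \<and> (\<Sum>i<n. \<bar>b i - a i\<bar>) < \<delta>}"
  have Wsub: "W \<subseteq> \<psi> ` (V \<inter> ball x \<epsilon>)" using \<delta>(2) unfolding W_def .
  obtain \<kappa> where \<kappa>: "\<kappa> > 0" "\<And>y z. y \<in> V \<Longrightarrow> z \<in> V \<Longrightarrow> \<kappa> * dist y z \<le> (\<Sum>i<n. \<bar>\<psi> y i - \<psi> z i\<bar>)"
    using good_chartD(4)[OF g] by blast
  obtain \<psi>0 where \<psi>0: "regular_on V \<psi>0" "semi V 0 \<psi>0" and
    E: "\<And>y z. y \<in> V \<Longrightarrow> z \<in> V \<Longrightarrow> \<bar>\<psi>0 y - \<psi>0 z + (\<Sum>i<n. \<psi> y i - \<psi> z i)\<bar> \<le> (\<Sum>i<n. \<bar>\<psi> y i - \<psi> z i\<bar>) / 2"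
    using good_chartD(6)[OF g] by blast
  obtain s where s: "regular_on V s" "semi V (-1) s" using good_chartD(7)[OF g] by blast
  obtain lam where lam: "lam \<ge> 0" "semi U lam u" using regular_on_semi[OF U(3)] by blast
  \<comment> \<open>Stated for all larger constants, so that \<open>k1\<close> and \<open>k2\<close>
    can share one.\<close>
  have pos: "\<exists>C. C \<ge> 0 \<and> (\<forall>C'\<ge>C. semiconcave n W (\<lambda>b. - (k (inv_into V \<psi> b) + C' * \<psi>0 (inv_into V \<psi> b))))"
    if k: "regular_on ?B k" "semi ?B 0 k" for k
  proof -
    obtain L where L: "L \<ge> 0" "\<And>y z. y \<in> ?B \<Longrightarrow> z \<in> ?B \<Longrightarrow> \<bar>k y - k z\<bar> \<le> L * dist y z"
      using regular_on_lip[OF k(1)] by blast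
    have "semiconcave n W (\<lambda>b. - (k (inv_into V \<psi> b) + C' * \<psi>0 (inv_into V \<psi> b)))" if C': "2 * L / \<kappa> \<le> C'" for C'
    proof -
      have "0 \<le> 2 * L / \<kappa>" using L \<kappa> by simp
      then have C0: "0 \<le> C'" using C' by simp
      have CL: "2 * L \<le> C' * \<kappa>" using C' \<kappa> by (simp add: pos_divide_le_eq)
      have "regular_on ?B (\<lambda>y. k y + C' * \<psi>0 y)"
        using k(1) regular_on_cmul[OF regular_on_subset[OF \<psi>0(1) B(1)] C0] by (rule regular_on_add)
      moreover have "semi ?B (0 + C' * 0) (\<lambda>y. k y + C' * \<psi>0 y)"
        using k(2) semi_cmul[OF semi_subset[OF \<psi>0(2) B(1)] C0] by (rule semi_add)
      ultimately show ?thesis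
      proof (intro semiconcave_value[OF g B(1) W_def Wsub, of "\<lambda>y. k y + C' * \<psi>0 y"])
        fix y z assume yz: "y \<in> ?B" "z \<in> ?B" and le: "\<And>i. i < n \<Longrightarrow> \<psi> z i \<le> \<psi> y i"
        have yV: "y \<in> V" "z \<in> V" using yz B(1) by auto
        show "k y + C' * \<psi>0 y \<le> k z + C' * \<psi>0 z"
          by (rule chart_monotone[OF E[OF yV] \<kappa>(2)[OF yV] L(2)[OF yz] C0 CL le])
      qed simp_all
    qed
    then show ?thesis using L \<kappa> by (intro exI[of _ "2 * L / \<kappa>"]) auto
  qed
  define k2 where "k2 y = lam * s y" for y
  define k1 where "k1 y = u y + k2 y" for y
  have k2: "regular_on ?B k2" unfolding k2_def
    using regular_on_cmul[OF regular_on_subset[OF s(1) B(1)] lam(1)] .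
  have k2s: "semi ?B (lam * -1) k2" unfolding k2_def
    using semi_cmul[OF semi_subset[OF s(2) B(1)] lam(1)] .
  have k1: "regular_on ?B k1" unfolding k1_def
    using regular_on_subset[OF U(3) B(3)] k2 by (rule regular_on_add)
  have "semi ?B (lam + lam * -1) k1" unfolding k1_def
    using semi_subset[OF lam(2) B(3)] k2s by (rule semi_add)
  then have k1s: "semi ?B 0 k1" by simp
  have k2s0: "semi ?B 0 k2" using k2s by (rule semi_mono) (use lam in simp)
  obtain C1 where C1: "C1 \<ge> 0" "\<And>C'. C' \<ge> C1 \<Longrightarrow> semiconcave n W (\<lambda>b. - (k1 (inv_into V \<psi> b) + C' * \<psi>0 (inv_into V \<psi> b)))"
    using pos[OF k1 k1s] by blast
  obtain C2 where C2: "C2 \<ge> 0" "\<And>C'. C' \<ge> C2 \<Longrightarrow> semiconcave n W (\<lambda>b. - (k2 (inv_into V \<psi> b) + C' * \<psi>0 (inv_into V \<psi> b)))"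
    using pos[OF k2 k2s0] by blast
  define C where "C = max C1 C2"
  show "\<exists>W g h. openin (Euclidean_space n) W \<and> a \<in> W \<and> W \<subseteq> \<psi> ` (V \<inter> O') \<and>
        semiconcave n W g \<and> semiconcave n W h \<and> (\<forall>y\<in>W. u (inv_into V \<psi> y) = g y - h y)"
  proof (intro exI conjI ballI)
    show "openin (Euclidean_space n) W" unfolding W_def by (rule openin_Euclidean_ball)
    show "a \<in> W" unfolding W_def using \<delta> x good_chartD(2)[OF g] by simp
    have "V \<inter> ball x \<epsilon> \<subseteq> V \<inter> O'" using B(2) \<epsilon> by auto
    then show "W \<subseteq> \<psi> ` (V \<inter> O')" using Wsub by blast
    \<comment> \<open>Semiconcave parts are negatives of convex ones, so the part from
      \<open>k2\<close> becomes the minuend.\<close>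
    show "semiconcave n W (\<lambda>b. - (k2 (inv_into V \<psi> b) + C * \<psi>0 (inv_into V \<psi> b)))"
      by (rule C2) (simp add: C_def)
    show "semiconcave n W (\<lambda>b. - (k1 (inv_into V \<psi> b) + C * \<psi>0 (inv_into V \<psi> b)))"
      by (rule C1) (simp add: C_def)
    show "u (inv_into V \<psi> b) = - (k2 (inv_into V \<psi> b) + C * \<psi>0 (inv_into V \<psi> b)) -
        - (k1 (inv_into V \<psi> b) + C * \<psi>0 (inv_into V \<psi> b))" for b
      unfolding k1_def by simp
  qed
qed

section \<open>Second countability and the atlas of all good charts\<close>

lemma second_countable_euclidean: "second_countable (euclidean :: 'a topology)"
proof -
  fix x0 :: 'a
  have "\<exists>F. finite F \<and> F \<subseteq> cball x0 k \<and> cball x0 k \<subseteq> (\<Union>p\<in>F. ball p (1 / real (Suc m)))" for k :: real and m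
    using seq_compact_imp_totally_bounded[of "cball x0 k"] cball_compact[of x0 k] compact_eq_seq_compact_metric
    by (metis of_nat_0_less_iff zero_less_Suc zero_less_divide_1_iff)
  then obtain F where F: "\<And>k m. finite (F k m)" "\<And>k m. cball x0 k \<subseteq> (\<Union>p\<in>F k m. ball p (1 / real (Suc m)))"
    by metis
  define B where "B = (\<Union>k::nat. \<Union>m. (\<lambda>p. ball p (1 / real (Suc m))) ` F (real k) m)"
  have "countable B" unfolding B_def using F(1) by (intro countable_UN countable_image) (auto simp: countable_finite)
  moreover have "\<exists>S\<in>B. x \<in> S \<and> S \<subseteq> U" if U: "open U" "x \<in> U" for x U
  proof -
    obtain r where r: "r > 0" "ball x r \<subseteq> U" using U open_contains_ball by blast
    obtain m where m: "inverse (real (Suc m)) < r / 2" using reals_Archimedean[of "r / 2"] r by auto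
    obtain k :: nat where k: "dist x0 x \<le> real k" using real_arch_simple by blast
    then obtain p where p: "p \<in> F (real k) m" "x \<in> ball p (1 / real (Suc m))" using F(2)[of "real k" m] by auto
    have "ball p (1 / real (Suc m)) \<subseteq> ball x r"
    proof
      fix z assume "z \<in> ball p (1 / real (Suc m))"
      then show "z \<in> ball x r"
        using p(2) m dist_triangle[of x z p] by (simp add: dist_commute inverse_eq_divide)
    qed
    moreover have "ball p (1 / real (Suc m)) \<in> B" unfolding B_def using p(1) by blast
    ultimately show ?thesis using p(2) r(2) by blast
  qed
  moreover have "\<forall>S\<in>B. open S" unfolding B_def by auto
  ultimately show ?thesis unfolding second_countable_def by (intro exI[of _ B]) auto
qed

definition charts :: "nat \<Rightarrow> 'a chart set" where
  "charts n = {(V, \<psi>). good_chart n V \<psi>}"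

lemma atlas_charts:
  assumes "\<forall>x::'a. \<exists>V \<psi>. good_chart n V \<psi> \<and> x \<in> V" shows "atlas n (charts n)"
  unfolding atlas_def
proof
  show "\<forall>c\<in>charts n. is_chart n c" unfolding charts_def using good_chart_is_chart by auto
  have "x \<in> (\<Union>c\<in>charts n. fst c)" for x :: 'a
  proof -
    obtain V \<psi> where "good_chart n V \<psi> \<and> x \<in> V" using assms[THEN spec, of x] by (elim exE)
    then have "(V, \<psi>) \<in> charts n" "x \<in> fst (V, \<psi>)" unfolding charts_def by auto
    then show ?thesis by blast
  qed
  then show "(\<Union>c\<in>charts n. fst c) = UNIV" by blast
qed

text \<open>The coordinates of one chart are regular functions, and regular functions are C1 in
  every chart.\<close>

lemma C1_atlas_charts:
  assumes "\<forall>x::'a. \<exists>V \<psi>. good_chart n V \<psi> \<and> x \<in> V" shows "C1_atlas n (charts n)"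
  unfolding C1_atlas_def
proof (intro conjI ballI)
  show "atlas n (charts n)" by (rule atlas_charts[OF assms])
  fix c c' :: "'a chart" assume "c \<in> charts n" "c' \<in> charts n"
  then obtain V \<psi> V' \<psi>' where c: "c = (V, \<psi>)" "good_chart n V \<psi>" "c' = (V', \<psi>')" "good_chart n V' \<psi>'"
    unfolding charts_def by auto
  show "C1_map n (overlap c c') (transition c c')"
    unfolding C1_map_def overlap_def transition_def chart_inv_def c fst_conv snd_conv o_def
    using good_chart_regular_at[OF c(4)]
    by (auto intro!: C1_function_chart[OF c(2) good_chartD(1)[OF c(4)]])
qed

lemma DC_atlas_charts:
  assumes "\<forall>x::'a. \<exists>V \<psi>. good_chart n V \<psi> \<and> x \<in> V" shows "DC_atlas n (charts n)"
  unfolding DC_atlas_def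
proof (intro conjI ballI)
  show "atlas n (charts n)" by (rule atlas_charts[OF assms])
  fix c c' :: "'a chart" assume "c \<in> charts n" "c' \<in> charts n"
  then obtain V \<psi> V' \<psi>' where c: "c = (V, \<psi>)" "good_chart n V \<psi>" "c' = (V', \<psi>')" "good_chart n V' \<psi>'"
    unfolding charts_def by auto
  show "DC_map n (overlap c c') (transition c c')"
    unfolding DC_map_def overlap_def transition_def chart_inv_def c fst_conv snd_conv o_def
    using good_chart_regular_at[OF c(4)]
    by (auto intro!: DC_function_chart[OF c(2) good_chartD(1)[OF c(4)]])
  obtain A where A: "A > 0" "\<And>y z. y \<in> V \<Longrightarrow> z \<in> V \<Longrightarrow> dist y z \<le> A * edist n (\<psi> y) (\<psi> z)"
    "\<And>y z. y \<in> V \<Longrightarrow> z \<in> V \<Longrightarrow> edist n (\<psi> y) (\<psi> z) \<le> A * dist y z"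
    using good_chart_bilipschitz[OF c(2)] by blast
  obtain A' where A': "A' > 0" "\<And>y z. y \<in> V' \<Longrightarrow> z \<in> V' \<Longrightarrow> dist y z \<le> A' * edist n (\<psi>' y) (\<psi>' z)"
    "\<And>y z. y \<in> V' \<Longrightarrow> z \<in> V' \<Longrightarrow> edist n (\<psi>' y) (\<psi>' z) \<le> A' * dist y z"
    using good_chart_bilipschitz[OF c(4)] by blast
  let ?\<Omega> = "\<psi> ` (V \<inter> V')"
  let ?f = "\<lambda>a. \<psi>' (inv_into V \<psi> a)"
  have "edist n a b / (A * A') \<le> edist n (?f a) (?f b) \<and> edist n (?f a) (?f b) \<le> (A * A') * edist n a b"
    if "a \<in> ?\<Omega>" "b \<in> ?\<Omega>" for a b
  proof -
    obtain y where y: "y \<in> V" "y \<in> V'" "a = \<psi> y" using \<open>a \<in> ?\<Omega>\<close> by blast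
    obtain z where z: "z \<in> V" "z \<in> V'" "b = \<psi> z" using \<open>b \<in> ?\<Omega>\<close> by blast
    have f: "?f a = \<psi>' y" "?f b = \<psi>' z" using y z good_chart_inv(1)[OF c(2)] by auto
    have "edist n (\<psi> y) (\<psi> z) \<le> A * dist y z" using A(3) y z by blast
    also have "\<dots> \<le> A * (A' * edist n (\<psi>' y) (\<psi>' z))" using A'(2) y z A(1) by (intro mult_left_mono) auto
    finally have "edist n a b / (A * A') \<le> edist n (?f a) (?f b)"
      using A(1) A'(1) unfolding f unfolding y(3) z(3) by (simp add: pos_divide_le_eq mult_ac)
    moreover have "edist n (\<psi>' y) (\<psi>' z) \<le> A' * dist y z" using A'(3) y z by blast
    moreover have "A' * dist y z \<le> A' * (A * edist n (\<psi> y) (\<psi> z))" using A(2) y z A'(1) by (intro mult_left_mono) auto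
    ultimately show ?thesis unfolding f unfolding y(3) z(3) by (simp add: mult_ac)
  qed
  moreover have "openin (Euclidean_space n) ?\<Omega>"
    by (rule openin_image_good_chart[OF c(2) good_chartD(1)[OF c(4)]])
  ultimately show "locally_bilipschitz n (overlap c c') (transition c c')"
    unfolding locally_bilipschitz_def overlap_def transition_def chart_inv_def c fst_conv snd_conv o_def
    using A(1) A'(1) by (intro ballI exI[of _ ?\<Omega>] conjI exI[of _ "A * A'"]) auto
qed

lemma canonical_atlas_charts:
  assumes "\<forall>x::'a. \<exists>V \<psi>. good_chart n V \<psi> \<and> x \<in> V" shows "canonical_atlas n (charts n)"
  unfolding canonical_atlas_def
proof (intro conjI allI)
  show "atlas n (charts n)" by (rule atlas_charts[OF assms])
  fix x :: 'a
  obtain U where U: "open U" "x \<in> U" "\<forall>p\<in>U. \<forall>y\<in>U. regular_at y (sqd p)"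
    using sqd_regular_at[of x] by (elim exE conjE)
  have "C1_function n (snd c ` (fst c \<inter> U)) (\<lambda>y. (dist p (chart_inv c y))\<^sup>2) \<and>
      DC_function n (snd c ` (fst c \<inter> U)) (\<lambda>y. (dist p (chart_inv c y))\<^sup>2)"
    if p: "p \<in> U" and cc: "c \<in> charts n" for p c
  proof -
    obtain V \<psi> where c: "c = (V, \<psi>)" "good_chart n V \<psi>" using cc unfolding charts_def by auto
    show ?thesis unfolding c chart_inv_def fst_conv snd_conv
      using C1_function_chart[OF c(2) U(1), of "sqd p"] DC_function_chart[OF c(2) U(1), of "sqd p"] U(3) p
      by auto
  qed
  then show "\<exists>U. open U \<and> x \<in> U \<and> (\<forall>p\<in>U. \<forall>c\<in>charts n.
      C1_function n (snd c ` (fst c \<inter> U)) (\<lambda>y. (dist p (chart_inv c y))\<^sup>2) \<and>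
      DC_function n (snd c ` (fst c \<inter> U)) (\<lambda>y. (dist p (chart_inv c y))\<^sup>2))"
    using U(1,2) by (intro exI[of _ U] conjI ballI) auto
qed

lemma topological_manifold_charts:
  assumes "\<forall>x::'a. \<exists>V \<psi>. good_chart n V \<psi> \<and> x \<in> V"
  shows "topological_manifold n (euclidean :: 'a topology)"
  unfolding topological_manifold_def
proof (intro conjI ballI)
  show "Hausdorff_space (euclidean :: 'a topology)" by simp
  show "second_countable (euclidean :: 'a topology)" by (rule second_countable_euclidean)
  fix x :: 'a
  obtain V \<psi> where V: "good_chart n V \<psi> \<and> x \<in> V" using assms[THEN spec, of x] by (elim exE)
  then have "is_chart n (V, \<psi>)" using good_chart_is_chart by blast
  then have "open V" "openin (Euclidean_space n) (\<psi> ` V)"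
    "homeomorphic_map (top_of_set V) (subtopology (Euclidean_space n) (\<psi> ` V)) \<psi>"
    unfolding is_chart_def by auto
  then show "\<exists>U V. openin euclidean U \<and> x \<in> U \<and> openin (Euclidean_space n) V \<and>
        top_of_set U homeomorphic_space subtopology (Euclidean_space n) V"
    using V homeomorphic_map_imp_homeomorphic_space
    by (intro exI[of _ V] exI[of _ "\<psi> ` V"]) auto
qed

end

section \<open>The Finsler metric\<close>

lemma tangent_spaceD:
  "\<xi> \<in> tangent_space n A x \<Longrightarrow>
    if c \<in> A \<and> x \<in> fst c then \<xi> c \<in> topspace (Euclidean_space n) else \<xi> c = (\<lambda>_. 0)"
  unfolding tangent_space_def by blast

context semiconvex_gspace
begin

text \<open>Links the two models of a tangent vector: the coordinate family \<open>\<xi>\<close> and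
  the derivation \<open>v\<close>, whose length is \<open>c\<close>.\<close>

definition represents :: "nat \<Rightarrow> 'a \<Rightarrow> ('a chart \<Rightarrow> nat \<Rightarrow> real) \<Rightarrow> real \<Rightarrow> (('a \<Rightarrow> real) \<Rightarrow> real) \<Rightarrow> bool" where
  "represents n x \<xi> c v \<longleftrightarrow> tvec x c v \<and>
     (\<forall>V \<psi>. good_chart n V \<psi> \<and> x \<in> V \<longrightarrow> (\<forall>i<n. v (\<lambda>y. \<psi> y i) = \<xi> (V, \<psi>) i))"

definition finsler :: "nat \<Rightarrow> 'a \<times> ('a chart \<Rightarrow> nat \<Rightarrow> real) \<Rightarrow> real" where
  "finsler n = (\<lambda>(x, \<xi>). THE c. \<exists>v. represents n x \<xi> c v)"

text \<open>The Finsler norm read in one chart, at the point with coordinates \<open>a\<close>; its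
  continuity is checked in this form.\<close>

definition chart_norm :: "nat \<Rightarrow> 'a set \<Rightarrow> ('a \<Rightarrow> nat \<Rightarrow> real) \<Rightarrow> (nat \<Rightarrow> real) \<times> (nat \<Rightarrow> real) \<Rightarrow> real" where
  "chart_norm n V \<psi> = (\<lambda>(a, w). THE c. \<exists>v. tvec (inv_into V \<psi> a) c v \<and> (\<forall>i<n. v (\<lambda>y. \<psi> y i) = w i))"

lemma chart_norm_eq:
  assumes g: "good_chart n V \<psi>" and x: "x \<in> V" and v: "tvec x c v" "\<And>i. i < n \<Longrightarrow> v (\<lambda>y. \<psi> y i) = w i"
  shows "chart_norm n V \<psi> (\<psi> x, w) = c"
  unfolding chart_norm_def prod.case good_chart_inv(1)[OF g x]
proof (rule the_equality)
  show "\<exists>v. tvec x c v \<and> (\<forall>i<n. v (\<lambda>y. \<psi> y i) = w i)" using v by blast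
  fix d assume "\<exists>v. tvec x d v \<and> (\<forall>i<n. v (\<lambda>y. \<psi> y i) = w i)"
  then obtain v' where "tvec x d v'" "\<forall>i<n. v' (\<lambda>y. \<psi> y i) = w i" by blast
  then show "d = c" using good_chart_tvec_unique(2)[OF g x _ v(1)] v(2) by auto
qed

text \<open>Trades the norm at \<open>y\<close> for a quotient of distance by time with any
  prescribed error, so that continuity of the norm reduces to two-point limits.\<close>

lemma chart_norm_approx:
  fixes y :: 'a
  assumes g: "good_chart n V \<psi>" and y: "y \<in> V" and v: "tvec y c v" "\<And>i. i < n \<Longrightarrow> v (\<lambda>y. \<psi> y i) = w i"
    and w: "\<forall>i\<ge>n. w i = 0" and e: "e > 0"
  shows "\<exists>t z. 0 < t \<and> t < e \<and> dist z y < e \<and> (\<forall>i. \<psi> z i = \<psi> y i + t * w i) \<and> \<bar>dist y z / t - c\<bar> < e"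
proof -
  let ?\<tau> = "\<lambda>m. 1 / real (Suc m)"
  obtain z where z: "z \<longlonglongrightarrow> y" "\<forall>\<^sub>F m in sequentially. \<psi> (z m) = (\<lambda>i. \<psi> y i + ?\<tau> m * w i)"
    using chart_point[OF g y tendsto_inverse_Suc w] by (elim exE conjE)
  have "(\<lambda>m. dist y (z m) / \<bar>?\<tau> m\<bar>) \<longlonglongrightarrow> c"
  proof (rule chart_limit(1)[OF g y tendsto_const z(1) _ tendsto_inverse_Suc v(1)])
    fix j assume j: "j < n"
    show "(\<lambda>m. (\<psi> (z m) j - \<psi> y j) / ?\<tau> m) \<longlonglongrightarrow> v (\<lambda>y. \<psi> y j)"
    proof (rule tendsto_eventually)
      show "\<forall>\<^sub>F m in sequentially. (\<psi> (z m) j - \<psi> y j) / ?\<tau> m = v (\<lambda>y. \<psi> y j)"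
        using z(2) by eventually_elim (use v(2) j in \<open>simp del: of_nat_Suc\<close>)
    qed
  qed simp
  then have "\<forall>\<^sub>F m in sequentially. dist (dist y (z m) / \<bar>?\<tau> m\<bar>) c < e" using e by (rule tendstoD)
  moreover have "\<forall>\<^sub>F m in sequentially. dist (z m) y < e" using z(1) e by (rule tendstoD)
  moreover have "\<forall>\<^sub>F m in sequentially. ?\<tau> m < e" using tendsto_inverse_Suc e by (rule order_tendstoD(2))
  ultimately have "\<forall>\<^sub>F m in sequentially. dist (dist y (z m) / \<bar>?\<tau> m\<bar>) c < e \<and> dist (z m) y < e \<and> ?\<tau> m < e \<and>
      \<psi> (z m) = (\<lambda>i. \<psi> y i + ?\<tau> m * w i)" using z(2) by eventually_elim blast
  then obtain m where m: "dist (dist y (z m) / \<bar>?\<tau> m\<bar>) c < e" "dist (z m) y < e" "?\<tau> m < e"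
      "\<psi> (z m) = (\<lambda>i. \<psi> y i + ?\<tau> m * w i)"
    using eventually_happens' sequentially_bot by blast
  show ?thesis
  proof (intro exI conjI allI)
    show "0 < ?\<tau> m" by simp
    show "\<bar>dist y (z m) / ?\<tau> m - c\<bar> < e" using m(1) by (simp add: dist_real_def)
    show "\<psi> (z m) i = \<psi> y i + ?\<tau> m * w i" for i using fun_cong[OF m(4)] .
  qed (use m in auto)
qed

text \<open>The norms at \<open>p k\<close> are replaced by quotients of distances near
  \<open>y k\<close>, and \<open>chart_limit\<close> at the limit point identifies their
  limit.\<close>

lemma chart_norm_continuous:
  assumes g: "good_chart n V (\<psi> :: 'a \<Rightarrow> nat \<Rightarrow> real)"
  shows "continuous_on (\<psi> ` V \<times> {w. \<forall>i\<ge>n. w i = 0}) (chart_norm n V \<psi>)"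
proof (rule continuous_on_sequentiallyI)
  fix p q assume p: "\<forall>k. p k \<in> \<psi> ` V \<times> {w. \<forall>i\<ge>n. w i = (0::real)}" "q \<in> \<psi> ` V \<times> {w. \<forall>i\<ge>n. w i = 0}"
    and lim: "p \<longlonglongrightarrow> q"
  define y where "y k = inv_into V \<psi> (fst (p k))" for k
  define x where "x = inv_into V \<psi> (fst q)"
  have y: "y k \<in> V" "\<psi> (y k) = fst (p k)" for k
    using p(1)[rule_format, of k] good_chart_inv[OF g] unfolding y_def by auto
  have x: "x \<in> V" "\<psi> x = fst q" using p(2) good_chart_inv[OF g] unfolding x_def by auto
  have w: "\<forall>i\<ge>n. snd (p k) i = 0" for k using p(1)[rule_format, of k] by auto
  have yx: "y \<longlonglongrightarrow> x"
    using y x tendsto_coordinate[OF tendsto_fst[OF lim]] by (intro good_chart_tendsto[OF g]) auto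
  obtain c v where v: "tvec x c v" "\<forall>i<n. v (\<lambda>y. \<psi> y i) = snd q i" using chart_vector[OF g x(1)] by blast
  have nq: "chart_norm n V \<psi> q = c"
    using chart_norm_eq[OF g x(1) v(1), of "snd q"] v(2) x(2) by simp
  have "\<exists>t z. 0 < t \<and> t < 1 / real (Suc k) \<and> dist z (y k) < 1 / real (Suc k) \<and>
      (\<forall>i. \<psi> z i = \<psi> (y k) i + t * snd (p k) i) \<and> \<bar>dist (y k) z / t - chart_norm n V \<psi> (p k)\<bar> < 1 / real (Suc k)" for k
  proof -
    obtain c' v' where v': "tvec (y k) c' v'" "\<forall>i<n. v' (\<lambda>y. \<psi> y i) = snd (p k) i"
      using chart_vector[OF g y(1)] by blast
    have "chart_norm n V \<psi> (p k) = c'"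
      using chart_norm_eq[OF g y(1) v'(1), of "snd (p k)"] v'(2) y(2) by simp
    then show ?thesis using chart_norm_approx[where e = "1 / real (Suc k)", OF g y(1) v'(1) _ w] v'(2) by simp
  qed
  then have "\<forall>k. \<exists>t z. 0 < t \<and> t < 1 / real (Suc k) \<and> dist z (y k) < 1 / real (Suc k) \<and>
      (\<forall>i. \<psi> z i = \<psi> (y k) i + t * snd (p k) i) \<and> \<bar>dist (y k) z / t - chart_norm n V \<psi> (p k)\<bar> < 1 / real (Suc k)"
    by blast
  then have "\<exists>t z. \<forall>k. 0 < t k \<and> t k < 1 / real (Suc k) \<and> dist (z k) (y k) < 1 / real (Suc k) \<and>
      (\<forall>i. \<psi> (z k) i = \<psi> (y k) i + t k * snd (p k) i) \<and> \<bar>dist (y k) (z k) / t k - chart_norm n V \<psi> (p k)\<bar> < 1 / real (Suc k)"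
    by (simp only: choice_iff)
  then obtain t z where tz: "\<forall>k. 0 < t k \<and> t k < 1 / real (Suc k) \<and> dist (z k) (y k) < 1 / real (Suc k) \<and>
      (\<forall>i. \<psi> (z k) i = \<psi> (y k) i + t k * snd (p k) i) \<and> \<bar>dist (y k) (z k) / t k - chart_norm n V \<psi> (p k)\<bar> < 1 / real (Suc k)"
    by (elim exE)
  have t: "\<And>k. 0 < t k" "\<And>k. t k < 1 / real (Suc k)" "\<And>k. dist (z k) (y k) < 1 / real (Suc k)"
    "\<And>k i. \<psi> (z k) i = \<psi> (y k) i + t k * snd (p k) i"
    "\<And>k. \<bar>dist (y k) (z k) / t k - chart_norm n V \<psi> (p k)\<bar> < 1 / real (Suc k)"
    using tz by (simp_all only: simp_thms)
  have zx: "z \<longlonglongrightarrow> x" using yx t(3) by (rule tendsto_if_dist_less)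
  have "(\<lambda>k. dist (y k) (z k) / \<bar>t k\<bar>) \<longlonglongrightarrow> c"
  proof (rule chart_limit(1)[OF g x(1) yx zx _ _ v(1)])
    show "t k \<noteq> 0" for k using t(1)[of k] by simp
    show "t \<longlonglongrightarrow> 0"
    proof (rule tendsto_0_if_abs_less)
      show "\<bar>t k\<bar> < 1 / real (Suc k)" for k using t(1,2)[of k] by simp
    qed
    fix i assume i: "i < n"
    have "(\<psi> (z k) i - \<psi> (y k) i) / t k = snd (p k) i" for k using t(1)[of k] t(4)[of k i] by simp
    then show "(\<lambda>k. (\<psi> (z k) i - \<psi> (y k) i) / t k) \<longlonglongrightarrow> v (\<lambda>y. \<psi> y i)"
      using tendsto_coordinate[OF tendsto_snd[OF lim], of i] v(2) i by simp
  qed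
  moreover have "\<bar>t k\<bar> = t k" for k using t(1)[of k] by simp
  ultimately have "(\<lambda>k. dist (y k) (z k) / t k) \<longlonglongrightarrow> c" by simp
  from tendsto_diff[OF this tendsto_0_if_abs_less[OF t(5)]]
  show "(\<lambda>k. chart_norm n V \<psi> (p k)) \<longlonglongrightarrow> chart_norm n V \<psi> q" unfolding nq by simp
qed

section \<open>Shortest paths are C1 in the charts\<close>

lemma shortest_path_extend_0:
  fixes \<gamma> :: "real \<Rightarrow> 'a"
  assumes \<gamma>: "shortest_path {0..D} \<gamma>" and D: "D > 0"
  shows "\<exists>b \<delta>. 0 < b \<and> b \<le> D \<and> shortest_path {-b..b} \<delta> \<and> (\<forall>t\<in>{0..b}. \<delta> t = \<gamma> t)"
proof -
  obtain a where a: "a > 0" and pth: "\<And>y z. y \<in> ball (\<gamma> 0) a \<Longrightarrow> z \<in> ball (\<gamma> 0) a \<Longrightarrow>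
      \<exists>\<gamma>. shortest_path {-3*a..3*a} \<gamma> \<and> \<gamma> 0 = y \<and> \<gamma> (dist y z) = z"
    by (rule two_sided_path[of "\<gamma> 0"]) (rule that; assumption)
  define b where "b = min D (a / 2)"
  have b: "0 < b" "b \<le> D" "b < a" unfolding b_def using a D by auto
  have d: "dist (\<gamma> 0) (\<gamma> b) = b" using shortest_path_dist[OF \<gamma>, of 0 b] b by auto
  then obtain \<delta> where \<delta>: "shortest_path {-3*a..3*a} \<delta>" "\<delta> 0 = \<gamma> 0" "\<delta> b = \<gamma> b"
    using pth[of "\<gamma> 0" "\<gamma> b"] a b by auto
  have sb: "shortest_path {-b..b} \<delta>"
    by (rule shortest_path_subset[OF \<delta>(1)]) (use a b in \<open>auto simp: is_interval_cc\<close>)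
  have "\<delta> t = \<gamma> t" if "t \<in> {0..b}" for t
    by (rule path_unique[OF b(1) sb _ \<delta>(2,3) that])
      (rule shortest_path_subset[OF \<gamma>], use b in \<open>auto simp: is_interval_cc\<close>)
  then show ?thesis using b sb by blast
qed

text \<open>\<open>derivative_limit\<close> works with two-sided paths, so at an endpoint the path
  is continued past it; \<open>path_unique\<close> ensures agreement on the old side. The far end
  reduces to the near one by reversing time, and the result is reversed back.\<close>

lemma shortest_path_extend:
  fixes \<gamma> :: "real \<Rightarrow> 'a"
  assumes \<gamma>: "shortest_path {0..D} \<gamma>" and D: "D > 0" and t0: "t0 \<in> {0..D}"
  shows "\<exists>b \<delta>. 0 < b \<and> shortest_path {-b..b} \<delta> \<and> (\<forall>t. \<bar>t\<bar> \<le> b \<and> t0 + t \<in> {0..D} \<longrightarrow> \<delta> t = \<gamma> (t0 + t))"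
proof -
  consider "t0 = 0" | "t0 = D" "t0 \<noteq> 0" | "0 < t0" "t0 < D" using t0 by fastforce
  then show ?thesis
  proof cases
    case 1
    obtain b \<delta> where "0 < b" "shortest_path {-b..b} \<delta>" "\<forall>t\<in>{0..b}. \<delta> t = \<gamma> t"
      using shortest_path_extend_0[OF \<gamma> D] by blast
    then show ?thesis using 1 by (intro exI[of _ b] exI[of _ \<delta>]) auto
  next
    case 2
    define \<gamma>' where "\<gamma>' t = \<gamma> (-1 * t + D)" for t
    have "shortest_path {0..D} \<gamma>'"
      unfolding \<gamma>'_def by (rule shortest_path_affine[OF \<gamma>]) (auto simp: is_interval_cc)
    from shortest_path_extend_0[OF this D] obtain b \<delta> where b: "0 < b" "shortest_path {-b..b} \<delta>" "\<forall>t\<in>{0..b}. \<delta> t = \<gamma>' t"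
      by blast
    define \<delta>' where "\<delta>' t = \<delta> (-1 * t + 0)" for t
    have "shortest_path {-b..b} \<delta>'"
      unfolding \<delta>'_def by (rule shortest_path_affine[OF b(2)]) (auto simp: is_interval_cc)
    moreover have "\<delta>' t = \<gamma> (t0 + t)" if "\<bar>t\<bar> \<le> b" "t0 + t \<in> {0..D}" for t
    proof -
      have "-t \<in> {0..b}" using that 2 by auto
      then have "\<delta> (-t) = \<gamma>' (-t)" using b(3) by blast
      then show ?thesis unfolding \<delta>'_def \<gamma>'_def using 2 by (simp add: add.commute)
    qed
    ultimately show ?thesis using b(1) by blast
  next
    case 3
    define b where "b = min t0 (D - t0)"
    have b: "0 < b" "b \<le> t0" "b \<le> D - t0" unfolding b_def using 3 by auto
    have "shortest_path {-b..b} (\<lambda>t. \<gamma> (1 * t + t0))"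
      by (rule shortest_path_affine[OF \<gamma>]) (use b in \<open>auto simp: is_interval_cc\<close>)
    then show ?thesis using b by (intro exI[of _ b] exI[of _ "\<lambda>t. \<gamma> (1 * t + t0)"]) (auto simp: add.commute)
  qed
qed

text \<open>Translates of \<open>\<delta>\<close> converge to \<open>\<delta>\<close>, so
  \<open>derivative_limit\<close> covers difference quotients both of whose ends move.\<close>

lemma shortest_path_strict_derivative:
  fixes \<gamma> :: "real \<Rightarrow> 'a"
  assumes \<gamma>: "shortest_path {0..D} \<gamma>" and D: "D > 0" and t0: "t0 \<in> {0..D}" and u: "regular_at (\<gamma> t0) u"
  shows "\<exists>d. \<forall>s s'. (\<forall>k. s k \<in> {0..D}) \<longrightarrow> (\<forall>k. s' k \<in> {0..D}) \<longrightarrow> (\<forall>k. s k \<noteq> s' k) \<longrightarrow>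
    s \<longlonglongrightarrow> t0 \<longrightarrow> s' \<longlonglongrightarrow> t0 \<longrightarrow> (\<lambda>k. (u (\<gamma> (s' k)) - u (\<gamma> (s k))) / (s' k - s k)) \<longlonglongrightarrow> d"
proof -
  obtain b \<delta> where b: "0 < b" and \<delta>: "shortest_path {-b..b} \<delta>"
    and ext: "\<And>t. \<bar>t\<bar> \<le> b \<Longrightarrow> t0 + t \<in> {0..D} \<Longrightarrow> \<delta> t = \<gamma> (t0 + t)"
    using shortest_path_extend[OF \<gamma> D t0] by blast
  have \<delta>0: "\<delta> 0 = \<gamma> t0" using ext[of 0] b t0 by simp
  have main: "(\<lambda>k. (u (\<gamma> (hi k)) - u (\<gamma> (lo k))) / (hi k - lo k)) \<longlonglongrightarrow> deriv (\<lambda>t. u (\<delta> t)) 0"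
    if lo: "\<And>k. lo k \<in> {0..D}" "lo \<longlonglongrightarrow> t0" and hi: "\<And>k. hi k \<in> {0..D}" "hi \<longlonglongrightarrow> t0" and less: "\<And>k. lo k < hi k" for lo hi
  proof -
    have "\<forall>\<^sub>F k in sequentially. dist (lo k) t0 < b / 2 \<and> dist (hi k) t0 < b / 2"
      using tendstoD[OF lo(2), of "b/2"] tendstoD[OF hi(2), of "b/2"] b by (auto intro: eventually_conj)
    then obtain N where N: "\<And>k. k \<ge> N \<Longrightarrow> dist (lo k) t0 < b / 2" "\<And>k. k \<ge> N \<Longrightarrow> dist (hi k) t0 < b / 2"
      unfolding eventually_sequentially by blast
    define l where "l k = lo (k + N)" for k
    define h where "h k = hi (k + N)" for k
    have l: "\<bar>l k - t0\<bar> < b / 2" "\<bar>h k - t0\<bar> < b / 2" "l k < h k" "l k \<in> {0..D}" "h k \<in> {0..D}" for k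
      using N[of "k + N"] less lo(1) hi(1) unfolding l_def h_def dist_real_def by auto
    have ll: "l \<longlonglongrightarrow> t0" "h \<longlonglongrightarrow> t0" unfolding l_def h_def
      using lo(2) hi(2) by (auto intro: LIMSEQ_ignore_initial_segment)
    \<comment> \<open>Shifts smaller than \<open>b / 2\<close> keep this path defined on the half
      interval.\<close>
    define \<beta> where "\<beta> k t = \<delta> (1 * t + (l k - t0))" for k t
    have "(\<lambda>k. (u (\<beta> k (h k - l k)) - u (\<beta> k 0)) / (h k - l k)) \<longlonglongrightarrow> 1 * deriv (\<lambda>t. u (\<delta> t)) 0"
    proof (rule derivative_limit[where b = "b / 2" and x = "\<gamma> t0", OF u])
      show "b / 2 > 0" using b by simp
      show "shortest_path {- (b / 2)..b / 2} (\<beta> k)" for k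
      proof -
        have "- (b / 2) < l k - t0" "l k - t0 < b / 2" using l(1)[of k] by linarith+
        then show ?thesis unfolding \<beta>_def
          by (intro shortest_path_affine[OF \<delta>]) (auto simp: is_interval_cc)
      qed
      show "shortest_path {- (b / 2)..b / 2} \<delta>"
        by (rule shortest_path_subset[OF \<delta>]) (use b in \<open>auto simp: is_interval_cc\<close>)
      show "(\<lambda>k. \<beta> k t) \<longlonglongrightarrow> \<delta> t" if t: "t \<in> {- (b / 2)..b / 2}" for t
      proof (rule metric_tendsto_imp_tendsto)
        show "(\<lambda>k. l k - t0) \<longlonglongrightarrow> 0" using tendsto_diff[OF ll(1) tendsto_const[of t0]] by simp
        have "dist (\<beta> k t) (\<delta> t) = \<bar>(1 * t + (l k - t0)) - t\<bar>" for k
        proof -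
          have "- (b / 2) < l k - t0" "l k - t0 < b / 2" using l(1)[of k] by linarith+
          then show ?thesis unfolding \<beta>_def using t b by (intro shortest_path_dist[OF \<delta>]) auto
        qed
        then show "\<forall>\<^sub>F k in sequentially. dist (\<beta> k t) (\<delta> t) \<le> dist (l k - t0) 0" by simp
      qed
      show "(\<lambda>k. h k - l k) \<longlonglongrightarrow> 0" using tendsto_diff[OF ll(2,1)] by simp
      have "(h k - l k) / (h k - l k) = 1" for k using l(3)[of k] by simp
      then show "(\<lambda>k. (h k - l k) / (h k - l k)) \<longlonglongrightarrow> 1" by simp
    qed (use l \<delta>0 in \<open>auto intro: less_imp_le\<close>)
    moreover have "\<beta> k (h k - l k) = \<gamma> (h k)" "\<beta> k 0 = \<gamma> (l k)" for k
    proof -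
      have "\<bar>h k - t0\<bar> \<le> b" "\<bar>l k - t0\<bar> \<le> b" using l(1,2)[of k] b by linarith+
      then show "\<beta> k (h k - l k) = \<gamma> (h k)" "\<beta> k 0 = \<gamma> (l k)"
        using ext[of "h k - t0"] ext[of "l k - t0"] l(4,5)[of k] unfolding \<beta>_def by simp_all
    qed
    ultimately have "(\<lambda>k. (u (\<gamma> (h k)) - u (\<gamma> (l k))) / (h k - l k)) \<longlonglongrightarrow> deriv (\<lambda>t. u (\<delta> t)) 0" by simp
    then show ?thesis unfolding h_def l_def by (rule LIMSEQ_offset)
  qed
  show ?thesis
  proof (intro exI allI impI)
    fix s s' assume s: "\<forall>k. s k \<in> {0..D}" "\<forall>k. s' k \<in> {0..D}" "\<forall>k::nat. s k \<noteq> s' k" "s \<longlonglongrightarrow> t0" "s' \<longlonglongrightarrow> t0"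
    have "(\<lambda>k. (u (\<gamma> (max (s k) (s' k))) - u (\<gamma> (min (s k) (s' k)))) / (max (s k) (s' k) - min (s k) (s' k)))
        \<longlonglongrightarrow> deriv (\<lambda>t. u (\<delta> t)) 0"
    proof (rule main)
      show "(\<lambda>k. min (s k) (s' k)) \<longlonglongrightarrow> t0" using tendsto_min[OF s(4,5)] by simp
      show "(\<lambda>k. max (s k) (s' k)) \<longlonglongrightarrow> t0" using tendsto_max[OF s(4,5)] by simp
      show "min (s k) (s' k) < max (s k) (s' k)" for k using s(3) by (simp add: min_def max_def less_le)
    qed (use s(1,2) in \<open>auto simp: min_def max_def\<close>)
    moreover have "(u (\<gamma> (max (s k) (s' k))) - u (\<gamma> (min (s k) (s' k)))) / (max (s k) (s' k) - min (s k) (s' k)) =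
        (u (\<gamma> (s' k)) - u (\<gamma> (s k))) / (s' k - s k)" for k
      using s(3)[rule_format, of k] by (cases "s k < s' k") (simp_all add: field_simps max_def min_def)
    ultimately show "(\<lambda>k. (u (\<gamma> (s' k)) - u (\<gamma> (s k))) / (s' k - s k)) \<longlonglongrightarrow> deriv (\<lambda>t. u (\<delta> t)) 0" by simp
  qed
qed

text \<open>A strict derivative is continuous: near each \<open>r k\<close> choose a quotient close
  to the derivative there, and these quotients converge. The factor \<open>D\<close> rescales unit
  speed to the parameter interval \<open>{0..1}\<close>.\<close>

lemma shortest_path_C1:
  fixes \<gamma> :: "real \<Rightarrow> 'a"
  assumes \<gamma>: "shortest_path {0..D} \<gamma>" and D: "D > 0"
    and u: "\<And>t. t \<in> S \<Longrightarrow> regular_at (\<gamma> (D * t)) u" and S: "S \<subseteq> {0..1}"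
  shows "\<exists>g. continuous_on S g \<and> (\<forall>t\<in>S. ((\<lambda>s. u (\<gamma> (D * s))) has_real_derivative g t) (at t within {0..1}))"
proof -
  let ?f = "\<lambda>s. u (\<gamma> (D * s))"
  have in01: "D * t \<in> {0..D}" if "t \<in> {0..1}" for t using that D by (simp add: mult_left_le)
  have strict: "\<exists>d. \<forall>s s'. (\<forall>k. s k \<in> {0..1}) \<longrightarrow> (\<forall>k. s' k \<in> {0..1}) \<longrightarrow> (\<forall>k. s k \<noteq> s' k) \<longrightarrow>
    s \<longlonglongrightarrow> t \<longrightarrow> s' \<longlonglongrightarrow> t \<longrightarrow> (\<lambda>k::nat. (?f (s' k) - ?f (s k)) / (s' k - s k)) \<longlonglongrightarrow> d" if t: "t \<in> S" for t
  proof -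
    have "D * t \<in> {0..D}" using in01 t S by blast
    from shortest_path_strict_derivative[OF \<gamma> D this u[OF t]] obtain d where d: "\<And>s s'. (\<forall>k. s k \<in> {0..D}) \<Longrightarrow> (\<forall>k. s' k \<in> {0..D}) \<Longrightarrow> (\<forall>k. s k \<noteq> s' k) \<Longrightarrow>
      s \<longlonglongrightarrow> D * t \<Longrightarrow> s' \<longlonglongrightarrow> D * t \<Longrightarrow> (\<lambda>k. (u (\<gamma> (s' k)) - u (\<gamma> (s k))) / (s' k - s k)) \<longlonglongrightarrow> d" by blast
    show ?thesis
    proof (intro exI allI impI)
      fix s s' assume s: "\<forall>k. s k \<in> {0..1}" "\<forall>k. s' k \<in> {0..1}" "\<forall>k::nat. s k \<noteq> s' k" "s \<longlonglongrightarrow> t" "s' \<longlonglongrightarrow> t"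
      have "(\<lambda>k. (u (\<gamma> (D * s' k)) - u (\<gamma> (D * s k))) / (D * s' k - D * s k)) \<longlonglongrightarrow> d"
        using s D in01 by (intro d tendsto_mult tendsto_const) auto
      from tendsto_mult[OF tendsto_const[of D] this]
      have "(\<lambda>k. D * ((?f (s' k) - ?f (s k)) / (D * s' k - D * s k))) \<longlonglongrightarrow> D * d" .
      moreover have "D * ((?f (s' k) - ?f (s k)) / (D * s' k - D * s k)) = (?f (s' k) - ?f (s k)) / (s' k - s k)" for k
        using D by (simp flip: right_diff_distrib)
      ultimately show "(\<lambda>k. (?f (s' k) - ?f (s k)) / (s' k - s k)) \<longlonglongrightarrow> D * d" by simp
    qed
  qed
  then have "\<forall>t. \<exists>d. t \<in> S \<longrightarrow> (\<forall>s s'. (\<forall>k. s k \<in> {0..1}) \<longrightarrow> (\<forall>k. s' k \<in> {0..1}) \<longrightarrow> (\<forall>k. s k \<noteq> s' k) \<longrightarrow>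
    s \<longlonglongrightarrow> t \<longrightarrow> s' \<longlonglongrightarrow> t \<longrightarrow> (\<lambda>k::nat. (?f (s' k) - ?f (s k)) / (s' k - s k)) \<longlonglongrightarrow> d)" by blast
  then have "\<exists>g. \<forall>t. t \<in> S \<longrightarrow> (\<forall>s s'. (\<forall>k. s k \<in> {0..1}) \<longrightarrow> (\<forall>k. s' k \<in> {0..1}) \<longrightarrow> (\<forall>k. s k \<noteq> s' k) \<longrightarrow>
    s \<longlonglongrightarrow> t \<longrightarrow> s' \<longlonglongrightarrow> t \<longrightarrow> (\<lambda>k::nat. (?f (s' k) - ?f (s k)) / (s' k - s k)) \<longlonglongrightarrow> g t)" by (rule choice)
  then obtain g where g': "\<forall>t. t \<in> S \<longrightarrow> (\<forall>s s'. (\<forall>k. s k \<in> {0..1}) \<longrightarrow> (\<forall>k. s' k \<in> {0..1}) \<longrightarrow> (\<forall>k. s k \<noteq> s' k) \<longrightarrow>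
    s \<longlonglongrightarrow> t \<longrightarrow> s' \<longlonglongrightarrow> t \<longrightarrow> (\<lambda>k::nat. (?f (s' k) - ?f (s k)) / (s' k - s k)) \<longlonglongrightarrow> g t)" by (elim exE)
  have g: "(\<lambda>k::nat. (?f (s' k) - ?f (s k)) / (s' k - s k)) \<longlonglongrightarrow> g t"
    if "t \<in> S" "\<forall>k. s k \<in> {0..1}" "\<forall>k. s' k \<in> {0..1}" "\<forall>k. s k \<noteq> s' k" "s \<longlonglongrightarrow> t" "s' \<longlonglongrightarrow> t" for t s s'
    using g' that by blast
  have der: "((\<lambda>r. (?f r - ?f t) / (r - t)) \<longlongrightarrow> g t) (at t within {0..1})" if t: "t \<in> S" for t
    unfolding tendsto_at_iff_sequentially
  proof (intro allI impI)
    fix X assume X: "\<forall>i. X i \<in> {0..1} - {t}" "X \<longlonglongrightarrow> t"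
    have "(\<lambda>k. (?f (X k) - ?f t) / (X k - t)) \<longlonglongrightarrow> g t"
      using X t S by (intro g[OF t, of "\<lambda>_. t" X]) auto
    then show "((\<lambda>r. (?f r - ?f t) / (r - t)) \<circ> X) \<longlonglongrightarrow> g t" unfolding o_def .
  qed
  have "continuous_on S g"
  proof (rule continuous_on_sequentiallyI)
    fix r t assume r: "\<forall>k. r k \<in> S" and t: "t \<in> S" and lim: "r \<longlonglongrightarrow> t"
    have "\<forall>k. \<exists>s. s \<in> {0..1} \<and> s \<noteq> r k \<and> \<bar>s - r k\<bar> < 1 / real (Suc k) \<and> \<bar>(?f s - ?f (r k)) / (s - r k) - g (r k)\<bar> < 1 / real (Suc k)"
    proof
      fix k
      have rk: "r k \<in> S" "r k \<in> {0..1}" using r S by auto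
      have "\<forall>\<^sub>F s in at (r k) within {0..1}. dist ((?f s - ?f (r k)) / (s - r k)) (g (r k)) < 1 / real (Suc k)"
        using der[OF rk(1)] by (rule tendstoD) simp
      moreover have "\<forall>\<^sub>F s in at (r k) within {0..1}. dist s (r k) < 1 / real (Suc k)"
        using tendsto_ident_at by (rule tendstoD) simp
      moreover have "\<forall>\<^sub>F s in at (r k) within {0..1}. s \<in> {0..1} \<and> s \<noteq> r k"
        unfolding eventually_at_filter by simp
      ultimately have "\<forall>\<^sub>F s in at (r k) within {0..1}. s \<in> {0..1} \<and> s \<noteq> r k \<and> \<bar>s - r k\<bar> < 1 / real (Suc k) \<and>
          \<bar>(?f s - ?f (r k)) / (s - r k) - g (r k)\<bar> < 1 / real (Suc k)"
        by eventually_elim (simp add: dist_real_def)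
      moreover have "at (r k) within {0..1} \<noteq> bot"
        using islimpt_Icc[of 0 1 "r k"] rk(2) by (simp add: trivial_limit_within)
      ultimately show "\<exists>s. s \<in> {0..1} \<and> s \<noteq> r k \<and> \<bar>s - r k\<bar> < 1 / real (Suc k) \<and> \<bar>(?f s - ?f (r k)) / (s - r k) - g (r k)\<bar> < 1 / real (Suc k)"
        using eventually_happens' by blast
    qed
    then have "\<exists>s. \<forall>k. s k \<in> {0..1} \<and> s k \<noteq> r k \<and> \<bar>s k - r k\<bar> < 1 / real (Suc k) \<and> \<bar>(?f (s k) - ?f (r k)) / (s k - r k) - g (r k)\<bar> < 1 / real (Suc k)"
      by (rule choice)
    then obtain s where s: "\<forall>k. s k \<in> {0..1} \<and> s k \<noteq> r k \<and> \<bar>s k - r k\<bar> < 1 / real (Suc k) \<and> \<bar>(?f (s k) - ?f (r k)) / (s k - r k) - g (r k)\<bar> < 1 / real (Suc k)"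
      by (elim exE)
    have "(\<lambda>k. s k - r k) \<longlonglongrightarrow> 0" by (rule tendsto_0_if_abs_less) (use s in blast)
    from tendsto_add[OF this lim] have sl: "s \<longlonglongrightarrow> t" by simp
    have "(\<lambda>k. (?f (s k) - ?f (r k)) / (s k - r k)) \<longlonglongrightarrow> g t"
    proof (rule g[OF t _ _ _ lim sl])
      show "\<forall>k. r k \<in> {0..1}" using r S by blast
      show "\<forall>k. s k \<in> {0..1}" "\<forall>k. r k \<noteq> s k" using s by metis+
    qed
    moreover have "(\<lambda>k. (?f (s k) - ?f (r k)) / (s k - r k) - g (r k)) \<longlonglongrightarrow> 0"
      by (rule tendsto_0_if_abs_less) (use s in blast)
    ultimately have "(\<lambda>k. (?f (s k) - ?f (r k)) / (s k - r k) - ((?f (s k) - ?f (r k)) / (s k - r k) - g (r k))) \<longlonglongrightarrow> g t - 0"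
      by (rule tendsto_diff)
    then show "(\<lambda>k. g (r k)) \<longlonglongrightarrow> g t" by simp
  qed
  moreover have "(?f has_real_derivative g t) (at t within {0..1})" if "t \<in> S" for t
    using der[OF that] unfolding has_field_derivative_iff .
  ultimately show ?thesis by blast
qed

section \<open>The Finsler metric of the atlas and lengths of C1 curves\<close>

context
  fixes n :: nat
  assumes cover: "\<forall>x::'a. \<exists>V \<psi>. good_chart n V \<psi> \<and> x \<in> V"
begin

lemma chart_at: obtains V \<psi> where "good_chart n V \<psi>" "(x::'a) \<in> V"
  using cover[THEN spec, of x] by (elim exE conjE)

lemma represents_unique:
  fixes x :: 'a
  assumes "represents n x \<xi> c v" "represents n x \<xi> d w" shows "v = w" "c = d"
proof -
  obtain V \<psi> where V: "good_chart n V \<psi>" "x \<in> V" by (rule chart_at)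
  have "tvec x c v" "tvec x d w" "\<And>i. i < n \<Longrightarrow> v (\<lambda>y. \<psi> y i) = w (\<lambda>y. \<psi> y i)"
    using assms V unfolding represents_def by auto
  then show "v = w" "c = d" using good_chart_tvec_unique[OF V] by blast+
qed

lemma finsler_eq: "represents n x \<xi> c v \<Longrightarrow> finsler n (x, \<xi>) = c"
  unfolding finsler_def prod.case using represents_unique(2) by (intro the_equality) blast+

text \<open>The coordinates in one chart determine a derivation; the Jacobian law built into
  \<open>tangent_space\<close> is \<open>tvec_chart_formula\<close>, so the coordinates in all other
  charts agree too.\<close>

lemma tangent_represents:
  fixes x :: 'a
  assumes \<xi>: "\<xi> \<in> tangent_space n (charts n) x"
  shows "\<exists>c v. represents n x \<xi> c v"
proof -
  obtain V \<psi> where V: "good_chart n V \<psi>" "x \<in> V" by (rule chart_at)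
  obtain c v where v: "tvec x c v" "\<forall>i<n. v (\<lambda>y. \<psi> y i) = \<xi> (V, \<psi>) i" using chart_vector[OF V] by blast
  have "v (\<lambda>y. \<psi>' y i) = \<xi> (V', \<psi>') i" if V': "good_chart n V' \<psi>'" "x \<in> V'" and i: "i < n" for V' \<psi>' i
  proof -
    have "(V, \<psi>) \<in> charts n" "(V', \<psi>') \<in> charts n" using V V' unfolding charts_def by auto
    then have "\<xi> (V', \<psi>') i = (\<Sum>j<n. partial_deriv j (\<lambda>y. transition (V, \<psi>) (V', \<psi>') y i) (snd (V, \<psi>) x) * \<xi> (V, \<psi>) j)"
      using \<xi> V(2) V'(2) i unfolding tangent_space_def by fastforce
    also have "\<dots> = (\<Sum>j<n. partial_deriv j (\<lambda>a. \<psi>' (inv_into V \<psi> a) i) (\<psi> x) * v (\<lambda>y. \<psi> y j))"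
      using v(2) unfolding transition_def chart_inv_def by (intro sum.cong) auto
    also have "\<dots> = v (\<lambda>y. \<psi>' y i)"
      using tvec_chart_formula[OF V good_chart_regular_at[OF V' i] v(1)] by simp
    finally show ?thesis by simp
  qed
  then show ?thesis unfolding represents_def using v(1) by blast
qed

lemma represents_add:
  fixes x :: 'a
  assumes "represents n x \<xi> c v" "represents n x \<eta> d w"
  shows "\<exists>e. e \<le> c + d \<and> represents n x (\<lambda>c i. \<xi> c i + \<eta> c i) e (\<lambda>u. v u + w u)"
proof -
  have "tvec x c v" "tvec x d w" using assms unfolding represents_def by auto
  from tvec_add[OF this] obtain e where "tvec x e (\<lambda>u. v u + w u)" "e \<le> c + d" by blast
  then show ?thesis using assms unfolding represents_def by auto
qed

lemma represents_scale:
  assumes "represents n x \<xi> c v" shows "represents n x (\<lambda>c i. a * \<xi> c i) (\<bar>a\<bar> * c) (\<lambda>u. a * v u)"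
  using assms tvec_scale unfolding represents_def by auto

lemma finsler_metric_finsler: "finsler_metric n (charts n) (finsler n)"
  unfolding finsler_metric_def
proof (intro allI ballI conjI)
  fix x \<xi> assume \<xi>: "\<xi> \<in> tangent_space n (charts n) (x::'a)"
  obtain c v where v: "represents n x \<xi> c v" using tangent_represents[OF \<xi>] by blast
  then have tv: "tvec x c v" unfolding represents_def by blast
  show "0 \<le> finsler n (x, \<xi>)" unfolding finsler_eq[OF v] using tvec_ge0[OF tv] .
  show "finsler n (x, \<lambda>c i. a * \<xi> c i) = \<bar>a\<bar> * finsler n (x, \<xi>)" for a
    unfolding finsler_eq[OF v] finsler_eq[OF represents_scale[OF v]] ..
  show "finsler n (x, \<xi>) = 0 \<longleftrightarrow> \<xi> = (\<lambda>c i. 0)"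
  proof
    assume "finsler n (x, \<xi>) = 0"
    then have "c = 0" unfolding finsler_eq[OF v] .
    then have v0: "v u = 0" for u using tvec_0 tv by blast
    show "\<xi> = (\<lambda>c i. 0)"
    proof (intro ext)
      fix ch i
      show "\<xi> ch i = 0"
      proof (cases "ch \<in> charts n \<and> x \<in> fst ch")
        case True
        then obtain V \<psi> where V: "ch = (V, \<psi>)" "good_chart n V \<psi>" "x \<in> V" unfolding charts_def by auto
        show ?thesis
        proof (cases "i < n")
          case i: True
          then show ?thesis using v V v0 unfolding represents_def by auto
        next
          case False
          have "\<xi> ch \<in> topspace (Euclidean_space n)" using tangent_spaceD[OF \<xi>, of ch] True by simp
          then show ?thesis using False by (simp add: topspace_Euclidean_space)
        qed
      next
        case False
        then have "\<xi> ch = (\<lambda>_. 0)" using tangent_spaceD[OF \<xi>, of ch] by (simp only: if_False)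
        then show ?thesis by simp
      qed
    qed
  next
    assume "\<xi> = (\<lambda>c i. 0)"
    then have "represents n x \<xi> 0 (\<lambda>u. 0)" unfolding represents_def using tvec_0_exists by auto
    then show "finsler n (x, \<xi>) = 0" by (rule finsler_eq)
  qed
  fix \<eta> assume \<eta>: "\<eta> \<in> tangent_space n (charts n) x"
  obtain d w where w: "represents n x \<eta> d w" using tangent_represents[OF \<eta>] by blast
  obtain e where e: "e \<le> c + d" "represents n x (\<lambda>c i. \<xi> c i + \<eta> c i) e (\<lambda>u. v u + w u)"
    using represents_add[OF v w] by blast
  show "finsler n (x, \<lambda>c i. \<xi> c i + \<eta> c i) \<le> finsler n (x, \<xi>) + finsler n (x, \<eta>)"
    unfolding finsler_eq[OF v] finsler_eq[OF w] finsler_eq[OF e(2)] by (rule e(1))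
qed

lemma finsler_chart_norm:
  fixes x :: 'a
  assumes g: "good_chart n V \<psi>" "x \<in> V" and r: "represents n x \<xi> c v" and w: "\<And>i. i < n \<Longrightarrow> w i = \<xi> (V, \<psi>) i"
  shows "finsler n (x, \<xi>) = chart_norm n V \<psi> (\<psi> x, w)"
proof -
  have "tvec x c v" "\<And>i. i < n \<Longrightarrow> v (\<lambda>y. \<psi> y i) = w i" using r g w unfolding represents_def by auto
  then show ?thesis using finsler_eq[OF r] chart_norm_eq[OF g] by metis
qed

text \<open>Continuity is local: the preimage of \<open>S\<close> is the union over all charts of
  the generating open sets given by preimages under \<open>chart_norm\<close>.\<close>

lemma continuous_finsler: "continuous_map (tangent_topology n (charts n)) euclideanreal (finsler n)"
proof -
  let ?gen = "\<lambda>c W. {(x, \<xi>) \<in> tangent_bundle n (charts n). x \<in> fst c \<and> (snd c x, \<xi> c) \<in> W}"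
  let ?E = "{x::nat \<Rightarrow> real. \<forall>i\<ge>n. x i = 0}"
  have op: "openin (tangent_topology n (charts n)) (?gen c W)"
    if "c \<in> charts n" "openin (prod_topology (Euclidean_space n) (Euclidean_space n)) W" for c W
    unfolding tangent_topology_def by (rule topology_generated_by_Basis) (use that in blast)
  have prod: "prod_topology (Euclidean_space n) (Euclidean_space n) = top_of_set (?E \<times> ?E)"
    unfolding Euclidean_space_eq by (rule prod_topology_subtopology_eu)
  have coord: "\<xi> c \<in> ?E" if "\<xi> \<in> tangent_space n (charts n) x" "c \<in> charts n" "x \<in> fst c" for \<xi> c and x :: 'a
  proof -
    have "\<xi> c \<in> topspace (Euclidean_space n)" using tangent_spaceD[OF that(1), of c] that(2,3) by simp
    then show ?thesis by (simp add: topspace_Euclidean_space)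
  qed
  have top: "topspace (tangent_topology n (charts n)) = tangent_bundle n (charts n :: 'a chart set)"
  proof
    show "topspace (tangent_topology n (charts n)) \<subseteq> tangent_bundle n (charts n :: 'a chart set)"
      unfolding tangent_topology_def topology_generated_by_topspace by auto
    show "tangent_bundle n (charts n) \<subseteq> topspace (tangent_topology n (charts n :: 'a chart set))"
    proof
      fix p assume p: "p \<in> tangent_bundle n (charts n :: 'a chart set)"
      obtain x \<xi> where x: "p = (x, \<xi>)" by force
      obtain V \<psi> where V: "good_chart n V \<psi>" "x \<in> V" by (rule chart_at)
      have c: "(V, \<psi>) \<in> charts n" using V unfolding charts_def by auto
      have "\<xi> \<in> tangent_space n (charts n) x" using p x unfolding tangent_bundle_def by auto
      then have "\<xi> (V, \<psi>) \<in> ?E" using coord c V(2) by auto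
      moreover have "\<psi> x \<in> ?E" using good_chartD(2)[OF V(1)] by auto
      ultimately have "p \<in> ?gen (V, \<psi>) (?E \<times> ?E)" using p x V(2) by auto
      moreover have "openin (prod_topology (Euclidean_space n) (Euclidean_space n)) (?E \<times> ?E)" unfolding prod by simp
      ultimately show "p \<in> topspace (tangent_topology n (charts n))" using op[OF c] openin_subset by blast
    qed
  qed
  show ?thesis
    unfolding continuous_map_def
  proof (intro conjI allI impI)
    show "finsler n \<in> topspace (tangent_topology n (charts n)) \<rightarrow> topspace euclideanreal" by simp
    fix S :: "real set" assume S: "openin euclideanreal S"
    define Wc where "Wc c = {p \<in> snd c ` fst c \<times> ?E. chart_norm n (fst c) (snd c) p \<in> S}" for c :: "'a chart"
    have opW: "openin (prod_topology (Euclidean_space n) (Euclidean_space n)) (Wc c)" if "c \<in> charts n" for c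
    proof -
      obtain V \<psi> where c: "c = (V, \<psi>)" "good_chart n V \<psi>" using \<open>c \<in> charts n\<close> unfolding charts_def by auto
      have 1: "openin (top_of_set (\<psi> ` V \<times> ?E)) ((\<psi> ` V \<times> ?E) \<inter> chart_norm n V \<psi> -` S)"
        using chart_norm_continuous[OF c(2)] S by (intro continuous_openin_preimage_gen) auto
      have 2: "openin (top_of_set (?E \<times> ?E)) (\<psi> ` V \<times> ?E)"
        using good_chartD(3)[OF c(2)] unfolding Euclidean_space_eq by (intro openin_Times) auto
      have "Wc c = (\<psi> ` V \<times> ?E) \<inter> chart_norm n V \<psi> -` S" unfolding Wc_def c by auto
      then show ?thesis using openin_trans[OF 1 2] unfolding prod by simp
    qed
    have "{p \<in> topspace (tangent_topology n (charts n)). finsler n p \<in> S} = (\<Union>c\<in>charts n. ?gen c (Wc c))"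
      unfolding top
    proof (intro equalityI subsetI)
      fix p assume "p \<in> {p \<in> tangent_bundle n (charts n). finsler n p \<in> S}"
      then have p: "p \<in> tangent_bundle n (charts n)" "finsler n p \<in> S" by auto
      obtain x \<xi> where x: "p = (x, \<xi>)" by force
      obtain V \<psi> where V: "good_chart n V \<psi>" "x \<in> V" by (rule chart_at)
      have c: "(V, \<psi>) \<in> charts n" using V unfolding charts_def by auto
      have \<xi>: "\<xi> \<in> tangent_space n (charts n) x" using p x unfolding tangent_bundle_def by auto
      obtain d v where r: "represents n x \<xi> d v" using tangent_represents[OF \<xi>] by blast
      have "finsler n (x, \<xi>) = chart_norm n V \<psi> (\<psi> x, \<xi> (V, \<psi>))" by (rule finsler_chart_norm[OF V r]) simp
      moreover have "\<xi> (V, \<psi>) \<in> ?E" using coord[OF \<xi> c] V(2) by auto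
      ultimately have "(snd (V, \<psi>) x, \<xi> (V, \<psi>)) \<in> Wc (V, \<psi>)" using p(2) x V(2) unfolding Wc_def by auto
      then have "p \<in> ?gen (V, \<psi>) (Wc (V, \<psi>))" using p(1) x V(2) by auto
      then show "p \<in> (\<Union>c\<in>charts n. ?gen c (Wc c))" using c by blast
    next
      fix p assume "p \<in> (\<Union>c\<in>charts n. ?gen c (Wc c))"
      then obtain c where c: "c \<in> charts n" "p \<in> ?gen c (Wc c)" by blast
      obtain V \<psi> where V: "c = (V, \<psi>)" "good_chart n V \<psi>" using c(1) unfolding charts_def by auto
      obtain x \<xi> where x: "p = (x, \<xi>)" by force
      have \<xi>: "\<xi> \<in> tangent_space n (charts n) x" and xV: "x \<in> V" and W: "(\<psi> x, \<xi> (V, \<psi>)) \<in> Wc (V, \<psi>)" and pT: "p \<in> tangent_bundle n (charts n)"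
        using c(2) x V unfolding tangent_bundle_def by auto
      obtain d v where r: "represents n x \<xi> d v" using tangent_represents[OF \<xi>] by blast
      have "finsler n (x, \<xi>) = chart_norm n V \<psi> (\<psi> x, \<xi> (V, \<psi>))" by (rule finsler_chart_norm[OF V(2) xV r]) simp
      then show "p \<in> {p \<in> tangent_bundle n (charts n). finsler n p \<in> S}" using W pT x unfolding Wc_def by auto
    qed
    moreover have "openin (tangent_topology n (charts n)) (\<Union>c\<in>charts n. ?gen c (Wc c))"
      using op opW by (intro openin_Union) blast
    ultimately show "openin (tangent_topology n (charts n)) {p \<in> topspace (tangent_topology n (charts n)). finsler n p \<in> S}"
      by simp
  qed
qed

abbreviation speed :: "(real \<Rightarrow> 'a) \<Rightarrow> real \<Rightarrow> real" where
  "speed c t \<equiv> finsler n (c t, velocity n (charts n) c t)"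

lemma C1_curve_chart:
  assumes c: "C1_curve n (charts n) c" and V: "good_chart n V (\<psi> :: 'a \<Rightarrow> nat \<Rightarrow> real)" and i: "i < n"
  shows "\<exists>g. continuous_on {t\<in>{0..1}. c t \<in> V} g \<and>
    (\<forall>t\<in>{0..1}. c t \<in> V \<longrightarrow> ((\<lambda>s. \<psi> (c s) i) has_real_derivative g t) (at t within {0..1}) \<and>
      velocity n (charts n) c t (V, \<psi>) i = g t)"
proof -
  have ch: "(V, \<psi>) \<in> charts n" using V unfolding charts_def by auto
  have "\<forall>(U, \<phi>)\<in>charts n. \<forall>i<n. \<exists>g. continuous_on {t\<in>{0..1}. c t \<in> U} g \<and>
        (\<forall>t\<in>{0..1}. c t \<in> U \<longrightarrow> ((\<lambda>s. \<phi> (c s) i) has_real_derivative g t) (at t within {0..1}))"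
    using c unfolding C1_curve_def by blast
  from bspec[OF this ch] i obtain g where g: "continuous_on {t\<in>{0..1}. c t \<in> V} g"
    "\<forall>t\<in>{0..1}. c t \<in> V \<longrightarrow> ((\<lambda>s. \<psi> (c s) i) has_real_derivative g t) (at t within {0..1})" by auto
  have "velocity n (charts n) c t (V, \<psi>) i = g t" if t: "t \<in> {0..1}" "c t \<in> V" for t
  proof -
    have "((\<lambda>s. \<psi> (c s) i) has_vector_derivative g t) (at t within {0..1})"
      using g(2) t has_real_derivative_iff_has_vector_derivative by blast
    then have "vector_derivative (\<lambda>s. \<psi> (c s) i) (at t within {0..1}) = g t"
      using vector_derivative_within_cbox[of 0 1 t] t by (simp add: cbox_interval)
    then show ?thesis unfolding velocity_def using ch t i by simp
  qed
  then show ?thesis using g by blast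
qed

text \<open>The velocity in one chart fixes a derivation. Its values on regular functions are limits
  of difference quotients along the curve, and these give the velocity in every other chart without
  any Jacobian. The same limit theorem identifies its length with the metric speed.\<close>

lemma C1_curve_speed:
  assumes c: "C1_curve n (charts n) c" and t: "t \<in> {0..1}"
  shows "\<exists>v. represents n (c t) (velocity n (charts n) c t) (speed c t) v"
    and "((\<lambda>s. dist (c t) (c s) / \<bar>s - t\<bar>) \<longlongrightarrow> speed c t) (at t within {0..1})"
proof -
  obtain V \<psi> where V: "good_chart n V \<psi>" "c t \<in> V" by (rule chart_at)
  let ?\<xi> = "velocity n (charts n) c t"
  obtain d v where v: "tvec (c t) d v" "\<forall>i<n. v (\<lambda>y. \<psi> y i) = ?\<xi> (V, \<psi>) i" using chart_vector[OF V] by blast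
  have quot: "(\<lambda>k. (\<phi> (c (X k)) i - \<phi> (c t) i) / (X k - t)) \<longlonglongrightarrow> ?\<xi> (U, \<phi>) i"
    if X: "\<forall>k. X k \<in> {0..1} - {t}" "X \<longlonglongrightarrow> t" and U: "good_chart n U \<phi>" "c t \<in> U" and i: "i < n" for X U \<phi> i
  proof -
    have "((\<lambda>s. \<phi> (c s) i) has_real_derivative ?\<xi> (U, \<phi>) i) (at t within {0..1})"
      using C1_curve_chart[OF c U(1) i] t U(2) by auto
    then have "((\<lambda>s. (\<phi> (c s) i - \<phi> (c t) i) / (s - t)) \<longlongrightarrow> ?\<xi> (U, \<phi>) i) (at t within {0..1})"
      unfolding has_field_derivative_iff .
    then show ?thesis using X unfolding tendsto_at_iff_sequentially o_def by blast
  qed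
  have cl: "(\<lambda>k. c (X k)) \<longlonglongrightarrow> c t" if X: "\<forall>k. X k \<in> {0..1} - {t}" "X \<longlonglongrightarrow> t" for X
  proof -
    have "continuous_on {0..1} c" using c unfolding C1_curve_def by blast
    then show ?thesis using X t by (intro continuous_on_tendsto_compose[of "{0..1}" c X t]) auto
  qed
  have lims: "(\<lambda>k. dist (c t) (c (X k)) / \<bar>X k - t\<bar>) \<longlonglongrightarrow> d"
     "\<And>u. regular_at (c t) u \<Longrightarrow> (\<lambda>k. (u (c (X k)) - u (c t)) / (X k - t)) \<longlonglongrightarrow> v u"
    if X: "\<forall>k. X k \<in> {0..1} - {t}" "X \<longlonglongrightarrow> t" for X
  proof -
    have X0: "\<And>k. X k - t \<noteq> 0" using X(1) by auto
    have X1: "(\<lambda>k. X k - t) \<longlonglongrightarrow> 0" using tendsto_diff[OF X(2) tendsto_const[of t]] by simp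
    have X2: "(\<lambda>k. (\<psi> (c (X k)) i - \<psi> (c t) i) / (X k - t)) \<longlonglongrightarrow> v (\<lambda>y. \<psi> y i)" if "i < n" for i
      using quot[OF X V that] v(2) that by simp
    show "(\<lambda>k. dist (c t) (c (X k)) / \<bar>X k - t\<bar>) \<longlonglongrightarrow> d"
      by (rule chart_limit(1)[OF V tendsto_const cl[OF X] X0 X1 v(1) X2])
    show "(\<lambda>k. (u (c (X k)) - u (c t)) / (X k - t)) \<longlonglongrightarrow> v u" if "regular_at (c t) u" for u
      by (rule chart_limit(2)[OF V tendsto_const cl[OF X] X0 X1 v(1) X2 that])
  qed
  have "t islimpt {0..1}" using islimpt_Icc[of 0 1 t] t by simp
  then obtain X where X: "\<forall>k. X k \<in> {0..1} - {t}" "X \<longlonglongrightarrow> t" unfolding islimpt_sequential by blast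
  have r: "represents n (c t) ?\<xi> d v"
    unfolding represents_def
  proof (intro conjI allI impI)
    show "tvec (c t) d v" by (rule v)
    fix U \<phi> i assume U: "good_chart n U \<phi> \<and> c t \<in> U" and i: "i < n"
    have "regular_at (c t) (\<lambda>y. \<phi> y i)" using good_chart_regular_at U i by blast
    from lims(2)[OF X this] show "v (\<lambda>y. \<phi> y i) = ?\<xi> (U, \<phi>) i"
      by (rule LIMSEQ_unique) (rule quot[OF X conjunct1[OF U] conjunct2[OF U] i])
  qed
  then show "\<exists>v. represents n (c t) ?\<xi> (speed c t) v" unfolding finsler_eq[OF r] by blast
  show "((\<lambda>s. dist (c t) (c s) / \<bar>s - t\<bar>) \<longlongrightarrow> speed c t) (at t within {0..1})"
    unfolding finsler_eq[OF r] tendsto_at_iff_sequentially o_def using lims(1) by blast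
qed

lemma speed_continuous:
  assumes c: "C1_curve n (charts n) c" shows "continuous_on {0..1} (speed c)"
proof (rule continuous_on_sequentiallyI)
  fix s :: "nat \<Rightarrow> real" and t assume s: "\<forall>k. s k \<in> {0..1}" and t: "t \<in> {0..1}" and lim: "s \<longlonglongrightarrow> t"
  obtain V \<psi> where V: "good_chart n V \<psi>" "c t \<in> V" by (rule chart_at)
  define w where "w t i = (if i < n then velocity n (charts n) c t (V, \<psi>) i else 0)" for t i
  have eq: "speed c r = chart_norm n V \<psi> (\<psi> (c r), w r)" if r: "r \<in> {0..1}" "c r \<in> V" for r
  proof -
    obtain v where v: "represents n (c r) (velocity n (charts n) c r) (speed c r) v"
      using C1_curve_speed(1)[OF c r(1)] by blast
    show ?thesis by (rule finsler_chart_norm[OF V(1) r(2) v]) (simp add: w_def)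
  qed
  have "continuous_on {0..1} c" using c unfolding C1_curve_def by blast
  then have cl: "(\<lambda>k. c (s k)) \<longlonglongrightarrow> c t" using s t lim by (intro continuous_on_tendsto_compose[of "{0..1}" c s t]) auto
  then have inV: "\<forall>\<^sub>F k in sequentially. c (s k) \<in> V" using V good_chartD(1) topological_tendstoD by blast
  have "(\<lambda>k. w (s k)) \<longlonglongrightarrow> w t"
  proof (rule tendsto_coordinatewise)
    fix i
    show "(\<lambda>k. w (s k) i) \<longlonglongrightarrow> w t i"
    proof (cases "i < n")
      case True
      obtain g where g: "continuous_on {t\<in>{0..1}. c t \<in> V} g"
        "\<forall>t\<in>{0..1}. c t \<in> V \<longrightarrow> ((\<lambda>s. \<psi> (c s) i) has_real_derivative g t) (at t within {0..1}) \<and>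
          velocity n (charts n) c t (V, \<psi>) i = g t"
        using C1_curve_chart[OF c V(1) True] by blast
      have "(\<lambda>k. g (s k)) \<longlonglongrightarrow> g t"
      proof (rule continuous_on_tendsto_compose[OF g(1) lim])
        show "t \<in> {t \<in> {0..1}. c t \<in> V}" using t V by simp
        show "\<forall>\<^sub>F k in sequentially. s k \<in> {t \<in> {0..1}. c t \<in> V}" using inV by eventually_elim (use s in auto)
      qed
      moreover have "\<forall>\<^sub>F k in sequentially. g (s k) = w (s k) i"
        using inV by eventually_elim (use s g(2) True in \<open>auto simp: w_def\<close>)
      moreover have "g t = w t i" using t V g(2) True by (auto simp: w_def)
      ultimately show ?thesis using Lim_transform_eventually by fastforce
    qed (simp add: w_def)
  qed
  moreover have "(\<lambda>k. \<psi> (c (s k))) \<longlonglongrightarrow> \<psi> (c t)"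
    by (rule continuous_on_tendsto_compose[OF good_chart_continuous[OF V(1)] cl V(2) inV])
  ultimately have "(\<lambda>k. (\<psi> (c (s k)), w (s k))) \<longlonglongrightarrow> (\<psi> (c t), w t)" by (rule tendsto_Pair[rotated])
  then have "(\<lambda>k. chart_norm n V \<psi> (\<psi> (c (s k)), w (s k))) \<longlonglongrightarrow> chart_norm n V \<psi> (\<psi> (c t), w t)"
  proof (rule continuous_on_tendsto_compose[OF chart_norm_continuous[OF V(1)]])
    show "(\<psi> (c t), w t) \<in> \<psi> ` V \<times> {w. \<forall>i\<ge>n. w i = 0}" using V by (auto simp: w_def)
    show "\<forall>\<^sub>F k in sequentially. (\<psi> (c (s k)), w (s k)) \<in> \<psi> ` V \<times> {w. \<forall>i\<ge>n. w i = 0}"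
      using inV by eventually_elim (auto simp: w_def)
  qed
  moreover have "\<forall>\<^sub>F k in sequentially. chart_norm n V \<psi> (\<psi> (c (s k)), w (s k)) = speed c (s k)"
    using inV by eventually_elim (use eq s in simp)
  ultimately show "(\<lambda>k. speed c (s k)) \<longlonglongrightarrow> speed c t"
    using Lim_transform_eventually eq[OF t V(2)] by fastforce
qed

text \<open>An estimate with error \<open>e * (b - a)\<close> is additive over adjacent intervals,
  so bisection reduces it to short intervals around a single time, where the speed is nearly
  constant.\<close>

lemma dist_le_length:
  assumes c: "C1_curve n (charts n) c" shows "dist (c 0) (c 1) \<le> integral {0..1} (speed c)"
proof (rule field_le_epsilon)
  fix e :: real assume e: "e > 0"
  have int: "speed c integrable_on {a..b}" if "0 \<le> a" "b \<le> 1" for a b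
    by (rule integrable_continuous_real[OF continuous_on_subset[OF speed_continuous[OF c]]]) (use that in auto)
  define P where "P a b \<longleftrightarrow> (0 \<le> a \<and> b \<le> 1 \<longrightarrow> dist (c a) (c b) \<le> integral {a..b} (speed c) + e * (b - a))" for a b
  have "P 0 1"
  proof (rule Bolzano[of 0 1 P])
    show "(0::real) \<le> 1" by simp
  next
    fix a b c' assume trans: "P a b" "P b c'" "a \<le> b" "b \<le> c'"
    show "P a c'" unfolding P_def
    proof
      assume ac: "0 \<le> a \<and> c' \<le> 1"
      have "integral {a..b} (speed c) + integral {b..c'} (speed c) = integral {a..c'} (speed c)"
        using trans ac int by (intro Henstock_Kurzweil_Integration.integral_combine) auto
      moreover have "dist (c a) (c b) \<le> integral {a..b} (speed c) + e * (b - a)"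
        "dist (c b) (c c') \<le> integral {b..c'} (speed c) + e * (c' - b)"
        using trans ac unfolding P_def by auto
      ultimately show "dist (c a) (c c') \<le> integral {a..c'} (speed c) + e * (c' - a)"
        using dist_triangle[of "c a" "c c'" "c b"] by (simp add: algebra_simps)
    qed
  next
    fix x :: real assume "0 \<le> x" "x \<le> 1"
    then have x: "x \<in> {0..1}" by simp
    have "\<forall>\<^sub>F s in at x within {0..1}. dist (dist (c x) (c s) / \<bar>s - x\<bar>) (speed c x) < e / 2"
      using C1_curve_speed(2)[OF c x] by (rule tendstoD) (use e in simp)
    then obtain d1 where d1: "d1 > 0" "\<And>s. s \<in> {0..1} \<Longrightarrow> s \<noteq> x \<Longrightarrow> dist s x < d1 \<Longrightarrow>
        dist (dist (c x) (c s) / \<bar>s - x\<bar>) (speed c x) < e / 2"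
      unfolding eventually_at by blast
    obtain d2 where d2: "d2 > 0" "\<And>s. s \<in> {0..1} \<Longrightarrow> dist s x < d2 \<Longrightarrow> dist (speed c s) (speed c x) < e / 2"
      using speed_continuous[OF c] x e unfolding continuous_on_iff by (metis half_gt_zero_iff)
    have near: "dist (c x) (c s) \<le> (speed c x + e / 2) * \<bar>s - x\<bar>" if "s \<in> {0..1}" "dist s x < d1" for s
    proof (cases "s = x")
      case False
      have "dist (c x) (c s) / \<bar>s - x\<bar> < speed c x + e / 2"
        using d1(2)[OF that(1) False that(2)] unfolding dist_real_def by linarith
      then show ?thesis using False by (simp add: pos_divide_less_eq)
    qed simp
    \<comment> \<open>Half of the error pays for the metric derivative at \<open>x\<close>, the
      other half for the variation of the speed.\<close>
    have "P a b" if ab: "a \<le> x" "x \<le> b" "b - a < min d1 d2" for a b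
      unfolding P_def
    proof
      assume ab01: "0 \<le> a \<and> b \<le> 1"
      have "dist (c a) (c b) \<le> dist (c x) (c a) + dist (c x) (c b)"
        using dist_triangle[of "c a" "c b" "c x"] by (simp add: dist_commute)
      also have "\<dots> \<le> (speed c x + e / 2) * \<bar>a - x\<bar> + (speed c x + e / 2) * \<bar>b - x\<bar>"
        using ab ab01 by (intro add_mono near) (auto simp: dist_real_def)
      also have "\<dots> = (speed c x + e / 2) * (b - a)" using ab by (simp flip: distrib_left)
      finally have 1: "dist (c a) (c b) \<le> (speed c x + e / 2) * (b - a)" .
      have "integral {a..b} (\<lambda>_. speed c x - e / 2) \<le> integral {a..b} (speed c)"
      proof (rule integral_le)
        show "speed c integrable_on {a..b}" using int ab01 by simp
        show "(\<lambda>_. speed c x - e / 2) integrable_on {a..b}" by (rule integrable_const_ivl)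
        fix s assume s: "s \<in> {a..b}"
        then have "dist (speed c s) (speed c x) < e / 2" using ab ab01 by (intro d2(2)) (auto simp: dist_real_def)
        then show "speed c x - e / 2 \<le> speed c s" unfolding dist_real_def by linarith
      qed
      then have "(b - a) * (speed c x - e / 2) \<le> integral {a..b} (speed c)" using ab by simp
      moreover have "(speed c x + e / 2) * (b - a) = (b - a) * (speed c x - e / 2) + e * (b - a)"
        by (simp add: field_simps)
      ultimately show "dist (c a) (c b) \<le> integral {a..b} (speed c) + e * (b - a)" using 1 by linarith
    qed
    then show "\<exists>d>0. \<forall>a b. a \<le> x \<and> x \<le> b \<and> b - a < d \<longrightarrow> P a b"
      using d1(1) d2(1) by (intro exI[of _ "min d1 d2"]) auto
  qed
  then show "dist (c 0) (c 1) \<le> integral {0..1} (speed c) + e" unfolding P_def by simp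
qed

text \<open>A shortest path run proportionally to arc length. Its metric difference quotients are
  constantly \<open>D\<close>, so its speed is \<open>D\<close> at every time.\<close>

lemma length_minimizing:
  fixes p q :: 'a
  shows "\<exists>c. C1_curve n (charts n) c \<and> c 0 = p \<and> c 1 = q \<and> integral {0..1} (speed c) = dist p q"
proof -
  define D where "D = dist p q"
  obtain \<gamma> where \<gamma>: "shortest_path {0..D} \<gamma>" "\<gamma> 0 = p" "\<gamma> D = q" unfolding D_def by (rule shortest_path_exists)
  define c where "c t = \<gamma> (D * t)" for t
  have in01: "D * t \<in> {0..D}" if "t \<in> {0..1}" for t
    using that zero_le_dist[of p q] unfolding D_def[symmetric] by (simp add: mult_left_le)
  have dc: "dist (c s) (c t) = D * \<bar>s - t\<bar>" if "s \<in> {0..1}" "t \<in> {0..1}" for s t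
  proof -
    have "dist (c s) (c t) = \<bar>D * s - D * t\<bar>" unfolding c_def using in01 that by (intro shortest_path_dist[OF \<gamma>(1)])
    also have "\<dots> = D * \<bar>s - t\<bar>" using zero_le_dist[of p q] unfolding D_def[symmetric] by (simp add: abs_mult flip: right_diff_distrib)
    finally show ?thesis .
  qed
  have cont: "continuous_on {0..1} c"
    unfolding c_def by (rule continuous_on_compose2[OF shortest_path_continuous_on[OF \<gamma>(1)]])
      (use in01 in \<open>auto intro!: continuous_intros\<close>)
  have C1: "C1_curve n (charts n) c"
    unfolding C1_curve_def
  proof (intro conjI ballI cont)
    fix ch :: "'a chart" assume "ch \<in> charts n"
    then obtain V \<psi> where V: "ch = (V, \<psi>)" "good_chart n V \<psi>" unfolding charts_def by auto
    have "\<exists>g. continuous_on {t \<in> {0..1}. c t \<in> V} g \<and>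
       (\<forall>t\<in>{0..1}. c t \<in> V \<longrightarrow> ((\<lambda>s. \<psi> (c s) i) has_real_derivative g t) (at t within {0..1}))" if i: "i < n" for i
    \<comment> \<open>Equal endpoints give a constant curve, treated apart because
      \<open>shortest_path_C1\<close> asks for positive length.\<close>
    proof (cases "D = 0")
      case True
      then have "(\<lambda>s. \<psi> (c s) i) = (\<lambda>s. \<psi> (\<gamma> 0) i)" unfolding c_def by simp
      then show ?thesis by (intro exI[of _ "\<lambda>_. 0"]) auto
    next
      case False
      then have D0: "D > 0" unfolding D_def by simp
      have "regular_at (\<gamma> (D * t)) (\<lambda>y. \<psi> y i)" if "t \<in> {t \<in> {0..1}. c t \<in> V}" for t
        using good_chart_regular_at[OF V(2) _ i] that unfolding c_def by simp
      moreover have "{t \<in> {0..1}. c t \<in> V} \<subseteq> {0..1}" by auto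
      ultimately obtain g where "continuous_on {t \<in> {0..1}. c t \<in> V} g"
        "\<forall>t\<in>{t \<in> {0..1}. c t \<in> V}. ((\<lambda>s. \<psi> (\<gamma> (D * s)) i) has_real_derivative g t) (at t within {0..1})"
        using shortest_path_C1[OF \<gamma>(1) D0, of "{t \<in> {0..1}. c t \<in> V}" "\<lambda>y. \<psi> y i"] by blast
      then show ?thesis by (intro exI[of _ g]) (simp add: c_def)
    qed
    then show "case ch of (U, \<phi>) \<Rightarrow> \<forall>i<n. \<exists>g. continuous_on {t \<in> {0..1}. c t \<in> U} g \<and>
       (\<forall>t\<in>{0..1}. c t \<in> U \<longrightarrow> ((\<lambda>s. \<phi> (c s) i) has_real_derivative g t) (at t within {0..1}))"
      unfolding V by simp
  qed
  have "speed c t = D" if t: "t \<in> {0..1}" for t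
  proof (rule tendsto_unique)
    show "at t within {0..1} \<noteq> bot" using islimpt_Icc[of 0 1 t] t by (simp add: trivial_limit_within)
    show "((\<lambda>s. dist (c t) (c s) / \<bar>s - t\<bar>) \<longlongrightarrow> speed c t) (at t within {0..1})" by (rule C1_curve_speed(2)[OF C1 t])
    have "\<forall>\<^sub>F s in at t within {0..1}. dist (c t) (c s) / \<bar>s - t\<bar> = D"
      unfolding eventually_at_filter using dc[OF t] by (intro always_eventually) (auto simp: abs_minus_commute)
    then show "((\<lambda>s. dist (c t) (c s) / \<bar>s - t\<bar>) \<longlongrightarrow> D) (at t within {0..1})" by (rule tendsto_eventually)
  qed
  then have "integral {0..1} (speed c) = integral {0..1} (\<lambda>t::real. D)" by (intro integral_cong) auto
  then have len: "integral {0..1} (speed c) = dist p q" by (simp add: D_def)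
  have ends: "c 0 = p" "c 1 = q" using \<gamma>(2,3) unfolding c_def by simp_all
  show ?thesis by (rule exI[of _ c]) (intro conjI C1 ends len)
qed

lemma compatible_finsler: "compatible_with_dist n (charts n) (finsler n)"
  unfolding compatible_with_dist_def
proof (intro allI)
  fix p q :: 'a
  show "ereal (dist p q) = (INF c\<in>{c. C1_curve n (charts n) c \<and> c 0 = p \<and> c 1 = q}. ereal (integral {0..1} (speed c)))"
  proof (rule antisym)
    show "ereal (dist p q) \<le> (INF c\<in>{c. C1_curve n (charts n) c \<and> c 0 = p \<and> c 1 = q}. ereal (integral {0..1} (speed c)))"
      by (rule INF_greatest) (use dist_le_length in auto)
    obtain c where c: "C1_curve n (charts n) c \<and> c 0 = p \<and> c 1 = q" "integral {0..1} (speed c) = dist p q"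
      using length_minimizing by blast
    then have "(INF c\<in>{c. C1_curve n (charts n) c \<and> c 0 = p \<and> c 1 = q}. ereal (integral {0..1} (speed c))) \<le> ereal (integral {0..1} (speed c))"
      by (intro INF_lower) simp
    then show "(INF c\<in>{c. C1_curve n (charts n) c \<and> c 0 = p \<and> c 1 = q}. ereal (integral {0..1} (speed c))) \<le> ereal (dist p q)"
      using c(2) by simp
  qed
qed

end

end

theorem theorem1p2:
  assumes "G_space TYPE('a::metric_space)"
    and "locally_semiconvex TYPE('a)"
    and "locally_differentiable TYPE('a)"
  shows "\<exists>n. topological_manifold n (euclidean :: 'a topology) \<and>
    (\<exists>A :: 'a chart set. C1_atlas n A \<and> DC_atlas n A \<and> canonical_atlas n A \<and>
      (\<exists>F. continuous_finsler_metric n A F \<and> compatible_with_dist n A F))"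
proof -
  interpret semiconvex_gspace "TYPE('a)" using assms by unfold_locales
  obtain n where n: "\<forall>x::'a. \<exists>V \<psi>. good_chart n V \<psi> \<and> x \<in> V"
    using good_chart_dimension_constant by (elim exE)
  have "continuous_finsler_metric n (charts n) (finsler n)"
    unfolding continuous_finsler_metric_def using finsler_metric_finsler[OF n] continuous_finsler[OF n] by simp
  then show ?thesis
    using topological_manifold_charts[OF n] C1_atlas_charts[OF n] DC_atlas_charts[OF n]
      canonical_atlas_charts[OF n] compatible_finsler[OF n] by blast
qed

end
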